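(* Let $K$ be a p.c.f. self-similar set with Hausdorff dimension $\alpha$ and walk dimension $\beta$, and let $K_n$ ($0\le n\le\infty$) be the bounded ($n<\infty$) and unbounded ($n=\infty$) p.c.f. self-similar sets induced by $K$, with Dirichlet form $(\mathcal{E}^{(n)},\mathcal{F}^{(n)})$ on $L^2(K_n,m)$. Then the H\"older regularity condition holds on $K_n$: there exists $C>0$ such that for every ball $B=B(x_0,r)$ in $K_n$ ($x_0\in K_n$, $r>0$), every $u\in\mathcal{F}^{(n)}$ harmonic in $2B=B(x_0,2r)$, and $m$-a.e. $x,y\in B$ with $x\neq y$, $$\frac{|u(x)-u(y)|}{d(x,y)^{\beta-\alpha}}\le\frac{C}{r^{\beta-\alpha}}\,\frac{1}{m(2B)}\int_{2B}|u|\,dm .$$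
   Context: **The fractal.** Let $M\ge 2$, $\rho\in(0,1)$, $F_i(x)=\rho x+a_i$ on $\mathbb{R}^d$ ($a_i\in\mathbb{R}^d$, $1\le i\le M$), and let $K$ be the unique non-empty compact set with $K=\bigcup_{i=1}^M F_i(K)$. Let $S=\{1,\dots,M\}$, $W_m=S^m$ for $m\ge1$; $W_0$ consists of a single (empty) word with $F_w=\mathrm{id}$, $r_w=1$. For $w=w_1\cdots w_m$ put $F_w=F_{w_1}\circ\cdots\circ F_{w_m}$. Let $\Sigma=S^{\mathbb{N}}$, let $\pi:\Sigma\to K$ be given by $\{\pi(\omega)\}=\bigcap_{m\ge1}F_{\omega_1\cdots\omega_m}K$, and let $\tau$ be the left shift on $\Sigma$. The critical set is $\mathcal{C}=\pi^{-1}\big(\bigcup_{i\ne j}(F_iK\cap F_jK)\big)$ and the post-critical set is $\mathcal{P}=\bigcup_{m\ge1}\tau^m(\mathcal{C})$. $K$ is called a p.c.f. (post-critically finite) self-similar set if $\mathcal{P}$ is finite. Throughout, $K$ is p.c.f. and connected, $\operatorname{diam}K=1$. Put $V_0=\pi(\mathcal{P})=\{p_1,\dots,p_N\}$, $V_m=\bigcup_{i}F_i(V_{m-1})$, $V_*=\bigcup_{m\ge 0}V_m$, and $\alpha=\dim_H K=-\log M/\log\rho$. **Harmonic structure and Dirichlet form on $K$.** A Laplace matrix $H$ on $V_0$ is a real symmetric matrix with $H_{pq}\ge0$ for $p\ne q$, $\langle f,Hf\rangle\le0$ for all $f:V_0\to\mathbb{R}$, and $Hf=0$ iff $f$ is constant.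 Given resistance weights $r_1,\dots,r_M>0$, put $\mathcal{E}_0(f,g)=-\langle f,Hg\rangle$ and $\mathcal{E}_m(f,g)=\sum_{w\in W_m}r_w^{-1}\mathcal{E}_0(f\circ F_w,g\circ F_w)$ with $r_w=r_{w_1}\cdots r_{w_m}$. The pair $(H,(r_i))$ is a harmonic structure if $\min\{\mathcal{E}_1(g,g):g|_{V_0}=f\}=\mathcal{E}_0(f,f)$ for all $f:V_0\to\mathbb{R}$; it is regular if all $r_i<1$. Standing assumption: $K$ is equipped with a regular harmonic structure with all $r_i$ equal. The walk dimension $\beta$ is defined by $r_i=\rho^{\beta-\alpha}$; it satisfies $2\le\beta\le\alpha+1$. The sequence $\mathcal{E}_m(f,f)$ is non-decreasing in $m$; put $\mathcal{E}(f,f)=\lim_{m\to\infty}\mathcal{E}_m(f,f)$ and $\mathcal{F}=\{f\in C(K):\mathcal{E}(f,f)<\infty\}$. **The sets $K_n$.** One of the maps is $x\mapsto\rho x$. Put $K_n=\rho^{-n}K$ for $0\le n<\infty$ and $K_\infty=\bigcup_{n\ge0}K_n$ (an increasing union). On each $K_n$, $d$ is the Euclidean metric, balls are taken with respect to $d$, and $m$ is the $\alpha$-dimensional Hausdorff measure. For $n<\infty$, the Dirichlet form on $K_n$ is the rescaled form $\mathcal{E}^{(n)}(u,u)=\rho^{n(\beta-\alpha)}\mathcal{E}(u_n,u_n)$, where $u_n(x)=u(\rho^{-n}x)$ for $x\in K$, with domain $\mathcal{F}^{(n)}=\{u\in C(K_n):u_n\in\mathcal{F}\}$. On $K_\infty$,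 $\mathcal{E}^{(\infty)}(u,u)=\lim_{n\to\infty}\mathcal{E}^{(n)}(u|_{K_n},u|_{K_n})$ (a non-decreasing limit) with domain $\mathcal{F}^{(\infty)}=\{u\in C(K_\infty)\cap L^2(K_\infty,m):\mathcal{E}^{(\infty)}(u,u)<\infty\}$. The bilinear forms are obtained by polarization. A function $u\in\mathcal{F}^{(n)}$ is harmonic in an open set $U\subseteq K_n$ if $\mathcal{E}^{(n)}(u,\varphi)=0$ for every $\varphi\in\mathcal{F}^{(n)}$ with compact support contained in $U$. *)

theory Defs
  imports
    "HOL-Analysis.Analysis"
    "HOL-Library.Stream"
    "HOL-Library.Extended_Nat"
begin

section \<open>Hausdorff measure and dimension\<close>

text \<open>
  The covering sets are required to be bounded because \<^const>\<open>diameter\<close> is meaningless on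
  unbounded sets. The definitions are meant for exponents \<open>s > 0\<close> only, since \<open>0 powr 0 = 0\<close>.
\<close>

definition hausdorff_content :: "real \<Rightarrow> real \<Rightarrow> 'a::metric_space set \<Rightarrow> ennreal" where
  "hausdorff_content s \<delta> A =
     (INF U \<in> {U :: nat \<Rightarrow> 'a set. A \<subseteq> (\<Union>i. U i) \<and> (\<forall>i. bounded (U i) \<and> diameter (U i) \<le> \<delta>)}.
        \<Sum>i. ennreal (diameter (U i) powr s))"

definition hausdorff_outer_measure :: "real \<Rightarrow> 'a::metric_space set \<Rightarrow> ennreal" where
  "hausdorff_outer_measure s A = (SUP \<delta> \<in> {0<..}. hausdorff_content s \<delta> A)"

text \<open>
  \<open>hausdorff_outer_measure s\<close> is a metric outer measure, hence countably additive on the Borel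
  sets, so that \<open>measure_of\<close> below takes its values there (and not the default value \<open>0\<close>).
\<close>

definition hausdorff_measure :: "real \<Rightarrow> 'a::metric_space measure" where
  "hausdorff_measure s = measure_of UNIV (sets borel) (hausdorff_outer_measure s)"

definition hausdorff_dim :: "'a::metric_space set \<Rightarrow> real" where
  "hausdorff_dim A = Inf {s. 0 < s \<and> hausdorff_outer_measure s A = 0}"

section \<open>The self-similar set and its post-critical set\<close>

text \<open>
  Finite words over the alphabet \<open>{1..M}\<close> are lists, infinite words are elements of
  \<open>streams {1..M}\<close>; \<open>stake m \<omega>\<close> is the prefix of length \<open>m\<close>, and \<open>sdrop m\<close> is the \<open>m\<close>-th
  iterate of the left shift.
\<close>

context
  fixes M :: nat and \<rho> :: real and a :: "nat \<Rightarrow> 'a::euclidean_space" and K :: "'a set"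
begin

definition ifs_map :: "nat \<Rightarrow> 'a \<Rightarrow> 'a" where
  "ifs_map i x = \<rho> *\<^sub>R x + a i"

definition is_attractor :: bool where
  "is_attractor \<longleftrightarrow> K \<noteq> {} \<and> compact K \<and> K = (\<Union>i\<in>{1..M}. ifs_map i ` K)"

definition word_map :: "nat list \<Rightarrow> 'a \<Rightarrow> 'a" where
  "word_map w = foldr (\<lambda>i g. ifs_map i \<circ> g) w id"

definition words :: "nat \<Rightarrow> nat list set" where
  "words m = {w. set w \<subseteq> {1..M} \<and> length w = m}"

definition coding_map :: "nat stream \<Rightarrow> 'a" where
  "coding_map \<omega> = the_elem (\<Inter>m\<in>{1..}. word_map (stake m \<omega>) ` K)"

definition critical_set :: "nat stream set" where
  "critical_set = {\<omega> \<in> streams {1..M}.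
     coding_map \<omega> \<in> (\<Union>i\<in>{1..M}. \<Union>j\<in>{1..M} - {i}. ifs_map i ` K \<inter> ifs_map j ` K)}"

definition post_critical_set :: "nat stream set" where
  "post_critical_set = (\<Union>m\<in>{1..}. sdrop m ` critical_set)"

definition post_critically_finite :: bool where
  "post_critically_finite \<longleftrightarrow> finite post_critical_set"

definition V0 :: "'a set" where
  "V0 = coding_map ` post_critical_set"

section \<open>Harmonic structure and energy on \<open>K\<close>\<close>

text \<open>
  Functions on \<open>V0\<close>, \<open>V\<^sub>m\<close> or \<open>K\<close> are represented by total functions on \<open>'a\<close>, and matrices on
  \<open>V0\<close> by functions of two arguments. Only the values on the set in question matter: the form
  \<open>energy_level m\<close> depends on its arguments only through their values on
  \<open>V\<^sub>m = (\<Union>w\<in>words m. word_map w ` V0)\<close>.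
\<close>

definition laplace_matrix :: "('a \<Rightarrow> 'a \<Rightarrow> real) \<Rightarrow> bool" where
  "laplace_matrix H \<longleftrightarrow>
     (\<forall>p\<in>V0. \<forall>q\<in>V0. H p q = H q p) \<and>
     (\<forall>p\<in>V0. \<forall>q\<in>V0. p \<noteq> q \<longrightarrow> 0 \<le> H p q) \<and>
     (\<forall>f. (\<Sum>p\<in>V0. f p * (\<Sum>q\<in>V0. H p q * f q)) \<le> 0) \<and>
     (\<forall>f. (\<forall>p\<in>V0. (\<Sum>q\<in>V0. H p q * f q) = 0) \<longleftrightarrow> f constant_on V0)"

context
  fixes H :: "'a \<Rightarrow> 'a \<Rightarrow> real"
begin

definition energy0 :: "('a \<Rightarrow> real) \<Rightarrow> ('a \<Rightarrow> real) \<Rightarrow> real" where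
  "energy0 f g = - (\<Sum>p\<in>V0. f p * (\<Sum>q\<in>V0. H p q * g q))"

context
  fixes r :: "nat \<Rightarrow> real"
begin

definition energy_level :: "nat \<Rightarrow> ('a \<Rightarrow> real) \<Rightarrow> ('a \<Rightarrow> real) \<Rightarrow> real" where
  "energy_level m f g =
     (\<Sum>w\<in>words m. inverse (prod_list (map r w)) * energy0 (f \<circ> word_map w) (g \<circ> word_map w))"

definition harmonic_structure :: bool where
  "harmonic_structure \<longleftrightarrow>
     laplace_matrix H \<and> (\<forall>i\<in>{1..M}. 0 < r i) \<and>
     (\<forall>f. (\<exists>g. (\<forall>p\<in>V0. g p = f p) \<and> energy_level 1 g g = energy0 f f) \<and>
          (\<forall>g. (\<forall>p\<in>V0. g p = f p) \<longrightarrow> energy0 f f \<le> energy_level 1 g g))"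

definition regular_harmonic_structure :: bool where
  "regular_harmonic_structure \<longleftrightarrow> harmonic_structure \<and> (\<forall>i\<in>{1..M}. r i < 1)"

text \<open>
  For a harmonic structure the sequence is non-decreasing, so this limit exists in \<^typ>\<open>ereal\<close>.
\<close>

definition energy :: "('a \<Rightarrow> real) \<Rightarrow> ereal" where
  "energy f = lim (\<lambda>m. ereal (energy_level m f f))"

definition energy_domain :: "('a \<Rightarrow> real) set" where
  "energy_domain = {f. continuous_on K f \<and> energy f < \<infinity>}"

end

end

section \<open>The sets \<open>K\<^sub>n\<close>, their measures and Dirichlet forms\<close>

definition blowup :: "enat \<Rightarrow> 'a set" where
  "blowup n = (case n of
       enat k \<Rightarrow> (\<lambda>x. inverse (\<rho> ^ k) *\<^sub>R x) ` K
     | \<infinity> \<Rightarrow> (\<Union>k. (\<lambda>x. inverse (\<rho> ^ k) *\<^sub>R x) ` K))"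

definition blowup_measure :: "real \<Rightarrow> enat \<Rightarrow> 'a measure" where
  "blowup_measure \<alpha> n = restrict_space (hausdorff_measure \<alpha>) (blowup n)"

definition rescale :: "nat \<Rightarrow> ('a \<Rightarrow> real) \<Rightarrow> 'a \<Rightarrow> real" where
  "rescale k u x = u (inverse (\<rho> ^ k) *\<^sub>R x)"

context
  fixes H :: "'a \<Rightarrow> 'a \<Rightarrow> real" and r :: "nat \<Rightarrow> real" and \<alpha> \<beta> :: real
begin

definition blowup_energy_fin :: "nat \<Rightarrow> ('a \<Rightarrow> real) \<Rightarrow> ereal" where
  "blowup_energy_fin k u = ereal (\<rho> powr (real k * (\<beta> - \<alpha>))) * energy H r (rescale k u)"

definition blowup_energy :: "enat \<Rightarrow> ('a \<Rightarrow> real) \<Rightarrow> ereal" where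
  "blowup_energy n u = (case n of
       enat k \<Rightarrow> blowup_energy_fin k u
     | \<infinity> \<Rightarrow> lim (\<lambda>k. blowup_energy_fin k u))"

text \<open>
  In the case \<open>n = \<infinity>\<close>, continuity makes \<open>u\<close> measurable, so integrability of \<open>u\<^sup>2\<close> says that
  \<open>u \<in> L\<^sup>2\<close>.
\<close>

definition blowup_domain :: "enat \<Rightarrow> ('a \<Rightarrow> real) set" where
  "blowup_domain n = (case n of
       enat k \<Rightarrow> {u. continuous_on (blowup n) u \<and> rescale k u \<in> energy_domain H r}
     | \<infinity> \<Rightarrow> {u. continuous_on (blowup n) u \<and>
                 integrable (blowup_measure \<alpha> n) (\<lambda>x. (u x)\<^sup>2) \<and>
                 blowup_energy n u < \<infinity>})"

text \<open>Polarization; both energies are finite for \<open>u\<close> and \<open>v\<close> in the domain.\<close>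

definition blowup_form :: "enat \<Rightarrow> ('a \<Rightarrow> real) \<Rightarrow> ('a \<Rightarrow> real) \<Rightarrow> real" where
  "blowup_form n u v =
     (real_of_ereal (blowup_energy n (\<lambda>x. u x + v x)) -
      real_of_ereal (blowup_energy n (\<lambda>x. u x - v x))) / 4"

definition harmonic_in :: "enat \<Rightarrow> ('a \<Rightarrow> real) \<Rightarrow> 'a set \<Rightarrow> bool" where
  "harmonic_in n u U \<longleftrightarrow>
     u \<in> blowup_domain n \<and> openin (top_of_set (blowup n)) U \<and>
     (\<forall>\<phi>\<in>blowup_domain n.
        let supp = top_of_set (blowup n) closure_of {x \<in> blowup n. \<phi> x \<noteq> 0}
        in compact supp \<and> supp \<subseteq> U \<longrightarrow> blowup_form n u \<phi> = 0)"

end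

definition blowup_ball :: "enat \<Rightarrow> 'a \<Rightarrow> real \<Rightarrow> 'a set" where
  "blowup_ball n x0 s = ball x0 s \<inter> blowup n"

end

end

theory Submission imports Defs begin

text \<open>
  For a p.c.f. set all of whose maps are \<open>x \<mapsto> \<rho> x + a\<^sub>i\<close>, two intersecting cells of the same level
  differ by a translation from a finite set, so disjoint cells of level \<open>m\<close> are at distance at
  least \<open>c \<rho>\<^sup>m\<close> and a ball meets boundedly many cells of its own size. A function that is harmonic
  in \<open>2B\<close> is, on every small cell contained in \<open>2B\<close>, the harmonic extension of its values at the
  boundary points of that cell. Harmonic extensions oscillate by at most a multiple of \<open>q\<^sup>m\<close>,
  \<open>q = \<rho>\<^bsup>\<beta>-\<alpha>\<^esup>\<close>, on cells of level \<open>m\<close>: the current through a single edge is at most the total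
  current through a level set, which is bounded by the boundary values, while the conductances grow
  like \<open>q\<^bsup>-m\<^esup>\<close>. This decay gives the Hoelder bound in terms of the maximum over the cell, and also the
  mean value inequality: near its maximum, \<open>|u|\<close> exceeds half the maximum on a subcell of
  comparable measure. If the Hausdorff measure of \<open>K\<close> vanishes there is nothing to prove.
\<close>

section \<open>Cells of the self-similar set\<close>

text \<open>The exponent \<beta> - \<alpha> demands oscillation decay at the full rate
  \<open>q ^ m\<close>. Comparing the energy inside one cell with the total energy bounds only the
  square of the oscillation by a multiple of \<open>q ^ m\<close>, which is half the exponent; a
  current is linear in the boundary values, and so is the bound it yields. All constants must also
  be uniform in the scale. They are therefore obtained on K, for cells named by words, and carried
  to K_k by a dilation under which only ratios of sizes matter.

  Harmonicity is given weakly, through test functions. On a cell inside the open set, the difference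
  between u and the harmonic extension of its vertex values vanishes at the vertices. Extended by
  zero it is itself an admissible test function, and testing with it shows that it has energy 0.

  Two situations stand apart. If the radius is at least the diameter of K_n, no level of cells fits
  the ball, but then u is harmonic on all of K_n and hence constant. For K_\<infinity> the ball must
  lie in some K_k, which is not automatic, since later stages may attach new cells at points of
  K_k.\<close>

lemma word_map_Nil [simp]: "word_map \<rho> a [] = id"
  by (simp add: word_map_def)

lemma word_map_Cons [simp]: "word_map \<rho> a (i # w) = ifs_map \<rho> a i \<circ> word_map \<rho> a w"
  by (simp add: word_map_def)

lemma word_map_append: "word_map \<rho> a (v @ w) = word_map \<rho> a v \<circ> word_map \<rho> a w"
  by (induction v) (auto simp: fun_eq_iff)

lemma word_map_affine: "word_map \<rho> a w x = \<rho> ^ length w *\<^sub>R x + word_map \<rho> a w 0"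
proof (induction w arbitrary: x)
  case (Cons i w)
  have "word_map \<rho> a (i # w) x = \<rho> *\<^sub>R word_map \<rho> a w x + a i"
    by (simp add: ifs_map_def)
  also have "\<dots> = \<rho> *\<^sub>R (\<rho> ^ length w *\<^sub>R x + word_map \<rho> a w 0) + a i"
    by (subst Cons) (rule refl)
  finally show ?case
    by (simp add: ifs_map_def scaleR_add_right)
qed simp

lemma dist_word_map:
  assumes "\<rho> \<ge> 0"
  shows "dist (word_map \<rho> a w x) (word_map \<rho> a w y) = \<rho> ^ length w * dist x y"
proof -
  have "word_map \<rho> a w x - word_map \<rho> a w y = \<rho> ^ length w *\<^sub>R (x - y)"
    using word_map_affine[of \<rho> a w x] word_map_affine[of \<rho> a w y]
    by (metis add_diff_cancel_right scaleR_right_diff_distrib)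
  then show ?thesis
    using assms by (simp add: dist_norm)
qed

lemma continuous_on_word_map [continuous_intros]: "continuous_on S (word_map \<rho> a w)"
proof -
  have "continuous_on S (\<lambda>x. \<rho> ^ length w *\<^sub>R x + word_map \<rho> a w 0)"
    by (intro continuous_intros)
  then show ?thesis
    by (metis (no_types, lifting) continuous_on_cong word_map_affine)
qed

lemma words_0 [simp]: "words M 0 = {[]}"
  by (auto simp: words_def)

lemma finite_words [simp]: "finite (words M m)"
  unfolding words_def by (rule finite_lists_length_eq) simp

lemma length_words: "w \<in> words M m \<Longrightarrow> length w = m"
  by (simp add: words_def)

lemma Cons_in_words_iff [simp]: "i # w \<in> words M (Suc m) \<longleftrightarrow> i \<in> {1..M} \<and> w \<in> words M m"
  by (auto simp: words_def)

lemma append_in_words: "v \<in> words M m \<Longrightarrow> w \<in> words M k \<Longrightarrow> v @ w \<in> words M (m + k)"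
  by (auto simp: words_def)

lemma words_Suc: "words M (Suc m) = (\<lambda>(i, w). i # w) ` ({1..M} \<times> words M m)"
  by (auto simp: words_def image_iff length_Suc_conv)

lemma words_add_split:
  assumes "w \<in> words M (m + k)"
  obtains v s where "w = v @ s" "v \<in> words M m" "s \<in> words M k"
proof
  show "w = take m w @ drop m w"
    by simp
  show "take m w \<in> words M m" "drop m w \<in> words M k"
    using assms set_take_subset[of m w] set_drop_subset[of m w] by (auto simp: words_def)
qed

lemma words_Suc_snoc:
  assumes "w \<in> words M (Suc m)"
  obtains v i where "w = v @ [i]" "v \<in> words M m" "i \<in> {1..M}"
proof -
  obtain v s where vs: "w = v @ s" "v \<in> words M m" "s \<in> words M (Suc 0)"
    using words_add_split[of w M m 1] assms by auto
  then obtain i where "s = [i]" "i \<in> {1..M}"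
    by (auto simp: words_def length_Suc_conv)
  then show ?thesis
    using vs that by blast
qed

lemma sum_words_Suc:
  "(\<Sum>w\<in>words M (Suc m). f w) = (\<Sum>i\<in>{1..M}. \<Sum>w\<in>words M m. f (i # w))"
proof -
  have "inj_on (\<lambda>(i, w). i # w) ({1..M} \<times> words M m)"
    by (auto simp: inj_on_def)
  then show ?thesis
    by (simp add: words_Suc sum.reindex sum.cartesian_product case_prod_unfold)
qed

lemma card_words: "card (words M m) = M ^ m"
  using card_lists_length_eq[of "{1..M}" m] by (simp add: words_def)

locale pcf_fractal =
  fixes M :: nat and \<rho> :: real and a :: "nat \<Rightarrow> 'a::euclidean_space" and K :: "'a set"
  assumes M_ge_2: "M \<ge> 2"
    and rho_pos: "0 < \<rho>" and rho_less_1: "\<rho> < 1"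
    and attractor: "is_attractor M \<rho> a K"
    and pcf: "post_critically_finite M \<rho> a K"
    and connected_K: "connected K"
    and diameter_K: "diameter K = 1"
begin

abbreviation F :: "nat \<Rightarrow> 'a \<Rightarrow> 'a" where "F \<equiv> ifs_map \<rho> a"
abbreviation FW :: "nat list \<Rightarrow> 'a \<Rightarrow> 'a" where "FW \<equiv> word_map \<rho> a"
abbreviation W :: "nat \<Rightarrow> nat list set" where "W \<equiv> words M"
abbreviation code :: "nat stream \<Rightarrow> 'a" where "code \<equiv> coding_map \<rho> a K"
abbreviation V :: "'a set" where "V \<equiv> V0 M \<rho> a K"

lemma K_nonempty: "K \<noteq> {}" and compact_K: "compact K" and K_eq: "K = (\<Union>i\<in>{1..M}. F i ` K)"
  using attractor unfolding is_attractor_def by auto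

lemma closed_K: "closed K"
  using compact_K by (rule compact_imp_closed)

lemma bounded_K: "bounded K"
  using compact_K by (rule compact_imp_bounded)

lemma dist_K_le_1: "x \<in> K \<Longrightarrow> y \<in> K \<Longrightarrow> dist x y \<le> 1"
  using diameter_bounded_bound[OF bounded_K] diameter_K by fastforce

lemma F_in_K: "i \<in> {1..M} \<Longrightarrow> x \<in> K \<Longrightarrow> F i x \<in> K"
  by (subst K_eq) blast

lemma K_child:
  assumes "x \<in> K"
  obtains i y where "i \<in> {1..M}" "y \<in> K" "x = F i y"
proof -
  have "x \<in> (\<Union>i\<in>{1..M}. F i ` K)"
    using assms by (subst (asm) K_eq)
  then show ?thesis
    using that by blast
qed

lemma FW_in_K: "w \<in> W m \<Longrightarrow> x \<in> K \<Longrightarrow> FW w x \<in> K"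
proof (induction m arbitrary: w)
  case (Suc m)
  then obtain i v where "w = i # v" "i \<in> {1..M}" "v \<in> W m"
    by (auto simp: words_Suc)
  with Suc show ?case
    by (auto intro: F_in_K)
qed simp

lemma K_eq_words: "K = (\<Union>w\<in>W m. FW w ` K)"
proof (induction m)
  case (Suc m)
  have "(\<Union>w\<in>W (Suc m). FW w ` K) = (\<Union>i\<in>{1..M}. F i ` (\<Union>w\<in>W m. FW w ` K))"
    unfolding words_Suc image_UN UN_simps by (simp add: image_comp Sigma_def)
  also have "\<dots> = K"
    using Suc K_eq by simp
  finally show ?case ..
qed simp

lemma K_cell:
  assumes "x \<in> K"
  obtains w y where "w \<in> W m" "y \<in> K" "x = FW w y"
  using assms K_eq_words[of m] by blast

lemma FW_inj [simp]: "FW w x = FW w y \<longleftrightarrow> x = y"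
proof -
  have "dist (FW w x) (FW w y) = 0 \<longleftrightarrow> dist x y = 0"
    using rho_pos by (subst dist_word_map) auto
  then show ?thesis
    by simp
qed

lemma compact_cell: "compact (FW w ` K)"
  by (intro compact_continuous_image continuous_intros compact_K)

lemma closed_cell: "closed (FW w ` K)"
  using compact_cell by (rule compact_imp_closed)

lemma dist_cell_le: "w \<in> W m \<Longrightarrow> x \<in> FW w ` K \<Longrightarrow> y \<in> FW w ` K \<Longrightarrow> dist x y \<le> \<rho> ^ m"
  using dist_K_le_1 rho_pos
  by (auto simp: dist_word_map length_words mult_le_cancel_left1 not_less)

lemma rho_power_less: "e > 0 \<Longrightarrow> \<exists>m. \<rho> ^ m < e"
  using real_arch_pow_inv rho_less_1 by blast

section \<open>Coding of points by infinite words\<close>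

declare stake.simps(2) [simp del] sdrop.simps(2) [simp del]

lemma stake_in_words: "\<omega> \<in> streams {1..M} \<Longrightarrow> stake m \<omega> \<in> W m"
  by (auto simp: words_def in_set_conv_nth snth_in[of \<omega> "{1..M}", simplified])

lemma cells_decseq:
  assumes "\<omega> \<in> streams {1..M}" "m \<le> k"
  shows "FW (stake k \<omega>) ` K \<subseteq> FW (stake m \<omega>) ` K"
proof -
  obtain j where k: "k = m + j"
    using assms(2) le_Suc_ex by blast
  have "sdrop m \<omega> \<in> streams {1..M}"
    using assms(1) by (simp add: streams_iff_snth sdrop_snth)
  then have "stake j (sdrop m \<omega>) \<in> W j"
    by (rule stake_in_words)
  then show ?thesis
    unfolding k stake_add[symmetric] word_map_append using FW_in_K by auto
qed

text \<open>\<open>coding_map\<close> is defined by \<open>the_elem\<close>, which is meaningful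
  only for a singleton. The cells along an address are nested, compact and of diameter at most
  \<open>\<rho> ^ m\<close>, so they shrink to one point.\<close>

lemma code_singleton:
  assumes "\<omega> \<in> streams {1..M}"
  shows "(\<Inter>m\<in>{1..}. FW (stake m \<omega>) ` K) = {code \<omega>}"
proof -
  have "\<exists>x. \<Inter>(range (\<lambda>m. FW (stake (Suc m) \<omega>) ` K)) = {x}"
  proof (rule decreasing_closed_nest_sing)
    fix e :: real assume "e > 0"
    then obtain m where "\<rho> ^ m < e"
      using rho_power_less by blast
    moreover have "\<rho> ^ Suc m \<le> \<rho> ^ m"
      using rho_pos rho_less_1 by (intro power_decreasing) auto
    ultimately show "\<exists>m. \<forall>x\<in>FW (stake (Suc m) \<omega>) ` K. \<forall>y\<in>FW (stake (Suc m) \<omega>) ` K. dist x y < e"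
      using dist_cell_le[OF stake_in_words[OF assms]] by (meson le_less_trans)
  qed (use cells_decseq[OF assms] K_nonempty closed_cell in auto)
  moreover have "\<Inter>(range (\<lambda>m. FW (stake (Suc m) \<omega>) ` K)) = (\<Inter>m\<in>{1..}. FW (stake m \<omega>) ` K)"
  proof -
    have "{1::nat..} = range Suc"
      by (auto simp: Suc_le_eq gr0_conv_Suc)
    then show ?thesis
      by (simp only: image_comp comp_def)
  qed
  ultimately obtain x where x: "(\<Inter>m\<in>{1..}. FW (stake m \<omega>) ` K) = {x}"
    by auto
  show ?thesis
    unfolding coding_map_def x by simp
qed

lemma code_in_cell:
  assumes "\<omega> \<in> streams {1..M}"
  shows "code \<omega> \<in> FW (stake m \<omega>) ` K"
proof -
  have "code \<omega> \<in> (\<Inter>m\<in>{1..}. FW (stake m \<omega>) ` K)"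
    unfolding code_singleton[OF assms] by blast
  then have "code \<omega> \<in> FW (stake (Suc m) \<omega>) ` K"
    by (rule INT_D) simp
  then show ?thesis
    using cells_decseq[OF assms, of m "Suc m"] by auto
qed

lemma code_in_K: "\<omega> \<in> streams {1..M} \<Longrightarrow> code \<omega> \<in> K"
  using code_in_cell[of \<omega> 0] by simp

lemma code_eqI:
  assumes "\<omega> \<in> streams {1..M}" "\<And>m. x \<in> FW (stake m \<omega>) ` K"
  shows "code \<omega> = x"
proof -
  have "x \<in> (\<Inter>m\<in>{1..}. FW (stake m \<omega>) ` K)"
    using assms(2) by (rule INT_I)
  then show ?thesis
    unfolding code_singleton[OF assms(1)] by simp
qed

lemma code_Stream:
  assumes "i \<in> {1..M}" "\<omega> \<in> streams {1..M}"
  shows "code (i ## \<omega>) = F i (code \<omega>)"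
proof (rule code_eqI)
  show "i ## \<omega> \<in> streams {1..M}"
    using assms by (simp add: streams_Stream)
  fix m
  show "F i (code \<omega>) \<in> FW (stake m (i ## \<omega>)) ` K"
  proof (cases m)
    case 0
    then show ?thesis
      using assms code_in_K F_in_K by simp
  next
    case (Suc k)
    then have "FW (stake m (i ## \<omega>)) ` K = F i ` FW (stake k \<omega>) ` K"
      by (simp add: image_comp stake.simps(2))
    then show ?thesis
      by (simp only:) (intro imageI code_in_cell assms)
  qed
qed

lemma code_shift:
  assumes "\<omega> \<in> streams {1..M}" "w \<in> W m"
  shows "code (w @- \<omega>) = FW w (code \<omega>)"
  using assms(2)
proof (induction m arbitrary: w)
  case (Suc m)
  then obtain i v where "w = i # v" "i \<in> {1..M}" "v \<in> W m"
    by (auto simp: words_Suc)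
  moreover from this have "v @- \<omega> \<in> streams {1..M}"
    using assms(1) by (auto simp: words_def intro!: shift_streams)
  ultimately show ?case
    using Suc.IH by (simp add: code_Stream)
qed simp

text \<open>For a point of K, \<open>d\<close> picks the letter of some first-level cell containing
  it and \<open>s\<close> the preimage in K. The letters read along the orbit of \<open>s\<close>
  form an address.\<close>

lemma code_surj:
  assumes "x \<in> K"
  obtains \<omega> where "\<omega> \<in> streams {1..M}" "code \<omega> = x"
proof -
  have "\<forall>x\<in>K. \<exists>i y. i \<in> {1..M} \<and> y \<in> K \<and> x = F i y"
    using K_child by metis
  then obtain d s where ds: "\<And>x. x \<in> K \<Longrightarrow> d x \<in> {1..M} \<and> s x \<in> K \<and> x = F (d x) (s x)"
    by metis
  define \<omega> where "\<omega> x = smap d (siterate s x)" for x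
  have \<omega>_unfold: "\<omega> x = d x ## \<omega> (s x)" for x
    unfolding \<omega>_def by (subst siterate.code) simp
  have sK: "(s ^^ m) x \<in> K" if "x \<in> K" for m x
    using that by (induction m) (auto simp: ds)
  have streams: "\<omega> x \<in> streams {1..M}" if "x \<in> K" for x
    unfolding \<omega>_def streams_iff_snth using sK[OF that] ds by simp
  have cell: "x \<in> FW (stake m (\<omega> x)) ` K" if "x \<in> K" for m x
    using that
  proof (induction m arbitrary: x)
    case (Suc m)
    then have "s x \<in> FW (stake m (\<omega> (s x))) ` K" "x = F (d x) (s x)"
      using ds by blast+
    then show ?case
      by (subst \<omega>_unfold) (simp add: stake.simps(2) image_iff, metis)
  qed simp
  show ?thesis
    using that streams[OF assms] code_eqI[OF streams[OF assms] cell[OF assms]] by blast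
qed

lemma V_subset_K: "V \<subseteq> K"
proof
  fix p assume "p \<in> V"
  then obtain \<omega> m where "\<omega> \<in> critical_set M \<rho> a K" "p = code (sdrop m \<omega>)"
    unfolding V0_def post_critical_set_def by blast
  moreover from this have "sdrop m \<omega> \<in> streams {1..M}"
    by (simp add: critical_set_def streams_iff_snth sdrop_snth)
  ultimately show "p \<in> K"
    by (simp add: code_in_K)
qed

lemma finite_V: "finite V"
  using pcf unfolding post_critically_finite_def V0_def by simp

text \<open>The post-critical set is invariant under the shift, so a post-critical address without
  its first letter is again one. This is the inclusion that makes the vertex sets of successive
  levels increase.\<close>

lemma V_refine:
  assumes "p \<in> V"
  obtains i p' where "i \<in> {1..M}" "p' \<in> V" "p = F i p'"
proof -
  obtain \<omega> m where \<omega>: "\<omega> \<in> critical_set M \<rho> a K" "m \<ge> 1" "p = code (sdrop m \<omega>)"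
    using assms unfolding V0_def post_critical_set_def by auto
  then have str: "sdrop m \<omega> \<in> streams {1..M}"
    by (simp add: critical_set_def streams_iff_snth sdrop_snth)
  have eq: "sdrop m \<omega> = \<omega> !! m ## sdrop (Suc m) \<omega>"
    by (metis sdrop_simps stream.collapse)
  have "sdrop (Suc m) \<omega> \<in> post_critical_set M \<rho> a K"
    unfolding post_critical_set_def using \<omega>(1) by (intro UN_I[of "Suc m"] imageI) simp_all
  then have "code (sdrop (Suc m) \<omega>) \<in> V"
    unfolding V0_def by blast
  moreover have "\<omega> !! m \<in> {1..M}" "sdrop (Suc m) \<omega> \<in> streams {1..M}"
    using str by (subst (asm) eq, simp add: streams_Stream)+
  moreover from this have "p = F (\<omega> !! m) (code (sdrop (Suc m) \<omega>))"
    unfolding \<omega>(3) by (subst eq) (rule code_Stream)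
  ultimately show ?thesis
    using that by blast
qed

lemma V_refine_words:
  assumes "p \<in> V"
  obtains w p' where "w \<in> W m" "p' \<in> V" "p = FW w p'"
  using assms
proof (induction m arbitrary: thesis p)
  case (Suc m)
  obtain i p' where p': "i \<in> {1..M}" "p' \<in> V" "p = F i p'"
    using V_refine Suc.prems(2) by blast
  obtain w p'' where "w \<in> W m" "p'' \<in> V" "p' = FW w p''"
    using Suc.IH p'(2) by blast
  then show ?case
    using Suc.prems(1)[of "i # w" p''] p' by simp
qed auto

text \<open>Strip the common prefix of the two words. Once the first letters differ, the common
  point lies in two first-level cells, so the address formed by \<open>w\<close> and an address of
  \<open>x\<close> is critical; shifting it by the length of \<open>w\<close> leaves a post-critical
  address of \<open>x\<close>. All later arguments about intersecting cells rest on this.\<close>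

lemma overlap_in_V:
  assumes "w \<in> W m" "v \<in> W m" "w \<noteq> v" "x \<in> K" "y \<in> K" "FW w x = FW v y"
  shows "x \<in> V"
  using assms
proof (induction m arbitrary: w v)
  case (Suc m)
  obtain i w' where w: "w = i # w'" "i \<in> {1..M}" "w' \<in> W m"
    using Suc.prems(1) by (auto simp: words_Suc)
  obtain j v' where v: "v = j # v'" "j \<in> {1..M}" "v' \<in> W m"
    using Suc.prems(2) by (auto simp: words_Suc)
  show ?case
  proof (cases "i = j")
    case True
    have "FW [i] (FW w' x) = FW [i] (FW v' y)"
      using Suc.prems(6) w v True by simp
    then have "FW w' x = FW v' y"
      by (simp only: FW_inj)
    then show ?thesis
      using Suc w v True by blast
  next
    case False
    obtain \<omega> where \<omega>: "\<omega> \<in> streams {1..M}" "code \<omega> = x"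
      using code_surj Suc.prems(4) by blast
    have str: "w @- \<omega> \<in> streams {1..M}"
      using \<omega> Suc.prems(1) by (auto simp: words_def intro!: shift_streams)
    have cw: "code (w @- \<omega>) = FW w x"
      using code_shift \<omega> Suc.prems(1) by blast
    have "FW w x = F i (FW w' x)" "FW w x = F j (FW v' y)"
      using w v Suc.prems(6) by auto
    then have "FW w x \<in> F i ` K \<inter> F j ` K"
      using FW_in_K w v Suc.prems by blast
    then have "w @- \<omega> \<in> critical_set M \<rho> a K"
      unfolding critical_set_def mem_Collect_eq cw
      using str w(2) v(2) False by (intro conjI UN_I[of i] UN_I[of j]) auto
    moreover have "sdrop (Suc m) (w @- \<omega>) = \<omega>"
      using length_words[OF Suc.prems(1)] by (simp add: sdrop_shift)
    ultimately have "\<omega> \<in> post_critical_set M \<rho> a K"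
      unfolding post_critical_set_def by (intro UN_I[of "Suc m"] image_eqI[of _ _ "w @- \<omega>"]) simp_all
    then show ?thesis
      unfolding V0_def using \<omega> by blast
  qed
qed simp

text \<open>If \<open>c\<close> took two values, the cells labelled like \<open>i\<close> and the
  remaining cells would form two disjoint nonempty closed sets covering K, against
  connectedness.\<close>

lemma level1_chain:
  fixes c :: "nat \<Rightarrow> 'c"
  assumes "\<And>i j. i \<in> {1..M} \<Longrightarrow> j \<in> {1..M} \<Longrightarrow> F i ` K \<inter> F j ` K \<noteq> {} \<Longrightarrow> c i = c j"
    and "i \<in> {1..M}" "j \<in> {1..M}"
  shows "c i = c j"
proof (rule ccontr)
  assume neq: "c i \<noteq> c j"
  define A where "A = (\<Union>k\<in>{k\<in>{1..M}. c k = c i}. F k ` K)"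
  define B where "B = (\<Union>k\<in>{k\<in>{1..M}. c k \<noteq> c i}. F k ` K)"
  have closed: "closed (F k ` K)" for k
    using closed_cell[of "[k]"] by (simp add: comp_def)
  have "closed A" "closed B"
    unfolding A_def B_def using closed by auto
  moreover have "K \<subseteq> A \<union> B"
  proof
    fix x assume "x \<in> K"
    then obtain k y where "k \<in> {1..M}" "y \<in> K" "x = F k y"
      by (rule K_child)
    then show "x \<in> A \<union> B"
      unfolding A_def B_def by blast
  qed
  moreover have "A \<inter> B \<inter> K = {}"
  proof (rule ccontr)
    assume "A \<inter> B \<inter> K \<noteq> {}"
    then obtain k l where "k \<in> {1..M}" "l \<in> {1..M}" "c k = c i" "c l \<noteq> c i" "F k ` K \<inter> F l ` K \<noteq> {}"
      unfolding A_def B_def by blast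
    then show False
      using assms(1)[of k l] by simp
  qed
  moreover have "A \<inter> K \<noteq> {}" "B \<inter> K \<noteq> {}"
  proof -
    obtain x where "x \<in> K"
      using K_nonempty by blast
    then have "F i x \<in> A \<inter> K" "F j x \<in> B \<inter> K"
      unfolding A_def B_def using assms(2,3) neq F_in_K by auto
    then show "A \<inter> K \<noteq> {}" "B \<inter> K \<noteq> {}"
      by blast+
  qed
  ultimately show False
    using connected_K unfolding connected_closed by blast
qed

lemma overlap1_in_V:
  assumes "i \<in> {1..M}" "j \<in> {1..M}" "i \<noteq> j" "x \<in> K" "y \<in> K" "F i x = F j y"
  shows "x \<in> V" "y \<in> V"
  using overlap_in_V[of "[i]" 1 "[j]" x y] overlap_in_V[of "[j]" 1 "[i]" y x] assms
  by auto

text \<open>Without post-critical points the first-level cells would be pairwise disjoint, so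
  \<open>level1_chain\<close> would apply to the labelling \<open>id\<close> and identify the
  letters 1 and 2.\<close>

lemma V_nonempty: "V \<noteq> {}"
proof
  assume "V = {}"
  then have "i = j" if "i \<in> {1..M}" "j \<in> {1..M}" "F i ` K \<inter> F j ` K \<noteq> {}" for i j
    using overlap1_in_V[OF that(1,2)] that by blast
  then have "(1::nat) = 2"
    using level1_chain[of id 1 2] M_ge_2 by auto
  then show False
    by simp
qed

text \<open>Connectedness of the graph formed by the vertices of level \<open>m\<close>. Inside one
  first-level cell the induction hypothesis applies to \<open>g \<circ> F i\<close>. Different
  first-level cells communicate through common points, which are images of points of
  \<open>V\<close>, and \<open>V_refine_words\<close> shows that such points are also vertices of
  the small cells.\<close>

lemma V_connected_words:
  assumes "\<And>w p q. w \<in> W m \<Longrightarrow> p \<in> V \<Longrightarrow> q \<in> V \<Longrightarrow> g (FW w p) = g (FW w q)"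
    and "w \<in> W m" "v \<in> W m" "p \<in> V" "q \<in> V"
  shows "g (FW w p) = g (FW v q)"
  using assms
proof (induction m arbitrary: g w v p q)
  case (Suc m)
  have const: "g (F i (FW w p)) = g (F i (FW v q))"
    if "i \<in> {1..M}" "w \<in> W m" "v \<in> W m" "p \<in> V" "q \<in> V" for i w v p q
  proof -
    have "g (F i (FW w p)) = g (F i (FW w q))" if "w \<in> W m" "p \<in> V" "q \<in> V" for w p q
      using Suc.prems(1)[of "i # w" p q] that \<open>i \<in> {1..M}\<close> by simp
    then show ?thesis
      using Suc.IH[of "g \<circ> F i", unfolded comp_apply] that(2-5) by blast
  qed
  obtain p0 where p0: "p0 \<in> V"
    using V_nonempty by blast
  have const': "g (F i p) = g (F i q)" if "i \<in> {1..M}" "p \<in> V" "q \<in> V" for i p q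
  proof -
    obtain w p' where "w \<in> W m" "p' \<in> V" "p = FW w p'"
      using V_refine_words \<open>p \<in> V\<close> by blast
    moreover obtain v q' where "v \<in> W m" "q' \<in> V" "q = FW v q'"
      using V_refine_words \<open>q \<in> V\<close> by blast
    ultimately show ?thesis
      using const[OF \<open>i \<in> {1..M}\<close>, of w v p' q'] by simp
  qed
  have "g (F i p0) = g (F j p0)" if "i \<in> {1..M}" "j \<in> {1..M}" for i j
  proof (rule level1_chain[of "\<lambda>i. g (F i p0)"])
    fix i j assume ij: "i \<in> {1..M}" "j \<in> {1..M}" "F i ` K \<inter> F j ` K \<noteq> {}"
    then obtain x y where xy: "x \<in> K" "y \<in> K" "F i x = F j y"
      by blast
    show "g (F i p0) = g (F j p0)"
    proof (cases "i = j")
      case False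
      then have "x \<in> V" "y \<in> V"
        using overlap1_in_V ij xy by blast+
      then show ?thesis
        using const'[OF ij(1) p0, of x] const'[OF ij(2) p0, of y] xy by simp
    qed simp
  qed (use that in auto)
  moreover obtain i w' where w: "w = i # w'" "i \<in> {1..M}" "w' \<in> W m"
    using Suc.prems(2) by (auto simp: words_Suc)
  moreover obtain j v' where v: "v = j # v'" "j \<in> {1..M}" "v' \<in> W m"
    using Suc.prems(3) by (auto simp: words_Suc)
  ultimately have "g (F i p0) = g (F j p0)"
    by blast
  obtain s p1 where s: "s \<in> W m" "p1 \<in> V" "p0 = FW s p1"
    using V_refine_words p0 by blast
  have "g (F i (FW w' p)) = g (F i p0)"
    using const[OF w(2,3) s(1) Suc.prems(4) s(2)] s(3) by simp
  also have "\<dots> = g (F j p0)"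
    by fact
  also have "\<dots> = g (F j (FW v' q))"
    using const[OF v(2) s(1) v(3) s(2) Suc.prems(5)] s(3) by simp
  finally show ?case
    by (simp add: w(1) v(1))
next
  case 0
  show ?case
    using "0.prems"(1)[of "[]" p q] "0.prems"(2-) by (simp only: words_0 singleton_iff)
qed

section \<open>Relative positions and separation of cells\<close>

definition displacements :: "'a set" where
  "displacements = (\<lambda>(p, q). p - q) ` (V \<times> V)"

lemma finite_displacements: "finite displacements"
  unfolding displacements_def using finite_V by simp

text \<open>If two different cells meet in \<open>FW w x = FW v y\<close>, then \<open>x\<close> and
  \<open>y\<close> lie in \<open>V\<close>, and the translation carrying one cell to the other is
  \<open>\<rho> ^ m\<close> times \<open>x - y\<close>. Equal words correspond to the displacement
  0.\<close>

lemma displacement_cells: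
  assumes "w \<in> W m" "v \<in> W m" "FW w ` K \<inter> FW v ` K \<noteq> {}"
  obtains t where "t \<in> displacements" "\<And>x. FW v x = FW w x + \<rho> ^ m *\<^sub>R t"
    "\<And>x. FW v x = FW w (x + t)"
proof -
  have affine: "FW w x = \<rho> ^ m *\<^sub>R x + FW w 0" "FW v x = \<rho> ^ m *\<^sub>R x + FW v 0" for x
    using word_map_affine[of \<rho> a w x] word_map_affine[of \<rho> a v x] length_words assms(1,2) by metis+
  have "\<exists>t\<in>displacements. FW v 0 = FW w 0 + \<rho> ^ m *\<^sub>R t"
  proof (cases "w = v")
    case True
    moreover have "0 \<in> displacements"
      using V_nonempty unfolding displacements_def by force
    ultimately show ?thesis
      by (intro bexI[of _ 0]) auto
  next
    case False
    obtain x y where xy: "x \<in> K" "y \<in> K" "FW w x = FW v y"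
      using assms(3) by blast
    then have "x \<in> V" "y \<in> V"
      using overlap_in_V[OF assms(1,2) False] overlap_in_V[OF assms(2,1)] False by metis+
    moreover have "FW v 0 = FW w 0 + \<rho> ^ m *\<^sub>R (x - y)"
      using xy(3) affine(1)[of x] affine(2)[of y] by (simp add: algebra_simps)
    ultimately show ?thesis
      unfolding displacements_def by auto
  qed
  then obtain t where t: "t \<in> displacements" "FW v 0 = FW w 0 + \<rho> ^ m *\<^sub>R t"
    by blast
  show ?thesis
  proof (rule that[OF t(1)])
    fix x
    show "FW v x = FW w x + \<rho> ^ m *\<^sub>R t"
      using affine(1)[of x] affine(2)[of x] t(2) by simp
    show "FW v x = FW w (x + t)"
      using affine(1)[of "x + t"] affine(2)[of x] t(2) by (simp add: algebra_simps)
  qed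
qed

text \<open>
  Since all contraction ratios agree and there are no rotations, two intersecting cells of the same
  level have one of finitely many relative positions, so that disjoint children of intersecting
  cells stay apart by a fixed multiple of their size.
\<close>

lemma disjoint_cells_apart:
  "\<exists>c>0. \<forall>m. \<forall>w\<in>W m. \<forall>v\<in>W m. \<forall>x\<in>K. \<forall>y\<in>K.
     dist (FW w x) (FW v y) < c * \<rho> ^ m \<longrightarrow> FW w ` K \<inter> FW v ` K \<noteq> {}"
proof -
  \<comment> \<open>For one fixed relative position \<open>t\<close> this is the positive distance
    of disjoint compact sets; finiteness of \<open>displacements\<close> then allows a common
    constant.\<close>
  have "\<exists>d>0. \<forall>x\<in>K. \<forall>y\<in>K. F i ` K \<inter> (\<lambda>x. F j x + t) ` K = {} \<longrightarrow> d \<le> dist (F i x) (F j y + t)"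
    for i j t
  proof (cases "F i ` K \<inter> (\<lambda>x. F j x + t) ` K = {}")
    case True
    have "compact (F i ` K)" "compact ((\<lambda>x. F j x + t) ` K)"
      unfolding ifs_map_def by (intro compact_continuous_image continuous_intros compact_K)+
    then obtain d where "d > 0" "\<forall>x\<in>F i ` K. \<forall>y\<in>(\<lambda>x. F j x + t) ` K. d \<le> dist x y"
      using separate_compact_closed[OF _ compact_imp_closed True] by blast
    then show ?thesis
      by blast
  qed (auto intro: exI[of _ 1])
  then obtain d where d: "\<And>i j t. d i j t > 0"
    "\<And>i j t x y. x \<in> K \<Longrightarrow> y \<in> K \<Longrightarrow> F i ` K \<inter> (\<lambda>x. F j x + t) ` K = {} \<Longrightarrow> d i j t \<le> dist (F i x) (F j y + t)"
    by metis
  define D where "D = insert 1 ((\<lambda>(i, j, t). d i j t) ` ({1..M} \<times> {1..M} \<times> displacements))"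
  define c where "c = Min D"
  have finD: "finite D"
    unfolding D_def using finite_displacements by simp
  then have "c > 0"
    unfolding c_def using d(1) by (subst Min_gr_iff) (auto simp: D_def)
  have c_le: "c \<le> d i j t" if "i \<in> {1..M}" "j \<in> {1..M}" "t \<in> displacements" for i j t
  proof -
    have "d i j t \<in> D"
      unfolding D_def using that by (intro insertI2 image_eqI[of _ _ "(i, j, t)"]) auto
    then show ?thesis
      unfolding c_def using finD by (intro Min_le)
  qed
  have "c * \<rho> ^ m \<le> dist (FW w x) (FW v y)"
    if "w \<in> W m" "v \<in> W m" "x \<in> K" "y \<in> K" "FW w ` K \<inter> FW v ` K = {}" for m w v x y
    using that
  proof (induction m arbitrary: w v x y)
    case 0
    then show ?case
      using K_nonempty by auto
  next
    case (Suc m)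
    obtain w' i where w: "w = w' @ [i]" "w' \<in> W m" "i \<in> {1..M}"
      using words_Suc_snoc[OF Suc.prems(1)] by blast
    obtain v' j where v: "v = v' @ [j]" "v' \<in> W m" "j \<in> {1..M}"
      using words_Suc_snoc[OF Suc.prems(2)] by blast
    have FWw: "FW w z = FW w' (F i z)" and FWv: "FW v z = FW v' (F j z)" for z
      using w v by (simp_all add: word_map_append)
    have le: "c * \<rho> ^ Suc m \<le> c * \<rho> ^ m"
      using rho_pos rho_less_1 \<open>c > 0\<close> by simp
    show ?case
    proof (cases "FW w' ` K \<inter> FW v' ` K = {}")
      case True
      then have "c * \<rho> ^ m \<le> dist (FW w' (F i x)) (FW v' (F j y))"
        using Suc.IH[OF w(2) v(2) F_in_K[OF w(3) Suc.prems(3)] F_in_K[OF v(3) Suc.prems(4)]]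
        by simp
      then show ?thesis
        using le by (simp add: FWw FWv)
    next
      case False
      then obtain t where t: "t \<in> displacements" "\<And>x. FW v' x = FW w' (x + t)"
        using displacement_cells w v by metis
      \<comment> \<open>Undoing \<open>FW w'\<close> turns the two child cells into the image of K
        under \<open>F i\<close> and the image under \<open>F j\<close> shifted by \<open>t\<close>,
        one of the finitely many configurations that enter \<open>c\<close>.\<close>
      have "F i ` K \<inter> (\<lambda>x. F j x + t) ` K = {}"
      proof (rule ccontr)
        assume "F i ` K \<inter> (\<lambda>x. F j x + t) ` K \<noteq> {}"
        then obtain x' y' where "x' \<in> K" "y' \<in> K" "F i x' = F j y' + t"
          by blast
        then have "FW w x' = FW v y'"
          using t(2) FWw FWv by simp
        then show False
          using Suc.prems(5) \<open>x' \<in> K\<close> \<open>y' \<in> K\<close> by blast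
      qed
      then have "c \<le> dist (F i x) (F j y + t)"
        using d(2)[of x y i j t] c_le[OF w(3) v(3) t(1)] Suc.prems by fastforce
      then have "c * \<rho> ^ m \<le> dist (FW w x) (FW v y)"
        using rho_pos length_words[OF w(2)]
        by (simp add: FWw FWv t(2) dist_word_map mult.commute mult_left_mono)
      then show ?thesis
        using le by simp
    qed
  qed
  then show ?thesis
    using \<open>c > 0\<close> by (meson not_le)
qed

end

section \<open>Harmonic extension\<close>

text \<open>Near \<open>s = 0\<close> the linear term dominates: the witness \<open>- D / b\<close>,
  with \<open>b\<close> above both 0 and \<open>B\<close>, would make the expression negative. This
  is the first-variation argument for energy minimizers.\<close>

lemma zero_if_quadratic_nonneg:
  fixes B D :: real
  assumes "\<And>s. 0 \<le> 2 * s * D + s\<^sup>2 * B"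
  shows "D = 0"
proof (rule ccontr)
  assume "D \<noteq> 0"
  define b where "b = \<bar>B\<bar> + 1"
  have b: "b > 0" "B < b"
    unfolding b_def by auto
  have "2 * (- D / b) * D + (- D / b)\<^sup>2 * B = (D\<^sup>2 / b) * (B / b - 2)"
    using b by (simp add: field_simps power2_eq_square)
  also have "\<dots> < 0"
    using b \<open>D \<noteq> 0\<close> by (intro mult_pos_neg) (auto simp: field_simps)
  finally show False
    using assms[of "- D / b"] by simp
qed

locale pcf_harmonic = pcf_fractal M \<rho> a K
  for M :: nat and \<rho> :: real and a :: "nat \<Rightarrow> 'a::euclidean_space" and K :: "'a set" +
  fixes H :: "'a \<Rightarrow> 'a \<Rightarrow> real" and r :: "nat \<Rightarrow> real" and q :: real
  assumes harmonic: "harmonic_structure M \<rho> a K H r"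
    and r_eq: "\<And>i. i \<in> {1..M} \<Longrightarrow> r i = q"
    and q_pos: "0 < q" and q_less_1: "q < 1"
begin

abbreviation E0 :: "('a \<Rightarrow> real) \<Rightarrow> ('a \<Rightarrow> real) \<Rightarrow> real" where "E0 \<equiv> energy0 M \<rho> a K H"
abbreviation EL :: "nat \<Rightarrow> ('a \<Rightarrow> real) \<Rightarrow> ('a \<Rightarrow> real) \<Rightarrow> real" where "EL \<equiv> energy_level M \<rho> a K H r"

lemma laplace: "laplace_matrix M \<rho> a K H"
  using harmonic unfolding harmonic_structure_def by blast

lemma H_sym: "x \<in> V \<Longrightarrow> y \<in> V \<Longrightarrow> H x y = H y x"
  and H_nonneg: "x \<in> V \<Longrightarrow> y \<in> V \<Longrightarrow> x \<noteq> y \<Longrightarrow> 0 \<le> H x y"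
  and H_kernel: "(\<forall>x\<in>V. (\<Sum>y\<in>V. H x y * f y) = 0) \<longleftrightarrow> f constant_on V"
  using laplace unfolding laplace_matrix_def by blast+

lemma H_row_sum: "x \<in> V \<Longrightarrow> (\<Sum>y\<in>V. H x y) = 0"
  using H_kernel[of "\<lambda>_. 1"] by (auto simp: constant_on_def)

text \<open>Row sums of \<open>H\<close> vanish because constants lie in its kernel, so the diagonal
  can be eliminated. The remaining weights are nonnegative; hence every summand is nonnegative when
  \<open>g\<close> is \<open>f\<close> or a nondecreasing function of \<open>f\<close>, which both
  truncation and the current estimate exploit.\<close>

lemma E0_eq_edges:
  "E0 f g = (\<Sum>x\<in>V. \<Sum>y\<in>V. H x y * (f x - f y) * (g x - g y)) / 2"
proof -
  have diag: "(\<Sum>x\<in>V. \<Sum>y\<in>V. H x y * c x) = 0" for c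
    using H_row_sum by (simp flip: sum_distrib_right)
  have diag': "(\<Sum>x\<in>V. \<Sum>y\<in>V. H x y * c y) = 0" for c
  proof -
    have "(\<Sum>x\<in>V. \<Sum>y\<in>V. H x y * c y) = (\<Sum>y\<in>V. \<Sum>x\<in>V. H y x * c y)"
      by (subst sum.swap) (auto intro!: sum.cong simp: H_sym)
    then show ?thesis
      using diag by simp
  qed
  have cross: "(\<Sum>x\<in>V. \<Sum>y\<in>V. H x y * (f y * g x)) = (\<Sum>x\<in>V. \<Sum>y\<in>V. H x y * (f x * g y))"
    by (subst sum.swap) (auto intro!: sum.cong simp: H_sym)
  have "(\<Sum>x\<in>V. \<Sum>y\<in>V. H x y * (f x - f y) * (g x - g y)) =
      (\<Sum>x\<in>V. \<Sum>y\<in>V. H x y * (f x * g x)) + (\<Sum>x\<in>V. \<Sum>y\<in>V. H x y * (f y * g y))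
      - (\<Sum>x\<in>V. \<Sum>y\<in>V. H x y * (f x * g y)) - (\<Sum>x\<in>V. \<Sum>y\<in>V. H x y * (f y * g x))"
    by (simp add: sum.distrib[symmetric] sum_subtractf[symmetric] algebra_simps)
  also have "\<dots> = - 2 * (\<Sum>x\<in>V. \<Sum>y\<in>V. H x y * (f x * g y))"
    unfolding diag diag' cross by simp
  also have "(\<Sum>x\<in>V. \<Sum>y\<in>V. H x y * (f x * g y)) = - E0 f g"
    unfolding energy0_def by (auto simp: sum_distrib_left intro!: sum.cong)
  finally show ?thesis
    by simp
qed

lemma E0_cong: "(\<And>x. x \<in> V \<Longrightarrow> f x = f' x) \<Longrightarrow> (\<And>x. x \<in> V \<Longrightarrow> g x = g' x) \<Longrightarrow> E0 f g = E0 f' g'"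
  unfolding energy0_def by (auto intro!: sum.cong)

lemma E0_sym: "E0 f g = E0 g f"
  unfolding E0_eq_edges by (simp add: mult_ac)

lemma E0_term_nonneg:
  assumes "x \<in> V" "y \<in> V" "0 \<le> (f x - f y) * (g x - g y)"
  shows "0 \<le> H x y * (f x - f y) * (g x - g y)"
  using assms H_nonneg[of x y] by (cases "x = y") (auto simp: mult.assoc)

lemma E0_nonneg: "0 \<le> E0 f f"
  unfolding E0_eq_edges by (intro divide_nonneg_nonneg sum_nonneg E0_term_nonneg) auto

lemma E0_add_left: "E0 (\<lambda>x. f x + g x) h = E0 f h + E0 g h"
  unfolding energy0_def by (simp add: algebra_simps sum.distrib)

lemma E0_scale_left: "E0 (\<lambda>x. c * f x) h = c * E0 f h"
  unfolding energy0_def by (simp add: sum_distrib_left mult.assoc)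

text \<open>
  Since the kernel of \<open>H\<close> consists of the constants, any two points of \<open>V\<close> are joined by a path of
  edges of positive conductance.
\<close>

lemma resistance_bound:
  "\<exists>c>0. \<forall>f. \<forall>x\<in>V. \<forall>y\<in>V. \<bar>f x - f y\<bar> \<le> c * (\<Sum>x\<in>V. \<Sum>y\<in>V. H x y * \<bar>f x - f y\<bar>)"
proof -
  define S where "S f = (\<Sum>x\<in>V. \<Sum>y\<in>V. H x y * \<bar>f x - f y\<bar>)" for f :: "'a \<Rightarrow> real"
  have term_nonneg: "0 \<le> H x y * \<bar>f x - f y\<bar>" if "x \<in> V" "y \<in> V" for f x y
    using H_nonneg[OF that] by (cases "x = y") auto
  have S_nonneg: "0 \<le> S f" for f
    unfolding S_def by (intro sum_nonneg term_nonneg)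
  have edge_le: "H x y * \<bar>f x - f y\<bar> \<le> S f" if "x \<in> V" "y \<in> V" for f x y
  proof -
    have "H x y * \<bar>f x - f y\<bar> \<le> (\<Sum>y\<in>V. H x y * \<bar>f x - f y\<bar>)"
      using that finite_V by (intro member_le_sum term_nonneg) auto
    also have "\<dots> \<le> S f"
      unfolding S_def using that finite_V
      by (intro member_le_sum[of x V "\<lambda>x. \<Sum>y\<in>V. H x y * \<bar>f x - f y\<bar>"] sum_nonneg term_nonneg) auto
    finally show ?thesis .
  qed
  define R where "R = {(x, y). x \<in> V \<and> y \<in> V \<and> x \<noteq> y \<and> 0 < H x y}"
  have reach_bound: "\<exists>c\<ge>0. \<forall>f. \<bar>f x - f y\<bar> \<le> c * S f" if "(x, y) \<in> R\<^sup>*" for x y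
    using that
  proof (induction rule: rtrancl_induct)
    case base
    then show ?case
      by (intro exI[of _ 0]) auto
  next
    case (step y z)
    then obtain c where c: "c \<ge> 0" "\<And>f. \<bar>f x - f y\<bar> \<le> c * S f"
      by blast
    have yz: "y \<in> V" "z \<in> V" "0 < H y z"
      using step(2) unfolding R_def by auto
    have "\<bar>f x - f z\<bar> \<le> (c + 1 / H y z) * S f" for f
    proof -
      have "\<bar>f y - f z\<bar> \<le> (1 / H y z) * S f"
        using edge_le[OF yz(1,2), of f] yz(3) by (simp add: field_simps)
      then show ?thesis
        using c(2)[of f] unfolding distrib_right by linarith
    qed
    then show ?case
      using c(1) yz(3) by (intro exI[of _ "c + 1 / H y z"]) auto
  qed
  have reach: "(x, y) \<in> R\<^sup>*" if "x \<in> V" "y \<in> V" for x y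
  proof -
    \<comment> \<open>Indicator of the points reachable from \<open>x\<close>. No edge of positive
      conductance leaves this set, so \<open>H\<close> annihilates the indicator, and the kernel
      condition makes it constant on \<open>V\<close>.\<close>
    define f :: "'a \<Rightarrow> real" where "f z = (if (x, z) \<in> R\<^sup>* then 1 else 0)" for z
    have no_edge: "H z z' = 0" if "z \<in> V" "z' \<in> V" "f z \<noteq> f z'" for z z'
    proof (rule ccontr)
      assume "H z z' \<noteq> 0"
      moreover have "z \<noteq> z'"
        using that by auto
      ultimately have "(z, z') \<in> R" "(z', z) \<in> R"
        using H_nonneg[of z z'] H_sym[of z z'] that unfolding R_def by auto
      then show False
        using that(3) unfolding f_def by (auto split: if_splits intro: rtrancl_into_rtrancl)
    qed
    have "(\<Sum>z'\<in>V. H z z' * f z') = 0" if "z \<in> V" for z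
    proof -
      have "(\<Sum>z'\<in>V. H z z' * f z') = (\<Sum>z'\<in>V. H z z' * f z)"
        using no_edge that by (intro sum.cong) force+
      then show ?thesis
        using H_row_sum[OF that] by (simp flip: sum_distrib_right)
    qed
    then have "f constant_on V"
      using H_kernel by blast
    then have "f y = f x"
      using that unfolding constant_on_def by auto
    then show ?thesis
      unfolding f_def by (auto split: if_splits)
  qed
  obtain c where c: "\<And>x y. x \<in> V \<Longrightarrow> y \<in> V \<Longrightarrow> c x y \<ge> (0::real)"
    "\<And>x y f. x \<in> V \<Longrightarrow> y \<in> V \<Longrightarrow> \<bar>f x - f y\<bar> \<le> c x y * S f"
    using reach_bound[OF reach] by metis
  define C where "C = (\<Sum>x\<in>V. \<Sum>y\<in>V. c x y) + 1"
  have "C > 0"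
    unfolding C_def by (intro add_nonneg_pos sum_nonneg) (auto simp: c)
  moreover have "\<bar>f x - f y\<bar> \<le> C * S f" if "x \<in> V" "y \<in> V" for f x y
  proof -
    have "c x y \<le> (\<Sum>y\<in>V. c x y)"
      using that finite_V c(1) by (intro member_le_sum) auto
    also have "\<dots> \<le> (\<Sum>x\<in>V. \<Sum>y\<in>V. c x y)"
      using that finite_V c(1) by (intro member_le_sum[of x V "\<lambda>x. \<Sum>y\<in>V. c x y"] sum_nonneg) auto
    finally have "c x y * S f \<le> C * S f"
      using S_nonneg by (intro mult_right_mono) (auto simp: C_def)
    then show ?thesis
      using c(2)[OF that, of f] by linarith
  qed
  ultimately show ?thesis
    unfolding S_def by blast
qed

lemma E0_zero_imp_const:
  assumes "E0 f f = 0" "x \<in> V" "y \<in> V"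
  shows "f x = f y"
proof -
  have nonneg: "0 \<le> H x y * (f x - f y) * (f x - f y)" if "x \<in> V" "y \<in> V" for x y
    using that by (intro E0_term_nonneg) auto
  have "(\<Sum>x\<in>V. \<Sum>y\<in>V. H x y * (f x - f y) * (f x - f y)) = 0"
    using assms(1) unfolding E0_eq_edges by simp
  then have "H x y * (f x - f y) * (f x - f y) = 0" if "x \<in> V" "y \<in> V" for x y
    using that nonneg finite_V by (simp add: sum_nonneg_eq_0_iff sum_nonneg)
  then have "(\<Sum>x\<in>V. \<Sum>y\<in>V. H x y * \<bar>f x - f y\<bar>) = 0"
    by (intro sum.neutral ballI) auto
  moreover obtain c where "\<And>f x y. x \<in> V \<Longrightarrow> y \<in> V \<Longrightarrow>
      \<bar>f x - f y\<bar> \<le> c * (\<Sum>x\<in>V. \<Sum>y\<in>V. H x y * \<bar>f x - f y\<bar>)"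
    using resistance_bound by blast
  from this[OF assms(2,3), of f] have "\<bar>f x - f y\<bar> \<le> c * (\<Sum>x\<in>V. \<Sum>y\<in>V. H x y * \<bar>f x - f y\<bar>)" .
  ultimately show ?thesis
    by simp
qed

section \<open>Energies of level m\<close>

lemma prod_list_r: "w \<in> W m \<Longrightarrow> prod_list (map r w) = q ^ m"
  by (induction m arbitrary: w) (auto simp: words_Suc r_eq)

lemma EL_eq: "EL m f g = inverse q ^ m * (\<Sum>w\<in>W m. E0 (f \<circ> FW w) (g \<circ> FW w))"
  unfolding energy_level_def sum_distrib_left
  by (intro sum.cong) (auto simp: prod_list_r power_inverse)

lemma EL_0 [simp]: "EL 0 f g = E0 f g"
  by (simp add: EL_eq)

lemma EL_Suc: "EL (Suc m) f g = inverse q * (\<Sum>i\<in>{1..M}. EL m (f \<circ> F i) (g \<circ> F i))"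
  unfolding EL_eq sum_words_Suc by (simp add: sum_distrib_left mult.assoc o_assoc)

lemma EL_1: "EL 1 f g = inverse q * (\<Sum>i\<in>{1..M}. E0 (f \<circ> F i) (g \<circ> F i))"
  using EL_Suc[of 0 f g] by simp

lemma EL_add: "EL (m + k) f g = inverse q ^ m * (\<Sum>w\<in>W m. EL k (f \<circ> FW w) (g \<circ> FW w))"
proof (induction m arbitrary: f g)
  case (Suc m)
  show ?case
    unfolding add_Suc EL_Suc Suc sum_words_Suc
    by (simp add: sum_distrib_left mult.assoc o_assoc)
qed simp

lemma EL_cong:
  assumes "\<And>x. x \<in> K \<Longrightarrow> f x = f' x" "\<And>x. x \<in> K \<Longrightarrow> g x = g' x"
  shows "EL m f g = EL m f' g'"
  unfolding EL_eq using V_subset_K FW_in_K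
  by (intro arg_cong2[of _ _ _ _ "(*)"] sum.cong E0_cong) (auto intro!: assms)

lemma EL_sym: "EL m f g = EL m g f"
  unfolding EL_eq by (simp add: E0_sym)

lemma EL_nonneg: "0 \<le> EL m f f"
  unfolding EL_eq using q_pos by (intro mult_nonneg_nonneg sum_nonneg E0_nonneg) auto

lemma EL_add_left: "EL m (\<lambda>x. f x + g x) h = EL m f h + EL m g h"
  unfolding EL_eq comp_def by (simp add: E0_add_left sum.distrib distrib_left)

lemma EL_scale_left: "EL m (\<lambda>x. c * f x) h = c * EL m f h"
  unfolding EL_eq comp_def by (simp add: E0_scale_left sum_distrib_left mult_ac)

lemma EL_add_right: "EL m h (\<lambda>x. f x + g x) = EL m h f + EL m h g"
  by (metis EL_add_left EL_sym)

lemma EL_scale_right: "EL m h (\<lambda>x. c * f x) = c * EL m h f"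
  by (metis EL_scale_left EL_sym)

lemma EL_diff_left: "EL m (\<lambda>x. f x - g x) h = EL m f h - EL m g h"
  using EL_add_left[of m f "\<lambda>x. - 1 * g x" h] EL_scale_left[of m "-1" g h] by simp

lemma EL_diff_right: "EL m h (\<lambda>x. f x - g x) = EL m h f - EL m h g"
  by (metis EL_diff_left EL_sym)

lemma E0_le_EL_1: "(\<And>x. x \<in> V \<Longrightarrow> g x = f x) \<Longrightarrow> E0 f f \<le> EL 1 g g"
  using harmonic unfolding harmonic_structure_def by blast

lemma EL_incseq: "incseq (\<lambda>m. EL m f f)"
proof (rule incseq_SucI)
  fix m
  have "EL m f f = EL (m + 0) f f"
    by simp
  also have "\<dots> \<le> EL (m + 1) f f"
    unfolding EL_add using q_pos E0_le_EL_1
    by (intro mult_left_mono sum_mono) auto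
  finally show "EL m f f \<le> EL (Suc m) f f"
    by simp
qed

text \<open>
  Truncation does not increase energy, so a minimizer can be chosen that obeys the maximum
  principle.
\<close>

lemma bounded_minimizer_exists:
  "\<exists>g. (\<forall>x\<in>V. g x = f x) \<and> EL 1 g g = E0 f f \<and> (\<forall>x. Min (f ` V) \<le> g x \<and> g x \<le> Max (f ` V))"
proof -
  obtain g where g: "\<And>x. x \<in> V \<Longrightarrow> g x = f x" "EL 1 g g = E0 f f"
    using harmonic unfolding harmonic_structure_def by metis
  define lo hi where "lo = Min (f ` V)" and "hi = Max (f ` V)"
  have range_f: "lo \<le> f x" "f x \<le> hi" if "x \<in> V" for x
    unfolding lo_def hi_def using that finite_V by auto
  then have "lo \<le> hi"
    using V_nonempty by fastforce
  define k where "k x = max lo (min hi (g x))" for x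
  have E0_k: "E0 (k \<circ> h) (k \<circ> h) \<le> E0 (g \<circ> h) (g \<circ> h)" for h :: "'a \<Rightarrow> 'a"
    unfolding E0_eq_edges
  proof (intro divide_right_mono sum_mono)
    fix x y assume xy: "x \<in> V" "y \<in> V"
    have "\<bar>k (h x) - k (h y)\<bar> \<le> \<bar>g (h x) - g (h y)\<bar>"
      unfolding k_def by (auto simp: max_def min_def)
    then have "(k (h x) - k (h y))\<^sup>2 \<le> (g (h x) - g (h y))\<^sup>2"
      by (rule abs_le_square_iff[THEN iffD1])
    then have "H x y * (k (h x) - k (h y))\<^sup>2 \<le> H x y * (g (h x) - g (h y))\<^sup>2"
      using H_nonneg[OF xy] by (cases "x = y") (auto intro: mult_left_mono)
    then show "H x y * ((k \<circ> h) x - (k \<circ> h) y) * ((k \<circ> h) x - (k \<circ> h) y)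
        \<le> H x y * ((g \<circ> h) x - (g \<circ> h) y) * ((g \<circ> h) x - (g \<circ> h) y)"
      by (simp add: power2_eq_square mult.assoc)
  qed auto
  have k_V: "k x = f x" if "x \<in> V" for x
    unfolding k_def using g(1)[OF that] range_f[OF that] by simp
  have "EL 1 k k \<le> EL 1 g g"
    unfolding EL_1 using q_pos E0_k by (intro mult_left_mono sum_mono) auto
  moreover have "E0 f f \<le> EL 1 k k"
    using k_V by (rule E0_le_EL_1)
  moreover have "lo \<le> k x" "k x \<le> hi" for x
    unfolding k_def using \<open>lo \<le> hi\<close> by auto
  ultimately show ?thesis
    using k_V g(2) unfolding lo_def hi_def by (intro exI[of _ k]) auto
qed

text \<open>The minimizer is selected together with its range bounds, so that the maximum principle
  can be iterated through the levels.\<close>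

definition hmin :: "('a \<Rightarrow> real) \<Rightarrow> 'a \<Rightarrow> real" where
  "hmin f = (SOME g. (\<forall>x\<in>V. g x = f x) \<and> EL 1 g g = E0 f f \<and>
     (\<forall>x. Min (f ` V) \<le> g x \<and> g x \<le> Max (f ` V)))"

lemma hmin_V: "x \<in> V \<Longrightarrow> hmin f x = f x"
  and hmin_energy: "EL 1 (hmin f) (hmin f) = E0 f f"
  and hmin_range: "Min (f ` V) \<le> hmin f x" "hmin f x \<le> Max (f ` V)"
  unfolding hmin_def using someI_ex[OF bounded_minimizer_exists[of f]] by blast+

lemma hmin_bounds:
  assumes "\<And>p. p \<in> V \<Longrightarrow> lo \<le> f p" "\<And>p. p \<in> V \<Longrightarrow> f p \<le> hi"
  shows "lo \<le> hmin f x" "hmin f x \<le> hi"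
proof -
  have "lo \<le> Min (f ` V)" "Max (f ` V) \<le> hi"
    using finite_V V_nonempty assms by auto
  then show "lo \<le> hmin f x" "hmin f x \<le> hi"
    using hmin_range[of f x] by linarith+
qed

text \<open>Vary the minimizer by \<open>s * g\<close>, where \<open>g\<close> may be nonzero on
  \<open>V\<close>: the comparison is with the minimal energy for the boundary values
  \<open>f + s * g\<close>. Equality at \<open>s = 0\<close> removes the constant term of the
  quadratic in \<open>s\<close>, so its linear coefficient \<open>2 * D\<close> vanishes. In
  particular the pairing depends on \<open>g\<close> only through its values on
  \<open>V\<close>.\<close>

lemma hmin_harmonic: "EL 1 (hmin f) g = E0 f g"
proof -
  define h where "h = hmin f"
  define D where "D = EL 1 h g - E0 f g"
  define B where "B = EL 1 g g - E0 g g"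
  have "0 \<le> 2 * s * D + s\<^sup>2 * B" for s
  proof -
    have "E0 (\<lambda>x. f x + s * g x) (\<lambda>x. f x + s * g x) \<le> EL 1 (\<lambda>x. h x + s * g x) (\<lambda>x. h x + s * g x)"
      by (rule E0_le_EL_1) (simp add: h_def hmin_V)
    then have "EL 0 (\<lambda>x. f x + s * g x) (\<lambda>x. f x + s * g x) \<le> EL 1 (\<lambda>x. h x + s * g x) (\<lambda>x. h x + s * g x)"
      by simp
    then have "EL 0 f f + 2 * s * EL 0 f g + s\<^sup>2 * EL 0 g g \<le> EL 1 h h + 2 * s * EL 1 h g + s\<^sup>2 * EL 1 g g"
      unfolding EL_add_left EL_add_right EL_scale_left EL_scale_right EL_sym[of _ g f] EL_sym[of _ g h]
      by (simp add: algebra_simps power2_eq_square)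
    then show ?thesis
      unfolding D_def B_def using hmin_energy[of f] by (simp add: algebra_simps h_def)
  qed
  then have "D = 0"
    by (rule zero_if_quadratic_nonneg)
  then show ?thesis
    unfolding D_def h_def by simp
qed

text \<open>
  \<open>hvals f w p\<close> is the value at \<open>FW w p\<close> (\<open>p \<in> V\<close>) of the harmonic extension of the boundary
  values \<open>f\<close>.
\<close>

primrec hvals :: "('a \<Rightarrow> real) \<Rightarrow> nat list \<Rightarrow> 'a \<Rightarrow> real" where
  "hvals f [] = f"
| "hvals f (i # w) = hvals (hmin f \<circ> F i) w"

lemma hvals_append: "hvals f (v @ w) = hvals (hvals f v) w"
  by (induction v arbitrary: f) auto

lemma hvals_bounds:
  assumes "\<And>p. p \<in> V \<Longrightarrow> lo \<le> f p" "\<And>p. p \<in> V \<Longrightarrow> f p \<le> hi" "p \<in> V"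
  shows "lo \<le> hvals f w p \<and> hvals f w p \<le> hi"
  using assms
proof (induction w arbitrary: f)
  case (Cons i w)
  have "lo \<le> (hmin f \<circ> F i) p" "(hmin f \<circ> F i) p \<le> hi" for p
    using hmin_bounds[of lo f hi "F i p"] Cons.prems by simp_all
  then show ?case
    unfolding hvals.simps using Cons.prems(3) by (rule Cons.IH)
qed simp

text \<open>Either the parent cells coincide, or the common point is a vertex of both parents, where
  \<open>hmin\<close> keeps the given value and the induction hypothesis applies.\<close>

lemma hvals_consistent:
  assumes "w \<in> W m" "v \<in> W m" "x \<in> V" "y \<in> V" "FW w x = FW v y"
  shows "hvals f w x = hvals f v y"
  using assms
proof (induction m arbitrary: w v x y)
  case (Suc m)
  obtain w' i where w: "w = w' @ [i]" "w' \<in> W m" "i \<in> {1..M}"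
    using words_Suc_snoc[OF Suc.prems(1)] by blast
  obtain v' j where v: "v = v' @ [j]" "v' \<in> W m" "j \<in> {1..M}"
    using words_Suc_snoc[OF Suc.prems(2)] by blast
  have eq: "FW w' (F i x) = FW v' (F j y)"
    using Suc.prems(5) w v by (simp add: word_map_append)
  have inK: "F i x \<in> K" "F j y \<in> K"
    using F_in_K V_subset_K w v Suc.prems by blast+
  have "hmin (hvals f w') (F i x) = hmin (hvals f v') (F j y)"
  proof (cases "w' = v'")
    case True
    then show ?thesis
      using eq by simp
  next
    case False
    then have V: "F i x \<in> V" "F j y \<in> V"
      using overlap_in_V[OF w(2) v(2) False inK eq] overlap_in_V[OF v(2) w(2) _ inK(2,1) eq[symmetric]]
      by blast+
    then show ?thesis
      using Suc.IH[OF w(2) v(2) V eq] by (simp add: hmin_V)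
  qed
  then show ?case
    by (simp add: w v hvals_append)
qed simp

lemma hvals_persist:
  assumes "p \<in> V"
  obtains s p' where "s \<in> W k" "p' \<in> V" "p = FW s p'" "\<And>f. hvals f s p' = f p"
  using assms
proof (induction k arbitrary: p thesis)
  case (Suc k)
  obtain i p1 where p1: "i \<in> {1..M}" "p1 \<in> V" "p = F i p1"
    using V_refine Suc.prems(2) by blast
  obtain s p' where s: "s \<in> W k" "p' \<in> V" "p1 = FW s p'" "\<And>f. hvals f s p' = f p1"
    using Suc.IH p1(2) by blast
  have "hvals f (i # s) p' = f p" for f
    using s(4) p1(3) hmin_V Suc.prems(2) by simp
  then show ?case
    using Suc.prems(1)[of "i # s" p'] s p1 by simp
next
  case 0
  then show ?case
    by (metis hvals.simps(1) id_apply singletonI word_map_Nil words_0)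
qed

text \<open>\<open>hmin_harmonic\<close> applied in every cell, level by level. For \<open>g\<close>
  an indicator it says that the total current through the corresponding cut can be read off at the
  boundary.\<close>

lemma hvals_energy:
  "inverse q ^ j * (\<Sum>w\<in>W j. E0 (hvals f w) (g \<circ> FW w)) = E0 f g"
proof (induction j arbitrary: f g)
  case (Suc j)
  have "inverse q ^ Suc j * (\<Sum>w\<in>W (Suc j). E0 (hvals f w) (g \<circ> FW w)) =
      inverse q * (\<Sum>i\<in>{1..M}. inverse q ^ j * (\<Sum>w\<in>W j. E0 (hvals (hmin f \<circ> F i) w) ((g \<circ> F i) \<circ> FW w)))"
    unfolding sum_words_Suc by (simp add: sum_distrib_left mult.assoc o_assoc)
  also have "\<dots> = EL 1 (hmin f) g"
    unfolding Suc EL_1 ..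
  finally show ?case
    by (simp only: hmin_harmonic)
qed simp

text \<open>
  The current through any single edge is at most the total current through a level set of the
  harmonic function, and the latter is controlled by the boundary values.
\<close>

lemma edge_current_bound:
  assumes w: "w \<in> W j" and xy: "x \<in> V" "y \<in> V"
    and D: "\<And>p p'. p \<in> V \<Longrightarrow> p' \<in> V \<Longrightarrow> \<bar>f p - f p'\<bar> \<le> D"
  shows "H x y * \<bar>hvals f w x - hvals f w y\<bar> \<le> q ^ j * (\<Sum>p\<in>V. \<Sum>p'\<in>V. \<bar>H p p'\<bar>) * D"
proof -
  define B where "B = (\<Sum>p\<in>V. \<Sum>p'\<in>V. \<bar>H p p'\<bar>)"
  have "D \<ge> 0"
    using D[OF xy(1) xy(1)] by simp
  have "B \<ge> 0"
    unfolding B_def by (intro sum_nonneg) auto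
  have main: "H x y * (hvals f w x - hvals f w y) \<le> q ^ j * B * D"
    if xy: "x \<in> V" "y \<in> V" and less: "hvals f w y < hvals f w x" for x y
  proof -
    define t where "t = hvals f w x"
    \<comment> \<open>Indicator of the superlevel set at the height of \<open>x\<close>, on the
      vertices of level \<open>j\<close>; by \<open>hvals_consistent\<close> it does not matter
      which cell names a vertex. It is a nondecreasing function of the harmonic values, so every
      edge contributes nonnegatively to the pairing with it, and a single edge contributes at most
      the whole pairing.\<close>
    define \<psi> :: "'a \<Rightarrow> real" where
      "\<psi> z = (if \<exists>v\<in>W j. \<exists>p\<in>V. z = FW v p \<and> t \<le> hvals f v p then 1 else 0)" for z
    have \<psi>_cell: "\<psi> (FW v p) = (if t \<le> hvals f v p then 1 else 0)" if "v \<in> W j" "p \<in> V" for v p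
      unfolding \<psi>_def using that hvals_consistent[where f = f] by (smt (verit, best))
    have \<psi>_01: "0 \<le> \<psi> z" "\<psi> z \<le> 1" for z
      unfolding \<psi>_def by auto
    have term_nonneg: "0 \<le> H p p' * (hvals f v p - hvals f v p') * ((\<psi> \<circ> FW v) p - (\<psi> \<circ> FW v) p')"
      if "v \<in> W j" "p \<in> V" "p' \<in> V" for v p p'
      using that by (intro E0_term_nonneg) (auto simp: \<psi>_cell)
    then have cell_nonneg: "0 \<le> E0 (hvals f v) (\<psi> \<circ> FW v)" if "v \<in> W j" for v
      unfolding E0_eq_edges using that by (intro divide_nonneg_nonneg sum_nonneg) auto
    have "H x y * (hvals f w x - hvals f w y) / 2
        = H x y * (hvals f w x - hvals f w y) * ((\<psi> \<circ> FW w) x - (\<psi> \<circ> FW w) y) / 2"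
      using w xy less by (simp add: \<psi>_cell t_def)
    also have "\<dots> \<le> (\<Sum>p'\<in>V. H x p' * (hvals f w x - hvals f w p') * ((\<psi> \<circ> FW w) x - (\<psi> \<circ> FW w) p')) / 2"
      using xy finite_V term_nonneg[OF w]
      by (intro divide_right_mono member_le_sum[of y V "\<lambda>p'. H x p' * (hvals f w x - hvals f w p') * ((\<psi> \<circ> FW w) x - (\<psi> \<circ> FW w) p')"]) auto
    also have "\<dots> \<le> E0 (hvals f w) (\<psi> \<circ> FW w)"
      unfolding E0_eq_edges using xy finite_V term_nonneg[OF w]
      by (intro divide_right_mono member_le_sum[of x V "\<lambda>p. \<Sum>p'\<in>V. H p p' * (hvals f w p - hvals f w p') * ((\<psi> \<circ> FW w) p - (\<psi> \<circ> FW w) p')"] sum_nonneg) auto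
    also have "\<dots> \<le> (\<Sum>v\<in>W j. E0 (hvals f v) (\<psi> \<circ> FW v))"
      using w cell_nonneg by (intro member_le_sum[of w "W j" "\<lambda>v. E0 (hvals f v) (\<psi> \<circ> FW v)"]) auto
    also have "\<dots> = q ^ j * E0 f \<psi>"
      using hvals_energy[of j f \<psi>] q_pos by (simp add: field_simps)
    \<comment> \<open>At level 0 the pairing is linear in \<open>D\<close>, since
      \<open>\<psi>\<close> takes values between 0 and 1.\<close>
    also have "E0 f \<psi> \<le> (\<Sum>p\<in>V. \<Sum>p'\<in>V. \<bar>H p p'\<bar> * D) / 2"
      unfolding E0_eq_edges
    proof (intro divide_right_mono sum_mono)
      fix p p' assume "p \<in> V" "p' \<in> V"
      have "H p p' * (f p - f p') * (\<psi> p - \<psi> p') \<le> \<bar>H p p'\<bar> * \<bar>f p - f p'\<bar> * \<bar>\<psi> p - \<psi> p'\<bar>"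
        by (metis abs_ge_self abs_mult)
      also have "\<dots> \<le> \<bar>H p p'\<bar> * D * 1"
        using D[OF \<open>p \<in> V\<close> \<open>p' \<in> V\<close>] \<psi>_01[of p] \<psi>_01[of p'] \<open>D \<ge> 0\<close>
        by (intro mult_mono) auto
      finally show "H p p' * (f p - f p') * (\<psi> p - \<psi> p') \<le> \<bar>H p p'\<bar> * D"
        by simp
    qed auto
    also have "(\<Sum>p\<in>V. \<Sum>p'\<in>V. \<bar>H p p'\<bar> * D) / 2 = B * D / 2"
      unfolding B_def by (simp add: sum_distrib_right)
    finally show ?thesis
      using q_pos by simp
  qed
  show ?thesis
  proof (cases "hvals f w x" "hvals f w y" rule: linorder_cases)
    case less
    then show ?thesis
      using main[OF xy(2,1)] H_sym[OF xy] by (simp add: B_def)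
  next
    case equal
    then show ?thesis
      using \<open>B \<ge> 0\<close> \<open>D \<ge> 0\<close> q_pos by (simp add: B_def)
  next
    case greater
    then show ?thesis
      using main[OF xy] by (simp add: B_def)
  qed
qed

text \<open>\<open>resistance_bound\<close> converts the currents through the edges of one cell into
  differences of vertex values. The summand 1 in \<open>C\<close> ensures a constant of at least 1,
  which later keeps trivial bounds below it.\<close>

lemma hvals_oscillation:
  "\<exists>c\<ge>1. \<forall>f D j. \<forall>w\<in>W j. \<forall>x\<in>V. \<forall>y\<in>V. (\<forall>p\<in>V. \<forall>p'\<in>V. \<bar>f p - f p'\<bar> \<le> D) \<longrightarrow>
     \<bar>hvals f w x - hvals f w y\<bar> \<le> c * q ^ j * D"
proof -
  obtain c where c: "c > 0"
    "\<And>f x y. x \<in> V \<Longrightarrow> y \<in> V \<Longrightarrow> \<bar>f x - f y\<bar> \<le> c * (\<Sum>x\<in>V. \<Sum>y\<in>V. H x y * \<bar>f x - f y\<bar>)"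
    using resistance_bound by blast
  define B where "B = (\<Sum>p\<in>V. \<Sum>p'\<in>V. \<bar>H p p'\<bar>)"
  define C where "C = c * (real (card V) * real (card V) * B) + 1"
  have "B \<ge> 0"
    unfolding B_def by (intro sum_nonneg) auto
  then have "C \<ge> 1"
    unfolding C_def using c(1) by simp
  moreover have "\<bar>hvals f w x - hvals f w y\<bar> \<le> C * q ^ j * D"
    if w: "w \<in> W j" and xy: "x \<in> V" "y \<in> V"
      and D: "\<And>p p'. p \<in> V \<Longrightarrow> p' \<in> V \<Longrightarrow> \<bar>f p - f p'\<bar> \<le> D" for f D j w x y
  proof -
    have "D \<ge> 0"
      using D[OF xy(1) xy(1)] by simp
    have "(\<Sum>x\<in>V. \<Sum>y\<in>V. H x y * \<bar>hvals f w x - hvals f w y\<bar>) \<le> (\<Sum>x\<in>V. \<Sum>y\<in>V. q ^ j * B * D)"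
      unfolding B_def using edge_current_bound[OF w _ _ D] by (intro sum_mono) auto
    also have "\<dots> = real (card V) * real (card V) * (q ^ j * B * D)"
      by simp
    finally have "c * (\<Sum>x\<in>V. \<Sum>y\<in>V. H x y * \<bar>hvals f w x - hvals f w y\<bar>) \<le> c * (real (card V) * real (card V) * (q ^ j * B * D))"
      using c(1) by (intro mult_left_mono) auto
    also have "\<dots> = (C - 1) * q ^ j * D"
      unfolding C_def by simp
    also have "\<dots> \<le> C * q ^ j * D"
      using \<open>D \<ge> 0\<close> q_pos by (intro mult_right_mono) auto
    finally show ?thesis
      using c(2)[OF xy, of "hvals f w"] by linarith
  qed
  ultimately show ?thesis
    by blast
qed

definition osc_le :: "('a \<Rightarrow> real) \<Rightarrow> real \<Rightarrow> bool" where
  "osc_le f D \<longleftrightarrow> (\<forall>p\<in>V. \<forall>p'\<in>V. \<bar>f p - f p'\<bar> \<le> D)"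

lemma osc_le_nonneg: "osc_le f D \<Longrightarrow> D \<ge> 0"
  unfolding osc_le_def using V_nonempty by fastforce

definition osc_const :: real where
  "osc_const = (SOME c. c \<ge> 1 \<and> (\<forall>f D j. \<forall>w\<in>W j. \<forall>x\<in>V. \<forall>y\<in>V.
     osc_le f D \<longrightarrow> \<bar>hvals f w x - hvals f w y\<bar> \<le> c * q ^ j * D))"

lemma osc_const_ge_1: "osc_const \<ge> 1"
  and hvals_osc: "w \<in> W j \<Longrightarrow> x \<in> V \<Longrightarrow> y \<in> V \<Longrightarrow>
    osc_le f D \<Longrightarrow>
    \<bar>hvals f w x - hvals f w y\<bar> \<le> osc_const * q ^ j * D"
  unfolding osc_const_def using someI_ex[OF hvals_oscillation, folded osc_le_def] by blast+

lemma q_power_tendsto_0: "(\<lambda>m. c * q ^ m) \<longlonglongrightarrow> 0"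
  using q_pos q_less_1 by (intro tendsto_mult_right_zero LIMSEQ_power_zero) auto

text \<open>Pass from \<open>v\<close> to its ancestor \<open>v'\<close> of level \<open>m\<close>.
  By the maximum principle the values below \<open>v'\<close> stay in the range of its vertex
  values, which costs one oscillation bound. If \<open>v'\<close> differs from \<open>w\<close>,
  then \<open>x\<close> lies in both cells and is a common vertex of them, and going through it
  costs a second bound.\<close>

lemma hvals_close:
  assumes w: "w \<in> W m" and v: "v \<in> W (m + k)" and x: "x \<in> FW w ` K" "x \<in> FW v ` K"
    and p: "p \<in> V" "p' \<in> V"
    and D: "osc_le f D"
  shows "\<bar>hvals f w p - hvals f v p'\<bar> \<le> 2 * osc_const * q ^ m * D"
proof -
  let ?B = "osc_const * q ^ m * D"
  have "?B \<ge> 0"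
    using osc_le_nonneg[OF D] osc_const_ge_1 q_pos by (intro mult_nonneg_nonneg) auto
  obtain v' s where vs: "v = v' @ s" "v' \<in> W m" "s \<in> W k"
    using words_add_split[OF v] by blast
  have tail: "\<bar>hvals f v' y - hvals f v p'\<bar> \<le> ?B" if "y \<in> V" for y
  proof -
    have "hvals f v' y - ?B \<le> hvals f v' p" "hvals f v' p \<le> hvals f v' y + ?B" if "p \<in> V" for p
      using hvals_osc[OF vs(2) \<open>y \<in> V\<close> that D] by linarith+
    then have "hvals f v' y - ?B \<le> hvals (hvals f v') s p' \<and> hvals (hvals f v') s p' \<le> hvals f v' y + ?B"
      using p(2) by (rule hvals_bounds)
    then show ?thesis
      unfolding vs(1) hvals_append by linarith
  qed
  show ?thesis
  proof (cases "w = v'")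
    case True
    then show ?thesis
      using tail[OF p(1)] \<open>?B \<ge> 0\<close> by simp
  next
    case False
    obtain y y' where y: "y \<in> K" "y' \<in> K" "FW w y = FW v' y'"
      using x FW_in_K[OF vs(3)] unfolding vs(1) word_map_append by auto
    then have V: "y \<in> V" "y' \<in> V"
      using overlap_in_V[OF w vs(2) False] overlap_in_V[OF vs(2) w] False by metis+
    have "hvals f w y = hvals f v' y'"
      using hvals_consistent[OF w vs(2) V y(3)] .
    moreover have "\<bar>hvals f w p - hvals f w y\<bar> \<le> ?B"
      using hvals_osc[OF w p(1) V(1) D] by blast
    ultimately show ?thesis
      using tail[OF V(2)] by linarith
  qed
qed

section \<open>Pointwise harmonic extension to K\<close>

definition vertex0 :: 'a where "vertex0 = (SOME p. p \<in> V)"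

lemma vertex0: "vertex0 \<in> V"
  unfolding vertex0_def using V_nonempty some_in_eq by blast

definition cell_word :: "nat \<Rightarrow> 'a \<Rightarrow> nat list" where
  "cell_word m x = (SOME w. w \<in> W m \<and> x \<in> FW w ` K)"

lemma cell_word: "x \<in> K \<Longrightarrow> cell_word m x \<in> W m" "x \<in> K \<Longrightarrow> x \<in> FW (cell_word m x) ` K"
  unfolding cell_word_def using someI_ex[of "\<lambda>w. w \<in> W m \<and> x \<in> FW w ` K"] K_cell[of x m] by blast+

text \<open>The words \<open>cell_word m x\<close> are chosen separately for each \<open>m\<close>
  and need not be prefixes of one another. \<open>hvals_close\<close> gives convergence all the
  same, and independence of the chosen cells and vertices.\<close>

definition hext :: "('a \<Rightarrow> real) \<Rightarrow> 'a \<Rightarrow> real" where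
  "hext f x = lim (\<lambda>m. hvals f (cell_word m x) vertex0)"

lemma osc_bound_exists: "\<exists>D\<ge>0. osc_le f D"
proof -
  let ?S = "(\<lambda>(p, p'). \<bar>f p - f p'\<bar>) ` (V \<times> V)"
  have "\<bar>f p - f p'\<bar> \<le> Max ?S" if "p \<in> V" "p' \<in> V" for p p'
    using finite_V that by (intro Max_ge) auto
  moreover from this[OF vertex0 vertex0] have "Max ?S \<ge> 0"
    by simp
  ultimately show ?thesis
    unfolding osc_le_def by blast
qed

lemma hext_LIMSEQ:
  assumes "x \<in> K"
  shows "(\<lambda>m. hvals f (cell_word m x) vertex0) \<longlonglongrightarrow> hext f x"
proof -
  obtain D where D: "D \<ge> 0" "osc_le f D"
    using osc_bound_exists[of f] by blast
  let ?h = "\<lambda>m. hvals f (cell_word m x) vertex0"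
  have le: "\<bar>?h m - ?h (m + k)\<bar> \<le> 2 * osc_const * q ^ m * D" for m k
    by (rule hvals_close[OF cell_word(1) cell_word(1) cell_word(2) cell_word(2) vertex0 vertex0 D(2)])
      (fact assms)+
  have "Cauchy ?h"
  proof (rule CauchyI')
    fix e :: real assume "e > 0"
    moreover have "(\<lambda>m. (2 * osc_const * D) * q ^ m) \<longlonglongrightarrow> 0"
      by (rule q_power_tendsto_0)
    ultimately have "eventually (\<lambda>m. (2 * osc_const * D) * q ^ m < e) sequentially"
      by (rule order_tendstoD(2)[rotated])
    then obtain N where N: "\<And>m. m \<ge> N \<Longrightarrow> (2 * osc_const * D) * q ^ m < e"
      using eventually_sequentially by auto
    have "dist (?h m) (?h k) < e" if "m \<ge> N" "m < k" for m k
    proof -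
      have "\<bar>?h m - ?h (m + (k - m))\<bar> \<le> 2 * osc_const * q ^ m * D"
        by (rule le)
      also have "\<dots> < e"
        using N[OF that(1)] by (simp add: mult_ac)
      finally show ?thesis
        using that by (simp add: dist_real_def)
    qed
    then show "\<exists>N. \<forall>m\<ge>N. \<forall>n>m. dist (?h m) (?h n) < e"
      by blast
  qed
  then show ?thesis
    unfolding hext_def by (intro convergent_LIMSEQ_iff[THEN iffD1] Cauchy_convergent)
qed

lemma hext_approx:
  assumes "x \<in> K" "w \<in> W m" "x \<in> FW w ` K" "p \<in> V"
    and D: "osc_le f D"
  shows "\<bar>hvals f w p - hext f x\<bar> \<le> 2 * osc_const * q ^ m * D"
proof (rule tendsto_upperbound[OF tendsto_rabs[OF tendsto_diff[OF tendsto_const LIMSEQ_ignore_initial_segment[OF hext_LIMSEQ[OF assms(1)], where k = m]]]])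
  show "\<forall>\<^sub>F n in sequentially. \<bar>hvals f w p - hvals f (cell_word (n + m) x) vertex0\<bar> \<le> 2 * osc_const * q ^ m * D"
  proof (intro always_eventually allI)
    fix n
    have "cell_word (n + m) x \<in> W (m + n)"
      using cell_word(1)[OF assms(1), of "n + m"] by (simp add: add.commute)
    then show "\<bar>hvals f w p - hvals f (cell_word (n + m) x) vertex0\<bar> \<le> 2 * osc_const * q ^ m * D"
      using hvals_close[OF assms(2) _ assms(3) cell_word(2)[OF assms(1)] assms(4) vertex0 D] by blast
  qed
qed simp

text \<open>Words of length \<open>Suc m\<close> are set against the rate \<open>q ^ m\<close> to
  fit \<open>hext_child\<close>, where they have the form \<open>i # w\<close> with \<open>w\<close>
  of length \<open>m\<close>.\<close>

lemma hext_eqI: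
  assumes "x \<in> K" "\<And>m. \<exists>w\<in>W (Suc m). \<exists>p\<in>V. x \<in> FW w ` K \<and> \<bar>hvals f w p - t\<bar> \<le> c * q ^ m"
  shows "hext f x = t"
proof -
  obtain D where D: "D \<ge> 0" "osc_le f D"
    using osc_bound_exists[of f] by blast
  have "\<bar>hext f x - t\<bar> \<le> (2 * osc_const * q * D + c) * q ^ m" for m
  proof -
    obtain w p where wp: "w \<in> W (Suc m)" "p \<in> V" "x \<in> FW w ` K" "\<bar>hvals f w p - t\<bar> \<le> c * q ^ m"
      using assms(2)[of m] by blast
    have "\<bar>hvals f w p - hext f x\<bar> \<le> 2 * osc_const * q ^ Suc m * D"
      using hext_approx[OF assms(1) wp(1,3,2) D(2)] by blast
    then show ?thesis
      using wp(4) by (simp add: algebra_simps)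
  qed
  then have "\<bar>hext f x - t\<bar> \<le> 0"
    by (intro tendsto_lowerbound[OF q_power_tendsto_0 always_eventually]) auto
  then show ?thesis
    by simp
qed

lemma hext_V:
  assumes "p \<in> V"
  shows "hext f p = f p"
proof (rule hext_eqI)
  show "p \<in> K"
    using assms V_subset_K by blast
  fix m
  obtain s p' where "s \<in> W (Suc m)" "p' \<in> V" "p = FW s p'" "hvals f s p' = f p"
    using hvals_persist[OF assms] by metis
  then show "\<exists>w\<in>W (Suc m). \<exists>p'\<in>V. p \<in> FW w ` K \<and> \<bar>hvals f w p' - f p\<bar> \<le> 0 * q ^ m"
    using V_subset_K by (intro bexI[of _ s] bexI[of _ p']) auto
qed

lemma hext_child:
  assumes "x \<in> K" "i \<in> {1..M}"
  shows "hext f (F i x) = hext (hmin f \<circ> F i) x"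
proof -
  let ?g = "hmin f \<circ> F i"
  obtain D where D: "D \<ge> 0" "osc_le ?g D"
    using osc_bound_exists[of ?g] by blast
  show ?thesis
  proof (rule hext_eqI[OF F_in_K[OF assms(2,1)]])
    fix m
    let ?w = "cell_word m x"
    have "\<bar>hvals ?g ?w vertex0 - hext ?g x\<bar> \<le> 2 * osc_const * q ^ m * D"
      using hext_approx[OF assms(1) cell_word[OF assms(1)] vertex0 D(2)] by blast
    then have "\<bar>hvals f (i # ?w) vertex0 - hext ?g x\<bar> \<le> (2 * osc_const * D) * q ^ m"
      by (simp add: mult_ac)
    moreover have "F i x \<in> FW (i # ?w) ` K"
      unfolding word_map_Cons image_comp[symmetric] using cell_word(2)[OF assms(1)] by (rule imageI)
    ultimately show "\<exists>w\<in>W (Suc m). \<exists>p\<in>V. F i x \<in> FW w ` K \<and>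
        \<bar>hvals f w p - hext ?g x\<bar> \<le> (2 * osc_const * D) * q ^ m"
      using cell_word(1)[OF assms(1), of m] vertex0 assms(2)
      by (intro bexI[of _ "i # ?w"] bexI[of _ vertex0]) auto
  qed
qed

lemma hext_word:
  assumes "x \<in> K" "w \<in> W m"
  shows "hext f (FW w x) = hext (hvals f w) x"
  using assms(2)
proof (induction m arbitrary: f w)
  case (Suc m)
  then obtain i v where w: "w = i # v" "i \<in> {1..M}" "v \<in> W m"
    by (auto simp: words_Suc)
  have "hext f (FW w x) = hext f (F i (FW v x))"
    by (simp add: w)
  also have "\<dots> = hext (hmin f \<circ> F i) (FW v x)"
    using w FW_in_K assms(1) by (intro hext_child)
  also have "\<dots> = hext (hvals (hmin f \<circ> F i) v) x"
    using w(3) by (rule Suc.IH)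
  finally show ?case
    by (simp only: w(1) hvals.simps)
qed simp

lemma hext_vertex: "w \<in> W m \<Longrightarrow> p \<in> V \<Longrightarrow> hext f (FW w p) = hvals f w p"
  using hext_word[of p w m f] hext_V[of p] V_subset_K by auto

lemma hext_bounds:
  assumes "\<And>p. p \<in> V \<Longrightarrow> lo \<le> f p" "\<And>p. p \<in> V \<Longrightarrow> f p \<le> hi" "x \<in> K"
  shows "lo \<le> hext f x" "hext f x \<le> hi"
proof -
  have "lo \<le> hvals f (cell_word m x) vertex0 \<and> hvals f (cell_word m x) vertex0 \<le> hi" for m
    using hvals_bounds[OF assms(1,2) vertex0] .
  then show "lo \<le> hext f x" "hext f x \<le> hi"
    using LIMSEQ_le_const[OF hext_LIMSEQ[OF assms(3)]] LIMSEQ_le_const2[OF hext_LIMSEQ[OF assms(3)]]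
    by blast+
qed

text \<open>On the cell, \<open>hext f\<close> is the extension of the vertex values
  \<open>hvals f w\<close>. It lies between the least and the greatest of them, so the oscillation
  bound for vertices carries over to all points.\<close>

lemma hext_osc:
  assumes "w \<in> W m" "x \<in> K" "y \<in> K"
    and D: "osc_le f D"
  shows "\<bar>hext f (FW w x) - hext f (FW w y)\<bar> \<le> osc_const * q ^ m * D"
proof -
  let ?g = "hvals f w"
  let ?lo = "Min (?g ` V)" and ?hi = "Max (?g ` V)"
  have "?lo \<le> hext ?g z" "hext ?g z \<le> ?hi" if "z \<in> K" for z
    using hext_bounds[of ?lo ?g ?hi z] finite_V that by auto
  then have "\<bar>hext ?g x - hext ?g y\<bar> \<le> ?hi - ?lo"
    using assms(2,3) by (smt (verit))
  moreover have "?hi \<in> ?g ` V" "?lo \<in> ?g ` V"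
    using finite_V V_nonempty by auto
  then have "\<bar>?hi - ?lo\<bar> \<le> osc_const * q ^ m * D"
    using hvals_osc[OF assms(1) _ _ D] by auto
  ultimately show ?thesis
    using hext_word[OF _ assms(1)] assms(2,3) by simp
qed

text \<open>Points closer than \<open>c * \<rho> ^ m\<close> lie in intersecting cells of level
  \<open>m\<close>; going through a common point costs two oscillation bounds.\<close>

lemma hext_continuous: "continuous_on K (hext f)"
proof -
  obtain c where c: "c > 0" "\<And>m w v x y. w \<in> W m \<Longrightarrow> v \<in> W m \<Longrightarrow> x \<in> K \<Longrightarrow> y \<in> K \<Longrightarrow>
      dist (FW w x) (FW v y) < c * \<rho> ^ m \<Longrightarrow> FW w ` K \<inter> FW v ` K \<noteq> {}"
    using disjoint_cells_apart by metis
  obtain D where D: "D \<ge> 0" "osc_le f D"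
    using osc_bound_exists[of f] by blast
  show ?thesis
    unfolding continuous_on_iff
  proof (intro ballI allI impI)
    fix x and e :: real assume "x \<in> K" "e > 0"
    have "eventually (\<lambda>m. (2 * osc_const * D) * q ^ m < e) sequentially"
      using q_power_tendsto_0 \<open>e > 0\<close> by (rule order_tendstoD(2))
    then obtain m where m: "(2 * osc_const * D) * q ^ m < e"
      by (rule eventually_happens'[OF sequentially_bot, rotated, THEN exE])
    have "dist (hext f y) (hext f x) < e" if "y \<in> K" "dist y x < c * \<rho> ^ m" for y
    proof -
      obtain w x' where x': "w \<in> W m" "x' \<in> K" "x = FW w x'"
        using K_cell[OF \<open>x \<in> K\<close>] by blast
      obtain v y' where y': "v \<in> W m" "y' \<in> K" "y = FW v y'"
        using K_cell[OF \<open>y \<in> K\<close>] by blast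
      have "dist (FW w x') (FW v y') < c * \<rho> ^ m"
        using that(2) x'(3) y'(3) by (simp add: dist_commute)
      then obtain z1 z2 where z: "z1 \<in> K" "z2 \<in> K" "FW w z1 = FW v z2"
        using c(2)[OF x'(1) y'(1) x'(2) y'(2)] by blast
      have "\<bar>hext f x - hext f (FW w z1)\<bar> \<le> osc_const * q ^ m * D"
        using hext_osc[OF x'(1,2) z(1) D(2)] x'(3) by blast
      moreover have "\<bar>hext f y - hext f (FW v z2)\<bar> \<le> osc_const * q ^ m * D"
        using hext_osc[OF y'(1,2) z(2) D(2)] y'(3) by blast
      ultimately have "\<bar>hext f y - hext f x\<bar> \<le> 2 * osc_const * D * q ^ m"
        using z(3) by (simp add: algebra_simps)
      then show ?thesis
        using m by (simp add: dist_real_def)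
    qed
    then show "\<exists>d>0. \<forall>x'\<in>K. dist x' x < d \<longrightarrow> dist (hext f x') (hext f x) < e"
      using c(1) rho_pos by (intro exI[of _ "c * \<rho> ^ m"]) auto
  qed
qed

text \<open>Since the value is that of level 0 for every \<open>m\<close>, the extension has finite
  energy and is orthogonal to every function vanishing on \<open>V\<close>, which is harmonicity in
  weak form.\<close>

lemma EL_hext: "EL m (hext f) g = E0 f g"
proof -
  have "EL m (hext f) g = inverse q ^ m * (\<Sum>w\<in>W m. E0 (hvals f w) (g \<circ> FW w))"
    unfolding EL_eq by (intro arg_cong2[of _ _ _ _ "(*)"] sum.cong E0_cong) (auto simp: hext_vertex)
  then show ?thesis
    by (simp only: hvals_energy)
qed

section \<open>The limiting energy on K\<close>

abbreviation EN :: "('a \<Rightarrow> real) \<Rightarrow> ereal" where "EN \<equiv> energy M \<rho> a K H r"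

lemma EN_LIMSEQ: "(\<lambda>m. ereal (EL m f f)) \<longlonglongrightarrow> EN f"
proof -
  have "incseq (\<lambda>m. ereal (EL m f f))"
    using EL_incseq by (auto simp: incseq_def)
  then have "(\<lambda>m. ereal (EL m f f)) \<longlonglongrightarrow> (SUP m. ereal (EL m f f))"
    by (rule LIMSEQ_SUP)
  then show ?thesis
    unfolding energy_def by (simp add: limI)
qed

lemma EL_le_EN: "ereal (EL m f f) \<le> EN f"
proof (rule incseq_le[OF _ EN_LIMSEQ])
  show "incseq (\<lambda>m. ereal (EL m f f))"
    using EL_incseq by (auto simp: incseq_def)
qed

lemma EN_nonneg: "0 \<le> EN f"
  using EL_le_EN[of 0 f] E0_nonneg[of f] by (metis EL_0 ereal_less_eq(5) order_trans)

lemma EN_finite_LIMSEQ: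
  assumes "EN f < \<infinity>"
  shows "(\<lambda>m. EL m f f) \<longlonglongrightarrow> real_of_ereal (EN f)"
proof -
  have "\<bar>EN f\<bar> \<noteq> \<infinity>"
    using assms EN_nonneg[of f] by auto
  then have "ereal (real_of_ereal (EN f)) = EN f"
    by (rule ereal_real')
  then show ?thesis
    using EN_LIMSEQ[of f] by (metis lim_ereal)
qed

lemma EN_finite_parallelogram:
  assumes "EN f < \<infinity>" "EN g < \<infinity>"
  shows "EN (\<lambda>x. f x + g x) < \<infinity>" "EN (\<lambda>x. f x - g x) < \<infinity>"
proof -
  have le: "EL m f f \<le> real_of_ereal (EN f)" "EL m g g \<le> real_of_ereal (EN g)" for m
    using incseq_le[OF EL_incseq EN_finite_LIMSEQ] assms by blast+
  have par: "EL m (\<lambda>x. f x + g x) (\<lambda>x. f x + g x) + EL m (\<lambda>x. f x - g x) (\<lambda>x. f x - g x)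
      = 2 * EL m f f + 2 * EL m g g" for m
    by (simp add: EL_add_left EL_add_right EL_diff_left EL_diff_right)
  let ?B = "2 * real_of_ereal (EN f) + 2 * real_of_ereal (EN g)"
  have "EL m (\<lambda>x. f x + g x) (\<lambda>x. f x + g x) \<le> ?B" "EL m (\<lambda>x. f x - g x) (\<lambda>x. f x - g x) \<le> ?B" for m
    using par[of m] le[of m] EL_nonneg[of m "\<lambda>x. f x + g x"] EL_nonneg[of m "\<lambda>x. f x - g x"]
    by linarith+
  then have "EN (\<lambda>x. f x + g x) \<le> ereal ?B" "EN (\<lambda>x. f x - g x) \<le> ereal ?B"
    by (intro LIMSEQ_le_const2[OF EN_LIMSEQ]; auto)+
  then show "EN (\<lambda>x. f x + g x) < \<infinity>" "EN (\<lambda>x. f x - g x) < \<infinity>"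
    by (auto intro: le_less_trans)
qed

text \<open>The level energies are bounded by the limit, so all vanish and \<open>f\<close> is
  constant on the vertices of each cell; \<open>V_connected_words\<close> joins the cells of one
  level. The constant is the same at all levels because \<open>p0\<close> is a vertex of every
  level, and vertices approximate each point of K.\<close>

lemma EN_zero_imp_const:
  assumes "continuous_on K f" "EN f = 0" "x \<in> K" "y \<in> K"
  shows "f x = f y"
proof -
  obtain p0 where p0: "p0 \<in> V"
    using V_nonempty by blast
  have vertex: "f (FW w p) = f p0" if "w \<in> W m" "p \<in> V" for w m p
  proof -
    have "EL m f f = 0"
      using EL_le_EN[of m f] assms(2) EL_nonneg[of m f] by simp
    then have "(\<Sum>w\<in>W m. E0 (f \<circ> FW w) (f \<circ> FW w)) = 0"
      unfolding EL_eq using q_pos by simp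
    then have zero: "E0 (f \<circ> FW w) (f \<circ> FW w) = 0" if "w \<in> W m" for w
      using that E0_nonneg by (subst (asm) sum_nonneg_eq_0_iff) auto
    have const: "f (FW w p) = f (FW w p')" if "w \<in> W m" "p \<in> V" "p' \<in> V" for w p p'
      using E0_zero_imp_const[OF zero[OF that(1)] that(2,3)] by simp
    obtain s p' where s: "s \<in> W m" "p' \<in> V" "p0 = FW s p'"
      using V_refine_words[OF p0] by blast
    then show ?thesis
      using V_connected_words[where g = f, OF const that(1) s(1) that(2) s(2)] by simp
  qed
  have "f x = f p0" if "x \<in> K" for x
  proof -
    define w where "w m = cell_word m x" for m
    have w: "w m \<in> W m" "x \<in> FW (w m) ` K" for m
      unfolding w_def using cell_word[OF that] by blast+
    have "(\<lambda>m. FW (w m) p0) \<longlonglongrightarrow> x"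
    proof (rule metric_tendsto_imp_tendsto[OF LIMSEQ_power_zero[of \<rho>]])
      show "norm \<rho> < 1"
        using rho_pos rho_less_1 by simp
      have "p0 \<in> K"
        using p0 V_subset_K by blast
      then show "\<forall>\<^sub>F m in sequentially. dist (FW (w m) p0) x \<le> dist (\<rho> ^ m) 0"
        using dist_cell_le[OF w(1) imageI w(2)] rho_pos by (intro always_eventually) simp
    qed
    moreover have "FW (w m) p0 \<in> K" for m
      using FW_in_K[OF w(1)] p0 V_subset_K by blast
    ultimately have "(\<lambda>m. f (FW (w m) p0)) \<longlonglongrightarrow> f x"
      using assms(1) that by (auto simp: continuous_on_sequentially comp_def)
    moreover have "f (FW (w m) p0) = f p0" for m
      using vertex[OF w(1) p0] .
    ultimately show ?thesis
      by (simp add: LIMSEQ_const_iff)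
  qed
  then show ?thesis
    using assms(3,4) by simp
qed

end

section \<open>Hausdorff measure of cells\<close>

lemma diameter_translation: "diameter ((+) t ` S) = diameter (S :: 'a::real_normed_vector set)"
proof -
  have "(+) t ` S \<times> (+) t ` S = (\<lambda>(x, y). (t + x, t + y)) ` (S \<times> S)"
    by auto
  then show ?thesis
    unfolding diameter_def by (simp add: image_comp comp_def case_prod_unfold)
qed

lemma hausdorff_content_translation_le:
  fixes A :: "'a::real_normed_vector set"
  shows "hausdorff_content s \<delta> ((+) t ` A) \<le> hausdorff_content s \<delta> A"
  unfolding hausdorff_content_def
proof (rule INF_greatest)
  fix U :: "nat \<Rightarrow> 'a set"
  assume "U \<in> {U. A \<subseteq> (\<Union>i. U i) \<and> (\<forall>i. bounded (U i) \<and> diameter (U i) \<le> \<delta>)}"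
  then have "(\<lambda>i. (+) t ` U i) \<in> {U. (+) t ` A \<subseteq> (\<Union>i. U i) \<and> (\<forall>i. bounded (U i) \<and> diameter (U i) \<le> \<delta>)}"
    by (auto simp: diameter_translation intro: bounded_translation) blast
  then show "(INF U\<in>{U. (+) t ` A \<subseteq> (\<Union>i. U i) \<and> (\<forall>i. bounded (U i) \<and> diameter (U i) \<le> \<delta>)}.
      \<Sum>i. ennreal (diameter (U i) powr s)) \<le> (\<Sum>i. ennreal (diameter (U i) powr s))"
    by (rule INF_lower2) (simp add: diameter_translation)
qed

lemma hausdorff_outer_measure_translation:
  fixes A :: "'a::real_normed_vector set"
  shows "hausdorff_outer_measure s ((+) t ` A) = hausdorff_outer_measure s A"
proof -
  have le: "hausdorff_outer_measure s ((+) t ` A) \<le> hausdorff_outer_measure s A" for t and A :: "'a set"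
    unfolding hausdorff_outer_measure_def by (intro SUP_mono' hausdorff_content_translation_le)
  have "(+) (- t) ` (+) t ` A = A"
    by (simp add: image_comp comp_def)
  then show ?thesis
    using le[of t A] le[of "- t" "(+) t ` A"] by simp
qed

lemma sets_hausdorff_measure [simp, measurable_cong]: "sets (hausdorff_measure s) = sets borel"
  unfolding hausdorff_measure_def by (metis sets.sigma_sets_eq sets_measure_of_conv space_borel subset_UNIV Pow_UNIV)

lemma space_hausdorff_measure [simp]: "space (hausdorff_measure s) = UNIV"
  unfolding hausdorff_measure_def by (simp add: space_measure_of_conv)

text \<open>
  With this case distinction it is not necessary to know that the outer measure is countably additive
  on the Borel sets: otherwise \<^const>\<open>hausdorff_measure\<close> would be the zero measure.
\<close>

lemma emeasure_hausdorff_measure: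
  fixes A :: "'a::metric_space set"
  shows "emeasure (hausdorff_measure s) A =
     (if A \<in> sets borel \<and> measure_space UNIV (sets (borel :: 'a measure)) (hausdorff_outer_measure s)
      then hausdorff_outer_measure s A else 0)"
  unfolding hausdorff_measure_def emeasure_measure_of_conv
  using sets.sigma_sets_eq[of "borel :: 'a measure"] by simp

lemma emeasure_hausdorff_measure_le:
  "emeasure (hausdorff_measure s) A \<le> hausdorff_outer_measure s A"
  unfolding emeasure_hausdorff_measure by simp

lemma emeasure_hausdorff_measure_translation:
  fixes A :: "'a::euclidean_space set"
  assumes "closed A"
  shows "emeasure (hausdorff_measure s) ((+) t ` A) = emeasure (hausdorff_measure s) A"
  using assms closed_translation[OF assms, of t]
  unfolding emeasure_hausdorff_measure hausdorff_outer_measure_translation by simp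

locale pcf_blowup = pcf_harmonic M \<rho> a K H r q
  for M :: nat and \<rho> :: real and a :: "nat \<Rightarrow> 'a::euclidean_space" and K :: "'a set"
    and H :: "'a \<Rightarrow> 'a \<Rightarrow> real" and r :: "nat \<Rightarrow> real" and q :: real +
  fixes \<alpha> \<beta> :: real and i0 :: nat
  assumes q_eq: "q = \<rho> powr (\<beta> - \<alpha>)"
    and alpha_eq: "\<alpha> = - ln (real M) / ln \<rho>"
    and i0: "i0 \<in> {1..M}" and a_i0: "a i0 = 0"
begin

abbreviation BL :: "enat \<Rightarrow> 'a set" where "BL \<equiv> blowup \<rho> K"
abbreviation \<nu> :: "'a measure" where "\<nu> \<equiv> hausdorff_measure \<alpha>"

text \<open>A cell of K_k, of diameter \<open>\<rho> ^ length w / \<rho> ^ k\<close>. The same map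
  has several names: by \<open>cell_replicate\<close>, raising \<open>k\<close> by \<open>j\<close>
  is compensated by prepending \<open>j\<close> letters \<open>i0\<close>, and this is how K_k sits
  inside K_(k+j).\<close>

definition cell :: "nat \<Rightarrow> nat list \<Rightarrow> 'a \<Rightarrow> 'a" where
  "cell k w x = inverse (\<rho> ^ k) *\<^sub>R FW w x"

lemma rho_ne_0 [simp]: "\<rho> \<noteq> 0"
  using rho_pos by simp

lemma FW_replicate: "FW (replicate j i0) x = \<rho> ^ j *\<^sub>R x"
  by (induction j) (auto simp: ifs_map_def a_i0)

lemma replicate_in_W: "replicate j i0 \<in> W j"
  using i0 by (auto simp: words_def)

lemma cell_replicate: "cell (k + j) (replicate j i0 @ w) = cell k w"
  by (simp add: fun_eq_iff cell_def word_map_append FW_replicate power_add)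

lemma cell_append: "cell k (w @ s) x = cell k w (FW s x)"
  by (simp add: cell_def word_map_append)

lemma rescale_word: "rescale \<rho> k u (FW w x) = u (cell k w x)"
  by (simp add: rescale_def cell_def)

lemma BL_enat: "BL (enat k) = cell k [] ` K"
  by (simp add: blowup_def cell_def)

lemma BL_inf: "BL \<infinity> = (\<Union>k. BL (enat k))"
  by (simp add: blowup_def)

lemma BL_eq_cells: "BL (enat k) = (\<Union>w\<in>W m. cell k w ` K)"
proof -
  have "cell k [] ` K = cell k [] ` (\<Union>w\<in>W m. FW w ` K)"
    by (rule arg_cong) (rule K_eq_words)
  also have "\<dots> = (\<Union>w\<in>W m. cell k w ` K)"
    by (simp add: image_UN image_comp comp_def cell_def)
  finally show ?thesis
    by (simp add: BL_enat)
qed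

lemma BL_cell:
  assumes "x \<in> BL (enat k)"
  obtains w y where "w \<in> W m" "y \<in> K" "x = cell k w y"
  using assms unfolding BL_eq_cells[of k m] by blast

lemma cell_in_BL: "w \<in> W m \<Longrightarrow> x \<in> K \<Longrightarrow> cell k w x \<in> BL (enat k)"
  unfolding BL_eq_cells[of k m] by blast

lemma BL_mono: "k \<le> l \<Longrightarrow> BL (enat k) \<subseteq> BL (enat l)"
proof -
  assume "k \<le> l"
  then obtain j where l: "l = k + j"
    using le_Suc_ex by blast
  have "cell k [] ` K = cell l (replicate j i0) ` K"
    using cell_replicate[of k j "[]"] by (simp add: l)
  then show ?thesis
    unfolding BL_enat[of k] BL_eq_cells[of l j] using replicate_in_W by blast
qed

lemma BL_subset: "BL (enat k) \<subseteq> BL \<infinity>"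
  unfolding BL_inf by blast

lemma continuous_on_cell [continuous_intros]: "continuous_on S (cell k w)"
  unfolding cell_def by (intro continuous_intros)

lemma compact_cell_image: "compact (cell k w ` K)"
  by (intro compact_continuous_image continuous_intros compact_K)

lemma closed_cell_image: "closed (cell k w ` K)"
  using compact_cell_image by (rule compact_imp_closed)

lemma compact_BL: "compact (BL (enat k))"
  unfolding BL_enat by (rule compact_cell_image)

lemma closed_BL: "closed (BL (enat k))"
  using compact_BL by (rule compact_imp_closed)

lemma BL_borel: "BL n \<in> sets borel"
proof (cases n)
  case (enat k)
  then show ?thesis
    using closed_BL by auto
next
  case infinity
  have "(\<Union>k. BL (enat k)) \<in> sets borel"
    using closed_BL by (intro sets.countable_UN) auto
  then show ?thesis
    by (simp add: infinity BL_inf)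
qed

lemma cell_inj [simp]: "cell k w x = cell k w y \<longleftrightarrow> x = y"
  by (simp add: cell_def)

lemma cell_affine: "cell k w x = (\<rho> ^ length w / \<rho> ^ k) *\<^sub>R x + cell k w 0"
  unfolding cell_def by (subst word_map_affine) (simp add: scaleR_add_right divide_inverse mult.commute)

lemma dist_cell: "dist (cell k w x) (cell k v y) = dist (FW w x) (FW v y) / \<rho> ^ k"
  using rho_pos by (simp add: cell_def dist_norm divide_inverse mult.commute flip: scaleR_diff_right)

lemma cell_translate:
  assumes "length w = length v"
  shows "cell k w ` K = (+) (cell k w 0 - cell k v 0) ` cell k v ` K"
proof -
  have eq: "cell k w x = (cell k w 0 - cell k v 0) + cell k v x" for x
  proof -
    have "cell k w x - cell k w 0 = cell k v x - cell k v 0"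
      using cell_affine[of k w x] cell_affine[of k v x] assms by (metis add_diff_cancel_right')
    then show ?thesis
      by (simp add: algebra_simps)
  qed
  show ?thesis
    unfolding image_comp comp_def by (rule image_cong[OF refl eq])
qed

section \<open>Measures of cells\<close>

lemma emeasure_cell_cong:
  "length w = length v \<Longrightarrow> emeasure \<nu> (cell k w ` K) = emeasure \<nu> (cell k v ` K)"
  by (metis cell_translate closed_cell_image emeasure_hausdorff_measure_translation)

lemma emeasure_cell_unit:
  assumes "w \<in> W k"
  shows "emeasure \<nu> (cell k w ` K) = emeasure \<nu> K"
proof -
  have eq: "cell k w x = cell k w 0 + x" for x
    using cell_affine[of k w x] length_words[OF assms] by (metis add.commute divide_self_if power_not_zero rho_ne_0 scaleR_one)
  have "cell k w ` K = (+) (cell k w 0) ` K"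
    by (rule image_cong[OF refl eq])
  then show ?thesis
    using closed_K by (simp add: emeasure_hausdorff_measure_translation)
qed

lemma M_rho_alpha: "real M * \<rho> powr \<alpha> = 1" and alpha_pos: "\<alpha> > 0"
proof -
  have "ln \<rho> < 0" "ln (real M) > 0"
    using rho_pos rho_less_1 M_ge_2 by auto
  then show "\<alpha> > 0"
    unfolding alpha_eq by (simp add: divide_pos_neg)
  have "\<rho> powr \<alpha> = exp (- ln (real M))"
    using rho_pos \<open>ln \<rho> < 0\<close> by (simp add: powr_def alpha_eq)
  also have "\<dots> = inverse (real M)"
    using M_ge_2 by (simp add: exp_minus)
  finally show "real M * \<rho> powr \<alpha> = 1"
    using M_ge_2 by simp
qed

text \<open>The cells of level \<open>m\<close> are a cover by \<open>M ^ m\<close> sets of diameter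
  at most \<open>\<rho> ^ m\<close>, and \<open>M * \<rho> powr \<alpha> = 1\<close> keeps the sum
  at most 1 for every \<open>m\<close>.\<close>

lemma hausdorff_content_K:
  assumes "\<delta> > 0"
  shows "hausdorff_content \<alpha> \<delta> K \<le> 1"
proof -
  obtain m where m: "\<rho> ^ m < \<delta>"
    using rho_power_less assms by blast
  obtain e where e: "bij_betw e {0..<M ^ m} (W m)"
    using ex_bij_betw_nat_finite[OF finite_words[of M m]] unfolding card_words by blast
  \<comment> \<open>A cover has to be a sequence. Padding with empty sets is free, since they have
    diameter 0 and \<open>0 powr \<alpha> = 0\<close>.\<close>
  define U where "U i = (if i < M ^ m then FW (e i) ` K else {})" for i
  have e_W: "e i \<in> W m" if "i < M ^ m" for i
    using bij_betwE[OF e] that by simp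
  have diam: "diameter (FW w ` K) \<le> \<rho> ^ m" if "w \<in> W m" for w
    using dist_cell_le[OF that] rho_pos by (intro diameter_le) (auto simp: dist_norm)
  have "K \<subseteq> (\<Union>i. U i)"
  proof
    fix x assume "x \<in> K"
    then obtain w y where "w \<in> W m" "y \<in> K" "x = FW w y"
      by (rule K_cell)
    moreover from this obtain i where "i < M ^ m" "w = e i"
      using bij_betw_imp_surj_on[OF e] by (metis atLeastLessThan_iff image_iff)
    ultimately have "x \<in> U i"
      by (simp add: U_def)
    then show "x \<in> (\<Union>i. U i)"
      by blast
  qed
  moreover have "bounded (U i) \<and> diameter (U i) \<le> \<delta>" for i
    unfolding U_def using diam[OF e_W, of i] m \<open>\<delta> > 0\<close> compact_cell[THEN compact_imp_bounded] by auto
  ultimately have "hausdorff_content \<alpha> \<delta> K \<le> (\<Sum>i. ennreal (diameter (U i) powr \<alpha>))"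
    unfolding hausdorff_content_def by (intro INF_lower) auto
  also have "\<dots> = (\<Sum>i<M ^ m. ennreal (diameter (U i) powr \<alpha>))"
    by (rule suminf_finite) (auto simp: U_def)
  also have "\<dots> \<le> (\<Sum>i<M ^ m. ennreal ((\<rho> ^ m) powr \<alpha>))"
    using diam[OF e_W] alpha_pos compact_cell[THEN compact_imp_bounded]
    by (intro sum_mono ennreal_leI powr_mono2) (auto simp: U_def diameter_ge_0)
  also have "\<dots> = ennreal (real (M ^ m) * (\<rho> ^ m) powr \<alpha>)"
    by (simp add: ennreal_mult'' ennreal_of_nat_eq_real_of_nat)
  also have "real (M ^ m) * (\<rho> ^ m) powr \<alpha> = (real M * \<rho> powr \<alpha>) ^ m"
    using rho_pos by (simp add: power_mult_distrib powr_power powr_realpow[symmetric] powr_powr mult.commute)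
  finally show ?thesis
    by (simp add: M_rho_alpha)
qed

lemma emeasure_K_finite: "emeasure \<nu> K < \<infinity>"
proof -
  have "hausdorff_outer_measure \<alpha> K \<le> 1"
    unfolding hausdorff_outer_measure_def by (intro SUP_least hausdorff_content_K) auto
  then have "emeasure \<nu> K \<le> 1"
    using emeasure_hausdorff_measure_le order_trans by blast
  then show ?thesis
    by (auto intro: le_less_trans)
qed

lemma emeasure_BL_le: "emeasure \<nu> (BL (enat k)) \<le> of_nat (M ^ k) * emeasure \<nu> K"
proof -
  have "emeasure \<nu> (BL (enat k)) \<le> (\<Sum>w\<in>W k. emeasure \<nu> (cell k w ` K))"
    unfolding BL_eq_cells[of k k] using closed_cell_image
    by (intro emeasure_subadditive_finite) auto
  also have "\<dots> = of_nat (M ^ k) * emeasure \<nu> K"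
    by (simp add: emeasure_cell_unit card_words)
  finally show ?thesis .
qed

lemma emeasure_BL_finite: "emeasure \<nu> (BL (enat k)) < \<infinity>"
  using emeasure_K_finite
  by (auto intro!: le_less_trans[OF emeasure_BL_le] simp: ennreal_mult_less_top of_nat_less_top
      simp del: of_nat_power)

lemma BL_null:
  assumes "emeasure \<nu> K = 0"
  shows "BL n \<in> null_sets (blowup_measure \<rho> K \<alpha> n)"
proof -
  have null: "BL (enat k) \<in> null_sets \<nu>" for k
    using emeasure_BL_le[of k] assms closed_BL[of k] by (intro null_setsI) auto
  have "BL n \<in> null_sets \<nu>"
    using null by (cases n) (auto simp: BL_inf intro!: null_sets_UN)
  then show ?thesis
    unfolding blowup_measure_def using BL_borel by (simp add: null_sets_restrict_space)
qed

text \<open>The cell of \<open>w\<close> is a union of \<open>M ^ j\<close> cells of the level of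
  \<open>v\<close>, all translates of one another, so subadditivity suffices. The result serves as a
  lower bound for the measure of small cells.\<close>

lemma measure_cell_le:
  assumes w: "w \<in> W m" and v: "v \<in> W (m + j)"
  shows "measure \<nu> (cell k w ` K) \<le> real (M ^ j) * measure \<nu> (cell k v ` K)"
proof -
  have fin: "emeasure \<nu> (cell k s ` K) \<noteq> \<infinity>" if "s \<in> W i" for s i
  proof -
    have "emeasure \<nu> (cell k s ` K) \<le> emeasure \<nu> (BL (enat k))"
      using cell_in_BL[OF that] closed_BL by (intro emeasure_mono) auto
    then show ?thesis
      using emeasure_BL_finite[of k] by auto
  qed
  have sub: "w @ s \<in> W (m + j)" if "s \<in> W j" for s
    using w that by (rule append_in_words)
  have "cell k w ` K = cell k w ` (\<Union>s\<in>W j. FW s ` K)"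
    by (rule arg_cong) (rule K_eq_words)
  also have "\<dots> = (\<Union>s\<in>W j. cell k (w @ s) ` K)"
    by (simp add: image_UN image_comp comp_def cell_append)
  finally have "measure \<nu> (cell k w ` K) = measure \<nu> (\<Union>s\<in>W j. cell k (w @ s) ` K)"
    by simp
  also have "\<dots> \<le> (\<Sum>s\<in>W j. measure \<nu> (cell k (w @ s) ` K))"
    using closed_cell_image fin[OF sub] by (intro measure_subadditive_finite) auto
  also have "\<dots> = (\<Sum>s\<in>W j. measure \<nu> (cell k v ` K))"
  proof (rule sum.cong[OF refl])
    fix s assume "s \<in> W j"
    then have "length (w @ s) = length v"
      using length_words[OF sub] length_words[OF v] by simp
    then show "measure \<nu> (cell k (w @ s) ` K) = measure \<nu> (cell k v ` K)"
      unfolding measure_def by (metis emeasure_cell_cong)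
  qed
  also have "\<dots> = real (M ^ j) * measure \<nu> (cell k v ` K)"
    by (simp add: card_words)
  finally show ?thesis .
qed

lemma measure_cell_pos:
  assumes "emeasure \<nu> K \<noteq> 0" "w \<in> W m"
  shows "measure \<nu> (cell k w ` K) > 0"
proof (rule ccontr)
  assume "\<not> ?thesis"
  then have zero: "measure \<nu> (cell k w ` K) = 0"
    using measure_nonneg[of \<nu> "cell k w ` K"] by linarith
  have "measure \<nu> (cell k [] ` K) \<le> real (M ^ m) * measure \<nu> (cell k w ` K)"
    using measure_cell_le[of "[]" 0 w m k] assms(2) by simp
  then have "measure \<nu> (BL (enat k)) = 0"
    using zero measure_nonneg[of \<nu> "cell k [] ` K"] by (simp add: BL_enat)
  then have "emeasure \<nu> (BL (enat k)) = 0"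
    using emeasure_BL_finite[of k] by (auto simp: measure_def enn2real_eq_0_iff)
  moreover have "emeasure \<nu> K \<le> emeasure \<nu> (BL (enat k))"
  proof (rule emeasure_mono)
    show "K \<subseteq> BL (enat k)"
      using BL_mono[of 0 k] by (simp add: BL_enat cell_def)
  qed (use closed_BL in auto)
  ultimately show False
    using assms(1) by simp
qed

section \<open>Test functions supported in a cell\<close>

text \<open>A function on K transplanted to a cell and extended by zero. If \<open>v\<close>
  vanishes on \<open>V\<close> the result is continuous on K_k, since different cells of one level
  meet only at images of points of \<open>V\<close>.\<close>

definition bump :: "nat \<Rightarrow> nat list \<Rightarrow> ('a \<Rightarrow> real) \<Rightarrow> 'a \<Rightarrow> real" where
  "bump k w v y = (if y \<in> cell k w ` K then v (the_inv_into K (cell k w) y) else 0)"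

lemma bump_replicate: "bump (k + j) (replicate j i0 @ w) v = bump k w v"
  unfolding bump_def cell_replicate ..

lemma inj_on_cell: "inj_on (cell k w) S"
  by (auto simp: inj_on_def)

lemma bump_on: "x \<in> K \<Longrightarrow> bump k w v (cell k w x) = v x"
  unfolding bump_def by (simp add: the_inv_into_f_f[OF inj_on_cell])

lemma bump_off:
  assumes "w \<in> W m" "w' \<in> W m" "w' \<noteq> w" "x \<in> K" and v: "\<And>p. p \<in> V \<Longrightarrow> v p = 0"
  shows "bump k w v (cell k w' x) = 0"
proof (cases "cell k w' x \<in> cell k w ` K")
  case True
  then obtain y where y: "y \<in> K" "cell k w' x = cell k w y"
    by blast
  then have "FW w y = FW w' x"
    by (simp add: cell_def)
  then have "y \<in> V"
    using overlap_in_V[OF assms(1,2)] assms(3,4) y(1) by metis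
  then show ?thesis
    using y v by (simp add: bump_on)
qed (simp add: bump_def)

lemma continuous_on_bump:
  assumes w: "w \<in> W m" and v: "\<And>p. p \<in> V \<Longrightarrow> v p = 0" and cont: "continuous_on K v"
  shows "continuous_on (BL (enat k)) (bump k w v)"
  unfolding BL_eq_cells[of k m]
proof (rule continuous_on_closed_Union)
  fix w' assume w': "w' \<in> W m"
  show "continuous_on (cell k w' ` K) (bump k w v)"
  proof (cases "w' = w")
    case True
    have "continuous_on (cell k w ` K) (the_inv_into K (cell k w))"
      by (intro continuous_on_inv_into continuous_on_cell compact_K inj_on_cell)
    moreover have "the_inv_into K (cell k w) ` (cell k w ` K) \<subseteq> K"
      using the_inv_into_into[OF inj_on_cell] by blast
    ultimately have "continuous_on (cell k w ` K) (\<lambda>y. v (the_inv_into K (cell k w) y))"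
      using cont by (rule continuous_on_compose2[rotated])
    then show ?thesis
      unfolding True by (rule continuous_on_eq) (simp add: bump_def)
  next
    case False
    show ?thesis
      by (rule continuous_on_eq[OF continuous_on_const[of _ 0]]) (use bump_off[OF w w' False] v in auto)
  qed
qed (auto simp: closed_cell_image)

text \<open>From level \<open>m\<close> on, the form splits into a sum over the cells of level
  \<open>m\<close>, and the transplanted function vanishes on all of them except
  \<open>w\<close>.\<close>

lemma EL_bump:
  assumes w: "w \<in> W m" and v: "\<And>p. p \<in> V \<Longrightarrow> v p = 0"
  shows "EL (m + j) f (rescale \<rho> k (bump k w v)) = inverse q ^ m * EL j (f \<circ> FW w) v"
proof -
  have "EL j (f \<circ> FW w') (rescale \<rho> k (bump k w v) \<circ> FW w') = (if w' = w then EL j (f \<circ> FW w) v else 0)"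
    if "w' \<in> W m" for w'
  proof (cases "w' = w")
    case True
    have "EL j (f \<circ> FW w) (rescale \<rho> k (bump k w v) \<circ> FW w) = EL j (f \<circ> FW w) v"
      by (rule EL_cong) (simp_all add: rescale_word bump_on)
    then show ?thesis
      using True by simp
  next
    case False
    have "EL j (f \<circ> FW w') (rescale \<rho> k (bump k w v) \<circ> FW w') = EL j (f \<circ> FW w') (\<lambda>x. 0 * v x)"
      by (rule EL_cong) (use bump_off[OF w that False _ v] in \<open>simp_all add: rescale_word\<close>)
    also have "\<dots> = 0"
      by (subst EL_scale_right) simp
    finally show ?thesis
      using False by simp
  qed
  then have "EL (m + j) f (rescale \<rho> k (bump k w v)) =
      inverse q ^ m * (\<Sum>w'\<in>W m. if w' = w then EL j (f \<circ> FW w) v else 0)"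
    unfolding EL_add by simp
  then show ?thesis
    using w by simp
qed

lemma EN_le_of_tail:
  assumes "\<And>j. EL (m + j) f f \<le> B"
  shows "EN f \<le> ereal B"
proof (rule LIMSEQ_le_const2[OF EN_LIMSEQ])
  show "\<exists>N. \<forall>n\<ge>N. ereal (EL n f f) \<le> ereal B"
    using assms by (intro exI[of _ m]) (auto simp: le_iff_add)
qed

lemma EL_le_real_EN: "EN f < \<infinity> \<Longrightarrow> EL m f f \<le> real_of_ereal (EN f)"
  using incseq_le[OF EL_incseq EN_finite_LIMSEQ] by blast

lemma EN_bump_le:
  assumes w: "w \<in> W m" and v: "\<And>p. p \<in> V \<Longrightarrow> v p = 0" and fin: "EN v < \<infinity>"
  shows "EN (rescale \<rho> k (bump k w v)) \<le> ereal (inverse q ^ m * real_of_ereal (EN v))"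
proof (rule EN_le_of_tail[where m = m])
  fix j
  have "EL j (rescale \<rho> k (bump k w v) \<circ> FW w) v = EL j v v"
    by (rule EL_cong) (simp_all add: rescale_word bump_on)
  then have "EL (m + j) (rescale \<rho> k (bump k w v)) (rescale \<rho> k (bump k w v)) = inverse q ^ m * EL j v v"
    using EL_bump[OF w, of v] v by simp
  also have "\<dots> \<le> inverse q ^ m * real_of_ereal (EN v)"
    using EL_le_real_EN[OF fin] q_pos by (intro mult_left_mono) auto
  finally show "EL (m + j) (rescale \<rho> k (bump k w v)) (rescale \<rho> k (bump k w v)) \<le> inverse q ^ m * real_of_ereal (EN v)" .
qed

lemma EN_bump_finite:
  assumes "w \<in> W m" "\<And>p. p \<in> V \<Longrightarrow> v p = 0" "EN v < \<infinity>"
  shows "EN (rescale \<rho> k (bump k w v)) < \<infinity>"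
proof -
  have "EN (rescale \<rho> k (bump k w v)) \<le> ereal (inverse q ^ m * real_of_ereal (EN v))"
    using assms by (rule EN_bump_le)
  then show ?thesis
    by auto
qed

text \<open>The forms on K_n are defined by polarizing the limit energy. This identifies the
  polarized expression with the limit of the bilinear level forms, where \<open>EL_bump\<close>
  computes the pairing.\<close>

lemma EL_LIMSEQ_polarization:
  assumes "EN f < \<infinity>" "EN g < \<infinity>"
  shows "(\<lambda>m. EL m f g) \<longlonglongrightarrow>
    (real_of_ereal (EN (\<lambda>x. f x + g x)) - real_of_ereal (EN (\<lambda>x. f x - g x))) / 4"
proof -
  have "EL m f g = (EL m (\<lambda>x. f x + g x) (\<lambda>x. f x + g x) - EL m (\<lambda>x. f x - g x) (\<lambda>x. f x - g x)) / 4" for m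
    by (simp add: EL_add_left EL_add_right EL_diff_left EL_diff_right EL_sym[of m g f])
  then show ?thesis
    by (simp only:) (intro tendsto_divide tendsto_diff EN_finite_LIMSEQ EN_finite_parallelogram assms tendsto_const; simp)
qed

lemma EN_cell_finite:
  assumes "EN f < \<infinity>" "w \<in> W m"
  shows "EN (f \<circ> FW w) < \<infinity>"
proof -
  have "EL (0 + j) (f \<circ> FW w) (f \<circ> FW w) \<le> q ^ m * real_of_ereal (EN f)" for j
  proof -
    have "EL j (f \<circ> FW w) (f \<circ> FW w) \<le> (\<Sum>w\<in>W m. EL j (f \<circ> FW w) (f \<circ> FW w))"
      using assms(2) EL_nonneg by (intro member_le_sum[of w "W m" "\<lambda>w. EL j (f \<circ> FW w) (f \<circ> FW w)"]) auto
    also have "\<dots> = q ^ m * EL (m + j) f f"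
      unfolding EL_add using q_pos by (simp add: field_simps)
    also have "\<dots> \<le> q ^ m * real_of_ereal (EN f)"
      using EL_le_real_EN[OF assms(1)] q_pos by (intro mult_left_mono) auto
    finally show ?thesis
      by simp
  qed
  then have "EN (f \<circ> FW w) \<le> ereal (q ^ m * real_of_ereal (EN f))"
    by (rule EN_le_of_tail)
  then show ?thesis
    by (auto intro: le_less_trans)
qed

lemma EN_hext_finite: "EN (hext f) < \<infinity>"
proof -
  have "EN (hext f) \<le> ereal (E0 f (hext f))"
    by (rule EN_le_of_tail[where m = 0]) (simp add: EL_hext)
  then show ?thesis
    by (auto intro: le_less_trans)
qed

text \<open>
  The remainder of \<open>g\<close> after subtracting its harmonic extension is an admissible test function on
  the cell, and pairing \<open>g\<close> with it gives the full energy of the remainder.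
\<close>

definition remainder :: "('a \<Rightarrow> real) \<Rightarrow> 'a \<Rightarrow> real" where
  "remainder g x = g x - hext g x"

lemma remainder_V: "p \<in> V \<Longrightarrow> remainder g p = 0"
  by (simp add: remainder_def hext_V)

lemma continuous_on_remainder: "continuous_on K g \<Longrightarrow> continuous_on K (remainder g)"
  unfolding remainder_def by (intro continuous_intros hext_continuous)

lemma EN_remainder_finite: "EN g < \<infinity> \<Longrightarrow> EN (remainder g) < \<infinity>"
  unfolding remainder_def using EN_finite_parallelogram(2)[OF _ EN_hext_finite] .

lemma EL_remainder: "EL j g (remainder g) = EL j (remainder g) (remainder g)"
proof -
  have "remainder g = (\<lambda>x. g x - hext g x)"
    by (simp add: remainder_def fun_eq_iff)
  then have "EL j (remainder g) (remainder g) = EL j g (remainder g) - EL j (hext g) (remainder g)"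
    by (metis EL_diff_left)
  moreover have "EL j (hext g) (remainder g) = 0"
    unfolding EL_hext energy0_def
  proof -
    have "(\<Sum>y\<in>V. H x y * remainder g y) = 0" for x
      by (intro sum.neutral) (simp add: remainder_V)
    then show "- (\<Sum>x\<in>V. g x * (\<Sum>y\<in>V. H x y * remainder g y)) = 0"
      by simp
  qed
  ultimately show ?thesis
    by simp
qed

text \<open>The left-hand side is the form on K_k without its scaling factor. Past level
  \<open>m\<close>, the level forms reduce by \<open>EL_bump\<close> and \<open>EL_remainder\<close>
  to those of the remainder on K, and the limit is taken along the levels
  \<open>j + m\<close>.\<close>

lemma remainder_pairing:
  assumes f: "EN f < \<infinity>" and w: "w \<in> W m" and g: "g = f \<circ> FW w"
    and b: "b = rescale \<rho> k (bump k w (remainder g))"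
  shows "(real_of_ereal (EN (\<lambda>x. f x + b x)) - real_of_ereal (EN (\<lambda>x. f x - b x))) / 4
    = inverse q ^ m * real_of_ereal (EN (remainder g))"
proof -
  have fin: "EN (remainder g) < \<infinity>"
    unfolding g by (intro EN_remainder_finite EN_cell_finite[OF f w])
  then have "EN b < \<infinity>"
    unfolding b by (intro EN_bump_finite[OF w] remainder_V fin)
  then have "(\<lambda>j. EL j f b) \<longlonglongrightarrow>
      (real_of_ereal (EN (\<lambda>x. f x + b x)) - real_of_ereal (EN (\<lambda>x. f x - b x))) / 4" (is "_ \<longlonglongrightarrow> ?L")
    using f by (intro EL_LIMSEQ_polarization)
  then have "(\<lambda>j. EL (j + m) f b) \<longlonglongrightarrow> ?L"
    by (rule LIMSEQ_ignore_initial_segment)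
  moreover have "EL (j + m) f b = inverse q ^ m * EL j (remainder g) (remainder g)" for j
    using EL_bump[where j = j and f = f and k = k and v = "remainder g", OF w remainder_V] EL_remainder[of j g]
    by (simp add: b g add.commute)
  then have "(\<lambda>j. EL (j + m) f b) \<longlonglongrightarrow> inverse q ^ m * real_of_ereal (EN (remainder g))"
    by (simp only:) (intro tendsto_mult tendsto_const EN_finite_LIMSEQ fin)
  ultimately show ?thesis
    by (rule LIMSEQ_unique)
qed

lemma remainder_zero:
  assumes "continuous_on K g" "EN g < \<infinity>" "real_of_ereal (EN (remainder g)) = 0" "x \<in> K"
  shows "g x = hext g x"
proof -
  have "EN (remainder g) = 0"
    using assms(3) EN_remainder_finite[OF assms(2)] EN_nonneg[of "remainder g"]
    by (cases "EN (remainder g)") auto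
  then have "remainder g x = remainder g vertex0"
    using EN_zero_imp_const[OF continuous_on_remainder[OF assms(1)]] assms(4) vertex0 V_subset_K by blast
  then show ?thesis
    using remainder_V[OF vertex0] by (simp add: remainder_def)
qed

section \<open>Harmonic functions on cells of K_n\<close>

abbreviation energy_at :: "enat \<Rightarrow> ('a \<Rightarrow> real) \<Rightarrow> ereal" where
  "energy_at \<equiv> blowup_energy M \<rho> a K H r \<alpha> \<beta>"
abbreviation domain_at :: "enat \<Rightarrow> ('a \<Rightarrow> real) set" where
  "domain_at \<equiv> blowup_domain M \<rho> a K H r \<alpha> \<beta>"
abbreviation form_at :: "enat \<Rightarrow> ('a \<Rightarrow> real) \<Rightarrow> ('a \<Rightarrow> real) \<Rightarrow> real" where
  "form_at \<equiv> blowup_form M \<rho> a K H r \<alpha> \<beta>"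
abbreviation harmonic_at :: "enat \<Rightarrow> ('a \<Rightarrow> real) \<Rightarrow> 'a set \<Rightarrow> bool" where
  "harmonic_at \<equiv> harmonic_in M \<rho> a K H r \<alpha> \<beta>"

lemma rescale_add: "rescale \<rho> k (\<lambda>x. u x + v x) = (\<lambda>x. rescale \<rho> k u x + rescale \<rho> k v x)"
  and rescale_diff: "rescale \<rho> k (\<lambda>x. u x - v x) = (\<lambda>x. rescale \<rho> k u x - rescale \<rho> k v x)"
  by (simp_all add: fun_eq_iff rescale_def)

lemma q_power: "\<rho> powr (real k * (\<beta> - \<alpha>)) = q ^ k"
  using rho_pos by (simp add: q_eq powr_powr mult.commute flip: powr_realpow)

lemma energy_fin: "energy_at (enat k) u = ereal (q ^ k) * EN (rescale \<rho> k u)"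
  by (simp add: blowup_energy_def blowup_energy_fin_def q_power)

lemma domain_fin: "u \<in> domain_at (enat k) \<longleftrightarrow> continuous_on (BL (enat k)) u \<and> EN (rescale \<rho> k u) < \<infinity>"
proof -
  have "continuous_on K (rescale \<rho> k u)" if "continuous_on (BL (enat k)) u"
    using that unfolding rescale_def blowup_def
    by (auto intro!: continuous_on_compose2[of _ u K] continuous_intros)
  then show ?thesis
    unfolding blowup_domain_def energy_domain_def by auto
qed

lemma continuous_on_comp_cell:
  assumes "continuous_on (BL (enat k)) u" "w \<in> W m"
  shows "continuous_on K (u \<circ> cell k w)"
  using assms cell_in_BL by (intro continuous_on_compose continuous_on_cell) (auto intro: continuous_on_subset)

lemma BL_mono_enat: "enat k \<le> n \<Longrightarrow> BL (enat k) \<subseteq> BL n"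
  using BL_mono BL_subset by (cases n) auto

lemma support_in_cell:
  assumes "w \<in> W m" "enat k \<le> n"
  shows "compact (top_of_set (BL n) closure_of {x \<in> BL n. bump k w v x \<noteq> 0})"
    and "top_of_set (BL n) closure_of {x \<in> BL n. bump k w v x \<noteq> 0} \<subseteq> cell k w ` K"
proof -
  let ?S = "top_of_set (BL n) closure_of {x \<in> BL n. bump k w v x \<noteq> 0}"
  have sub: "cell k w ` K \<subseteq> BL n"
    using cell_in_BL[OF assms(1), of _ k] BL_mono_enat[OF assms(2)] by blast
  have "closedin (top_of_set (BL n)) (cell k w ` K)"
    using sub closed_cell_image by (rule closed_subset)
  then show "?S \<subseteq> cell k w ` K"
    by (intro closure_of_minimal) (auto simp: bump_def split: if_splits)
  then have "closedin (top_of_set (cell k w ` K)) ?S"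
    using sub by (intro closedin_subset_trans[OF closedin_closure_of])
  then show "compact ?S"
    by (rule closedin_compact[OF compact_cell_image])
qed

lemma harmonic_at_bump:
  assumes "harmonic_at n u U" "bump k w v \<in> domain_at n" "w \<in> W m" "enat k \<le> n" "cell k w ` K \<subseteq> U"
  shows "form_at n u (bump k w v) = 0"
  using assms(1,2) support_in_cell[OF assms(3,4), of v] assms(5)
  unfolding harmonic_in_def Let_def by blast

text \<open>Test with the transplanted remainder. Its support lies in the cell, hence in
  \<open>U\<close>, so the form vanishes; by \<open>remainder_pairing\<close> the form is also a
  positive multiple of the energy of the remainder.\<close>

lemma harmonic_on_cell_fin:
  assumes harm: "harmonic_at (enat k) u U" and w: "w \<in> W m" "cell k w ` K \<subseteq> U" and x: "x \<in> K"
  shows "u (cell k w x) = hext (u \<circ> cell k w) x"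
proof -
  have u: "continuous_on (BL (enat k)) u" "EN (rescale \<rho> k u) < \<infinity>"
    using harm unfolding harmonic_in_def domain_fin by auto
  define g where "g = u \<circ> cell k w"
  have g: "g = rescale \<rho> k u \<circ> FW w"
    by (simp add: g_def fun_eq_iff rescale_word)
  have g_cont: "continuous_on K g"
    unfolding g_def using u(1) w(1) by (rule continuous_on_comp_cell)
  have g_fin: "EN g < \<infinity>"
    unfolding g using u(2) w(1) by (rule EN_cell_finite)
  let ?\<phi> = "bump k w (remainder g)"
  have fin: "EN (remainder g) < \<infinity>"
    using g_fin by (rule EN_remainder_finite)
  have \<phi>_fin: "EN (rescale \<rho> k ?\<phi>) < \<infinity>"
    by (intro EN_bump_finite[OF w(1)] remainder_V fin)
  have "?\<phi> \<in> domain_at (enat k)"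
    unfolding domain_fin
    using continuous_on_bump[OF w(1) remainder_V continuous_on_remainder[OF g_cont]] \<phi>_fin by blast
  then have "form_at (enat k) u ?\<phi> = 0"
    using harmonic_at_bump[OF harm _ w(1) _ w(2)] by simp
  moreover have "form_at (enat k) u ?\<phi> = q ^ k * (inverse q ^ m * real_of_ereal (EN (remainder g)))"
    unfolding remainder_pairing[OF u(2) w(1) g refl, of k, symmetric]
    by (simp add: blowup_form_def energy_fin rescale_add rescale_diff right_diff_distrib)
  ultimately have "real_of_ereal (EN (remainder g)) = 0"
    using q_pos by simp
  then show ?thesis
    using remainder_zero[OF g_cont g_fin _ x] by (simp add: g_def)
qed

text \<open>K_k is the cell \<open>i0\<close> of K_(k+1), and its energy is one of the nonnegative
  summands in \<open>EL_Suc\<close>. Multiplied by \<open>q ^ k\<close> this is monotonicity in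
  \<open>k\<close>, by which the energy on K_\<infinity> is a genuine limit.\<close>

lemma EN_rescale_le: "EN (rescale \<rho> k u) \<le> ereal q * EN (rescale \<rho> (Suc k) u)"
proof (rule LIMSEQ_le_const2[OF EN_LIMSEQ], intro exI[of _ 0] allI impI)
  fix j
  let ?f = "rescale \<rho> (Suc k) u"
  have "?f \<circ> F i0 = rescale \<rho> k u"
  proof
    fix x
    have "inverse (\<rho> ^ Suc k) * \<rho> = inverse (\<rho> ^ k)"
      using rho_pos by (simp add: field_simps)
    then show "(?f \<circ> F i0) x = rescale \<rho> k u x"
      by (simp only: comp_apply rescale_def ifs_map_def a_i0 add_0_right scaleR_scaleR)
  qed
  then have "EL j (rescale \<rho> k u) (rescale \<rho> k u) \<le> (\<Sum>i\<in>{1..M}. EL j (?f \<circ> F i) (?f \<circ> F i))"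
    using i0 EL_nonneg by (metis member_le_sum[of i0 "{1..M}" "\<lambda>i. EL j (?f \<circ> F i) (?f \<circ> F i)"] finite_atLeastAtMost Diff_iff)
  also have "\<dots> = q * EL (Suc j) ?f ?f"
    unfolding EL_Suc using q_pos by simp
  finally have "ereal (EL j (rescale \<rho> k u) (rescale \<rho> k u)) \<le> ereal q * ereal (EL (Suc j) ?f ?f)"
    by simp
  also have "\<dots> \<le> ereal q * EN ?f"
    using q_pos EL_le_EN by (intro ereal_mult_left_mono) auto
  finally show "ereal (EL j (rescale \<rho> k u) (rescale \<rho> k u)) \<le> ereal q * EN ?f" .
qed

lemma energy_fin_incseq: "incseq (\<lambda>k. energy_at (enat k) u)"
proof (rule incseq_SucI)
  fix k
  have "ereal (q ^ k) * EN (rescale \<rho> k u) \<le> ereal (q ^ k) * (ereal q * EN (rescale \<rho> (Suc k) u))"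
    using q_pos EN_rescale_le by (intro ereal_mult_left_mono) auto
  then show "energy_at (enat k) u \<le> energy_at (enat (Suc k)) u"
    by (simp add: energy_fin mult.assoc[symmetric] mult.commute)
qed

lemma energy_inf_LIMSEQ: "(\<lambda>k. energy_at (enat k) u) \<longlonglongrightarrow> energy_at \<infinity> u"
proof -
  have "(\<lambda>k. energy_at (enat k) u) \<longlonglongrightarrow> (SUP k. energy_at (enat k) u)"
    using energy_fin_incseq by (rule LIMSEQ_SUP)
  moreover have "energy_at \<infinity> u = lim (\<lambda>k. energy_at (enat k) u)"
    by (simp add: blowup_energy_def)
  ultimately show ?thesis
    by (simp add: limI)
qed

lemma energy_nonneg: "0 \<le> energy_at (enat k) u"
  unfolding energy_fin using q_pos EN_nonneg by auto

lemma energy_fin_le_inf: "energy_at (enat k) u \<le> energy_at \<infinity> u"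
  using incseq_le[OF energy_fin_incseq energy_inf_LIMSEQ] .

lemma EN_finite_of_energy:
  assumes "energy_at \<infinity> u < \<infinity>"
  shows "EN (rescale \<rho> k u) < \<infinity>"
proof (rule ccontr)
  assume "\<not> EN (rescale \<rho> k u) < \<infinity>"
  then have "energy_at (enat k) u = \<infinity>"
    unfolding energy_fin using q_pos by simp
  then show False
    using energy_fin_le_inf[of k u] assms by simp
qed

lemma real_energy_fin: "real_of_ereal (energy_at (enat k) u) = q ^ k * real_of_ereal (EN (rescale \<rho> k u))"
  by (simp add: energy_fin)

lemma energy_inf_real_LIMSEQ:
  assumes "energy_at \<infinity> u < \<infinity>"
  shows "(\<lambda>k. q ^ k * real_of_ereal (EN (rescale \<rho> k u))) \<longlonglongrightarrow> real_of_ereal (energy_at \<infinity> u)"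
proof -
  have "0 \<le> energy_at \<infinity> u"
    using energy_nonneg energy_fin_le_inf order_trans by blast
  then have "\<bar>energy_at \<infinity> u\<bar> \<noteq> \<infinity>"
    using assms by auto
  then have "(\<lambda>k. real_of_ereal (energy_at (enat k) u)) \<longlonglongrightarrow> real_of_ereal (energy_at \<infinity> u)"
    using energy_inf_LIMSEQ by (intro lim_real_of_ereal) (simp add: ereal_real')
  then show ?thesis
    by (simp add: real_energy_fin)
qed

lemma energy_inf_leI:
  assumes "\<And>k. k \<ge> l \<Longrightarrow> EN (rescale \<rho> k u) < \<infinity>"
    "\<And>k. k \<ge> l \<Longrightarrow> q ^ k * real_of_ereal (EN (rescale \<rho> k u)) \<le> B"
  shows "energy_at \<infinity> u < \<infinity>"
proof -
  have "energy_at \<infinity> u \<le> ereal B"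
  proof (rule LIMSEQ_le_const2[OF energy_inf_LIMSEQ], intro exI[of _ l] allI impI)
    fix k assume "l \<le> k"
    then have "\<bar>EN (rescale \<rho> k u)\<bar> \<noteq> \<infinity>"
      using assms(1) EN_nonneg[of "rescale \<rho> k u"] by force
    then have "energy_at (enat k) u = ereal (q ^ k * real_of_ereal (EN (rescale \<rho> k u)))"
      unfolding energy_fin by (metis ereal_real' times_ereal.simps(1))
    then show "energy_at (enat k) u \<le> ereal B"
      using assms(2)[OF \<open>l \<le> k\<close>] by simp
  qed
  then show ?thesis
    by (auto intro: le_less_trans)
qed

lemma real_EN_parallelogram:
  assumes "EN f < \<infinity>" "EN g < \<infinity>"
  shows "real_of_ereal (EN (\<lambda>x. f x + g x)) \<le> 2 * real_of_ereal (EN f) + 2 * real_of_ereal (EN g)" (is ?A)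
    and "real_of_ereal (EN (\<lambda>x. f x - g x)) \<le> 2 * real_of_ereal (EN f) + 2 * real_of_ereal (EN g)" (is ?B)
proof -
  have "EL m (\<lambda>x. f x + g x) (\<lambda>x. f x + g x) + EL m (\<lambda>x. f x - g x) (\<lambda>x. f x - g x)
      = 2 * EL m f f + 2 * EL m g g" for m
    by (simp add: EL_add_left EL_add_right EL_diff_left EL_diff_right)
  moreover have "(\<lambda>m. EL m (\<lambda>x. f x + g x) (\<lambda>x. f x + g x) + EL m (\<lambda>x. f x - g x) (\<lambda>x. f x - g x))
      \<longlonglongrightarrow> real_of_ereal (EN (\<lambda>x. f x + g x)) + real_of_ereal (EN (\<lambda>x. f x - g x))"
    by (intro tendsto_add EN_finite_LIMSEQ EN_finite_parallelogram assms)
  moreover have "(\<lambda>m. 2 * EL m f f + 2 * EL m g g) \<longlonglongrightarrow> 2 * real_of_ereal (EN f) + 2 * real_of_ereal (EN g)"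
    by (intro tendsto_add tendsto_mult tendsto_const EN_finite_LIMSEQ assms)
  ultimately have "real_of_ereal (EN (\<lambda>x. f x + g x)) + real_of_ereal (EN (\<lambda>x. f x - g x))
      = 2 * real_of_ereal (EN f) + 2 * real_of_ereal (EN g)"
    by (simp add: LIMSEQ_unique)
  moreover have "0 \<le> real_of_ereal (EN (\<lambda>x. f x + g x))" "0 \<le> real_of_ereal (EN (\<lambda>x. f x - g x))"
    using EN_nonneg by (auto intro: real_of_ereal_pos)
  ultimately show ?A ?B
    by linarith+
qed

lemma energy_inf_parallelogram:
  assumes "energy_at \<infinity> u < \<infinity>" "energy_at \<infinity> v < \<infinity>"
  shows "energy_at \<infinity> (\<lambda>x. u x + v x) < \<infinity>" "energy_at \<infinity> (\<lambda>x. u x - v x) < \<infinity>"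
proof -
  let ?B = "2 * real_of_ereal (energy_at \<infinity> u) + 2 * real_of_ereal (energy_at \<infinity> v)"
  have fin: "EN (rescale \<rho> k u) < \<infinity>" "EN (rescale \<rho> k v) < \<infinity>" for k
    using assms EN_finite_of_energy by blast+
  have le: "q ^ k * real_of_ereal (EN (rescale \<rho> k z)) \<le> real_of_ereal (energy_at \<infinity> z)"
    if "energy_at \<infinity> z < \<infinity>" for k z
    using energy_fin_le_inf[of k z] that energy_nonneg[of k z]
    by (subst real_energy_fin[symmetric]) (auto intro: real_of_ereal_positive_mono)
  have bound: "q ^ k * X \<le> ?B" if "X \<le> 2 * real_of_ereal (EN (rescale \<rho> k u)) + 2 * real_of_ereal (EN (rescale \<rho> k v))" for k X
  proof -
    have "q ^ k * X \<le> q ^ k * (2 * real_of_ereal (EN (rescale \<rho> k u)) + 2 * real_of_ereal (EN (rescale \<rho> k v)))"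
      using that q_pos by (intro mult_left_mono) auto
    also have "\<dots> \<le> ?B"
      using le[OF assms(1), of k] le[OF assms(2), of k] by (simp add: algebra_simps)
    finally show ?thesis .
  qed
  show "energy_at \<infinity> (\<lambda>x. u x + v x) < \<infinity>"
    by (rule energy_inf_leI[where l = 0 and B = ?B]; unfold rescale_add rescale_diff)
      (intro EN_finite_parallelogram fin bound real_EN_parallelogram)+
  show "energy_at \<infinity> (\<lambda>x. u x - v x) < \<infinity>"
    by (rule energy_inf_leI[where l = 0 and B = ?B]; unfold rescale_add rescale_diff)
      (intro EN_finite_parallelogram fin bound real_EN_parallelogram)+
qed

text \<open>The argument of the bounded case, with a test function that must be admissible on the
  whole of K_\<infinity>. On K_(k+d) the cell is renamed \<open>replicate d i0 @ w\<close>; the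
  scaling factor \<open>q ^ (k + d)\<close> compensates the longer word, so the form has the same
  value for all \<open>d\<close>.\<close>

lemma harmonic_on_cell_inf:
  assumes harm: "harmonic_at \<infinity> u U" and U: "U \<subseteq> BL (enat k)"
    and w: "w \<in> W m" "cell k w ` K \<subseteq> U" and x: "x \<in> K"
  shows "u (cell k w x) = hext (u \<circ> cell k w) x"
proof -
  have u: "continuous_on (BL \<infinity>) u" "energy_at \<infinity> u < \<infinity>"
    using harm unfolding harmonic_in_def blowup_domain_def by auto
  have U_open: "openin (top_of_set (BL \<infinity>)) U"
    using harm unfolding harmonic_in_def by blast
  define g where "g = u \<circ> cell k w"
  have g: "g = rescale \<rho> (k + d) u \<circ> FW (replicate d i0 @ w)" for d
    by (simp add: g_def fun_eq_iff rescale_word cell_replicate)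
  have w': "replicate d i0 @ w \<in> W (d + m)" for d
    using replicate_in_W w(1) by (rule append_in_words)
  have g_cont: "continuous_on K g"
    unfolding g_def using continuous_on_subset[OF u(1) BL_subset] w(1) by (rule continuous_on_comp_cell)
  have u_fin: "EN (rescale \<rho> l u) < \<infinity>" for l
    using u(2) by (rule EN_finite_of_energy)
  have g_fin: "EN g < \<infinity>"
    using EN_cell_finite[OF u_fin w'] g[of 0] by metis
  define \<phi> where "\<phi> = bump k w (remainder g)"
  have \<phi>: "\<phi> = bump (k + d) (replicate d i0 @ w) (remainder g)" for d
    unfolding \<phi>_def bump_replicate ..
  have fin: "EN (remainder g) < \<infinity>"
    using g_fin by (rule EN_remainder_finite)
  have cancel: "q ^ (k + d) * (inverse q ^ (d + m) * z) = q ^ k * (inverse q ^ m * z)" for d z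
    using q_pos by (simp add: power_add field_simps)
  have \<phi>_le: "EN (rescale \<rho> (k + d) \<phi>) \<le> ereal (inverse q ^ (d + m) * real_of_ereal (EN (remainder g)))" for d
    unfolding \<phi>[of d] by (intro EN_bump_le w' remainder_V fin)
  have \<phi>_energy: "energy_at \<infinity> \<phi> < \<infinity>"
  proof (rule energy_inf_leI)
    fix l assume "k \<le> l"
    then obtain d where l: "l = k + d"
      using le_Suc_ex by blast
    show "EN (rescale \<rho> l \<phi>) < \<infinity>"
      unfolding l using \<phi>_le[of d] by auto
    have "real_of_ereal (EN (rescale \<rho> l \<phi>)) \<le> inverse q ^ (d + m) * real_of_ereal (EN (remainder g))"
      using real_of_ereal_positive_mono[OF EN_nonneg \<phi>_le[of d]] by (simp add: l)
    then have "q ^ l * real_of_ereal (EN (rescale \<rho> l \<phi>)) \<le> q ^ l * (inverse q ^ (d + m) * real_of_ereal (EN (remainder g)))"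
      using q_pos by (intro mult_left_mono) auto
    then show "q ^ l * real_of_ereal (EN (rescale \<rho> l \<phi>)) \<le> q ^ k * (inverse q ^ m * real_of_ereal (EN (remainder g)))"
      unfolding l cancel .
  qed
  have \<phi>_cont_k: "continuous_on (BL (enat k)) \<phi>"
    unfolding \<phi>_def using continuous_on_bump[OF w(1) remainder_V continuous_on_remainder[OF g_cont]] .
  have \<phi>_cont: "continuous_on (BL \<infinity>) \<phi>"
  proof -
    \<comment> \<open>Continuity on \<open>U\<close> comes from K_k, which contains
      \<open>U\<close>; off the closed cell the function is 0. Both pieces are open in
      K_\<infinity>, so they can be pasted.\<close>
    let ?T = "BL \<infinity> - cell k w ` K"
    have eq: "BL \<infinity> = U \<union> ?T"
      using w(2) openin_imp_subset[OF U_open] by blast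
    have "openin (top_of_set (BL \<infinity>)) ?T"
      by (metis Diff_Diff_Int closed_cell_image open_Compl openin_open_Int Diff_eq)
    moreover have "continuous_on ?T \<phi>"
      by (rule continuous_on_eq[OF continuous_on_const[of _ 0]]) (simp add: \<phi>_def bump_def)
    moreover have "continuous_on U \<phi>"
      using \<phi>_cont_k U by (rule continuous_on_subset)
    ultimately have "continuous_on (U \<union> ?T) \<phi>"
      using U_open eq by (intro continuous_on_Un_local_open) auto
    then show ?thesis
      using eq by simp
  qed
  have \<phi>_L2: "integrable (blowup_measure \<rho> K \<alpha> \<infinity>) (\<lambda>x. (\<phi> x)\<^sup>2)"
  proof -
    let ?N = "blowup_measure \<rho> K \<alpha> \<infinity>"
    have "compact (\<phi> ` BL (enat k))"
      using \<phi>_cont_k compact_BL by (rule compact_continuous_image)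
    then have "bounded (\<phi> ` BL (enat k))"
      by (rule compact_imp_bounded)
    then obtain B where B: "\<And>x. x \<in> BL (enat k) \<Longrightarrow> \<bar>\<phi> x\<bar> \<le> B"
      unfolding bounded_iff by auto
    have meas: "BL (enat k) \<in> sets ?N"
      unfolding blowup_measure_def using closed_BL BL_subset[of k]
      by (auto simp: sets_restrict_space image_iff intro!: bexI[of _ "BL (enat k)"])
    have "\<phi> \<in> borel_measurable (restrict_space borel (BL \<infinity>))"
      using \<phi>_cont by (rule borel_measurable_continuous_on_restrict)
    then have \<phi>_meas: "\<phi> \<in> borel_measurable ?N"
      unfolding blowup_measure_def
      by (subst measurable_cong_sets[OF sets_restrict_space_cong[OF sets_hausdorff_measure] refl])
    have "emeasure ?N (BL (enat k)) < \<infinity>"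
      unfolding blowup_measure_def using emeasure_BL_finite[of k] BL_borel BL_subset[of k]
      by (subst emeasure_restrict_space) auto
    then show ?thesis
    proof (intro integrableI_bounded_set[where A = "BL (enat k)" and B = "B\<^sup>2"] meas)
      have "(\<phi> x)\<^sup>2 \<le> B\<^sup>2" if "x \<in> BL (enat k)" for x
        using power_mono[OF B[OF that] abs_ge_zero, of 2] by simp
      then show "AE x in ?N. x \<in> BL (enat k) \<longrightarrow> norm ((\<phi> x)\<^sup>2) \<le> B\<^sup>2"
        by simp
      show "AE x in ?N. x \<notin> BL (enat k) \<longrightarrow> (\<phi> x)\<^sup>2 = 0"
        using cell_in_BL[OF w(1), of _ k] by (intro AE_I2) (auto simp: \<phi>_def bump_def)
    qed (use \<phi>_meas in auto)
  qed
  have "\<phi> \<in> domain_at \<infinity>"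
    unfolding blowup_domain_def using \<phi>_cont \<phi>_L2 \<phi>_energy by simp
  then have form0: "form_at \<infinity> u \<phi> = 0"
    unfolding \<phi>_def using harmonic_at_bump[OF harm _ w(1) _ w(2)] by simp
  let ?f = "\<lambda>l. (q ^ l * real_of_ereal (EN (rescale \<rho> l (\<lambda>x. u x + \<phi> x)))
      - q ^ l * real_of_ereal (EN (rescale \<rho> l (\<lambda>x. u x - \<phi> x)))) / 4"
  have "?f \<longlonglongrightarrow> form_at \<infinity> u \<phi>"
    unfolding blowup_form_def
    by (intro tendsto_divide tendsto_diff energy_inf_real_LIMSEQ energy_inf_parallelogram u(2) \<phi>_energy tendsto_const) simp
  then have "(\<lambda>d. ?f (d + k)) \<longlonglongrightarrow> form_at \<infinity> u \<phi>"
    by (rule LIMSEQ_ignore_initial_segment)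
  moreover have "?f (d + k) = q ^ k * (inverse q ^ m * real_of_ereal (EN (remainder g)))" for d
  proof -
    have "?f (k + d) = q ^ (k + d) * (inverse q ^ (d + m) * real_of_ereal (EN (remainder g)))"
      unfolding remainder_pairing[OF u_fin[of "k + d"] w'[of d] g[of d] refl, of "k + d", symmetric] \<phi>[of d, symmetric]
      by (simp add: rescale_add rescale_diff right_diff_distrib)
    then show ?thesis
      unfolding cancel by (simp add: add.commute)
  qed
  ultimately have "form_at \<infinity> u \<phi> = q ^ k * (inverse q ^ m * real_of_ereal (EN (remainder g)))"
    by (simp add: LIMSEQ_const_iff)
  then have "real_of_ereal (EN (remainder g)) = 0"
    using q_pos form0 by simp
  then show ?thesis
    using remainder_zero[OF g_cont g_fin _ x] by (simp add: g_def)
qed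

section \<open>The Hoelder estimate\<close>

text \<open>A point \<open>y\<close> of the ball may be known to lie only in a much later stage.
  Seen there, \<open>x0\<close> and \<open>y\<close> belong to two copies of K_l1, where
  \<open>l1\<close> is so large that the radius is below the separation distance of such copies.
  Hence the copies meet, and the one containing \<open>y\<close> is one of finitely many translates
  of K_l1.\<close>

lemma ball_in_BL:
  assumes x0: "x0 \<in> BL \<infinity>" and s: "s > 0"
  obtains l where "ball x0 s \<inter> BL \<infinity> \<subseteq> BL (enat l)"
proof -
  obtain c where c: "c > 0" "\<And>m w v x y. w \<in> W m \<Longrightarrow> v \<in> W m \<Longrightarrow> x \<in> K \<Longrightarrow> y \<in> K \<Longrightarrow>
      dist (FW w x) (FW v y) < c * \<rho> ^ m \<Longrightarrow> FW w ` K \<inter> FW v ` K \<noteq> {}"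
    using disjoint_cells_apart by metis
  obtain l0 where l0: "x0 \<in> BL (enat l0)"
    using x0 unfolding BL_inf by blast
  obtain j where j: "\<rho> ^ j < c / s"
    using rho_power_less c(1) s by (metis divide_pos_pos)
  define l1 where "l1 = max l0 j"
  have "\<rho> ^ l1 \<le> \<rho> ^ j"
    using rho_pos rho_less_1 by (intro power_decreasing) (auto simp: l1_def)
  then have "s * \<rho> ^ l1 \<le> s * \<rho> ^ j"
    using s by (intro mult_left_mono) auto
  also have "\<dots> < c"
    using j s by (simp add: field_simps)
  finally have l1: "s * \<rho> ^ l1 < c" .
  obtain x' where x': "x' \<in> K" "x0 = cell l1 [] x'"
    using l0 BL_mono[of l0 l1] unfolding BL_enat l1_def by auto
  \<comment> \<open>\<open>S t\<close> is K_l1 displaced by \<open>t\<close> in units of its size,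
    and \<open>\<kappa> t\<close> a stage containing it, or an arbitrary number if there is
    none.\<close>
  define S where "S t = (\<lambda>z. cell l1 [] (z + t)) ` K" for t
  define \<kappa> where "\<kappa> t = (SOME k. S t \<subseteq> BL (enat k))" for t
  have \<kappa>: "S t \<subseteq> BL (enat (\<kappa> t))" if "S t \<subseteq> BL (enat k)" for t k
    unfolding \<kappa>_def using that by (rule someI)
  have "ball x0 s \<inter> BL \<infinity> \<subseteq> BL (enat (Max (\<kappa> ` displacements)))"
  proof
    fix y assume y: "y \<in> ball x0 s \<inter> BL \<infinity>"
    then obtain k' where k': "y \<in> BL (enat k')"
      unfolding BL_inf by blast
    define d where "d = k' - l1"
    have "y \<in> BL (enat (l1 + d))"
      using k' by (rule subsetD[OF BL_mono, rotated]) (simp add: d_def)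
    then obtain v y' where v: "v \<in> W d" "y' \<in> K" "y = cell (l1 + d) v y'"
      by (rule BL_cell)
    have x0_eq: "x0 = cell (l1 + d) (replicate d i0) x'"
      using x'(2) cell_replicate[of l1 d "[]"] by simp
    have "dist x0 y < s"
      using y by simp
    then have "dist (FW (replicate d i0) x') (FW v y') < s * \<rho> ^ (l1 + d)"
      unfolding x0_eq v(3) dist_cell using rho_pos by (simp add: field_simps)
    also have "\<dots> \<le> c * \<rho> ^ d"
      using l1 rho_pos by (simp add: power_add mult.assoc[symmetric])
    finally have "FW (replicate d i0) ` K \<inter> FW v ` K \<noteq> {}"
      using c(2)[OF replicate_in_W v(1) x'(1) v(2)] by blast
    then obtain t where t: "t \<in> displacements" "\<And>x. FW v x = FW (replicate d i0) (x + t)"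
      using displacement_cells[OF replicate_in_W v(1)] by metis
    have v_eq: "cell (l1 + d) v z = cell l1 [] (z + t)" for z
      using cell_replicate[of l1 d "[]"] t(2) by (metis append_Nil2 cell_def)
    then have "S t = cell (l1 + d) v ` K"
      unfolding S_def by simp
    then have "S t \<subseteq> BL (enat (l1 + d))" "y \<in> S t"
      using cell_in_BL[OF v(1)] v by auto
    then have "y \<in> BL (enat (\<kappa> t))"
      using \<kappa> by blast
    moreover have "\<kappa> t \<le> Max (\<kappa> ` displacements)"
      using t(1) finite_displacements by (intro Max_ge) auto
    ultimately show "y \<in> BL (enat (Max (\<kappa> ` displacements)))"
      using BL_mono by blast
  qed
  then show ?thesis
    using that by blast
qed

text \<open>Take a subcell of depth \<open>j\<close> containing a vertex where the absolute value of
  \<open>f\<close> attains its maximum \<open>S\<close>. The boundary values oscillate by at most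
  \<open>2 * S\<close>, so on the subcell the extension changes by at most \<open>S / 2\<close>; the
  choice of \<open>j\<close> involves only \<open>osc_const\<close> and \<open>q\<close>.\<close>

lemma hext_large_on_subcell:
  "\<exists>j. \<forall>f. \<exists>s\<in>W j. \<forall>x\<in>K. \<forall>p\<in>V. \<bar>f p\<bar> \<le> 2 * \<bar>hext f (FW s x)\<bar>"
proof -
  have "eventually (\<lambda>j. (2 * osc_const) * q ^ j < 1 / 2) sequentially"
    using q_power_tendsto_0 by (rule order_tendstoD(2)) simp
  then obtain j where j: "(2 * osc_const) * q ^ j < 1 / 2"
    by (rule eventually_happens'[OF sequentially_bot, rotated, THEN exE])
  have "\<exists>s\<in>W j. \<forall>x\<in>K. \<forall>p\<in>V. \<bar>f p\<bar> \<le> 2 * \<bar>hext f (FW s x)\<bar>" for f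
  proof -
    define S where "S = Max ((\<lambda>p. \<bar>f p\<bar>) ` V)"
    have le_S: "\<bar>f p\<bar> \<le> S" if "p \<in> V" for p
      unfolding S_def using that finite_V by auto
    have "S \<in> (\<lambda>p. \<bar>f p\<bar>) ` V"
      unfolding S_def using finite_V V_nonempty by (intro Max_in) auto
    then obtain p where p: "p \<in> V" "\<bar>f p\<bar> = S"
      by auto
    have "osc_le f (2 * S)"
      unfolding osc_le_def using le_S by (smt (verit))
    obtain s y where s: "s \<in> W j" "y \<in> K" "p = FW s y"
      using K_cell p(1) V_subset_K by blast
    have "S \<le> 2 * \<bar>hext f (FW s x)\<bar>" if "x \<in> K" for x
    proof -
      have "\<bar>hext f (FW s x) - hext f (FW s y)\<bar> \<le> osc_const * q ^ j * (2 * S)"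
        using s(1) that s(2) \<open>osc_le f (2 * S)\<close> by (rule hext_osc)
      also have "\<dots> = ((2 * osc_const) * q ^ j) * S"
        by simp
      also have "\<dots> \<le> 1 / 2 * S"
        using j p(2) by (intro mult_right_mono) auto
      finally have "\<bar>hext f (FW s x) - f p\<bar> \<le> S / 2"
        using hext_V[OF p(1)] s(3) by simp
      then show ?thesis
        using p(2) by linarith
    qed
    then show ?thesis
      using s(1) le_S order_trans by blast
  qed
  then show ?thesis
    by blast
qed

lemma emeasure_cell_finite: "w \<in> W m \<Longrightarrow> emeasure \<nu> (cell k w ` K) < \<infinity>"
  by (rule le_less_trans[OF emeasure_mono emeasure_BL_finite[of k]])
    (use cell_in_BL closed_BL in auto)

text \<open>
  By the separation of disjoint cells, a ball of radius comparable to the size of a cell is covered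
  by boundedly many translates of that cell.
\<close>

lemma measure_ball_le:
  "\<exists>L>0. \<forall>k x0 R m j w n. x0 \<in> BL (enat k) \<longrightarrow> \<rho> * (R * \<rho> ^ k) < \<rho> ^ m \<longrightarrow>
     ball x0 (2 * R) \<inter> BL n \<subseteq> BL (enat k) \<longrightarrow> w \<in> W (m + j) \<longrightarrow>
     measure \<nu> (ball x0 (2 * R) \<inter> BL n) \<le> L * real (M ^ j) * measure \<nu> (cell k w ` K)"
proof -
  obtain c where c: "c > 0" "\<And>m w v x y. w \<in> W m \<Longrightarrow> v \<in> W m \<Longrightarrow> x \<in> K \<Longrightarrow> y \<in> K \<Longrightarrow>
      dist (FW w x) (FW v y) < c * \<rho> ^ m \<Longrightarrow> FW w ` K \<inter> FW v ` K \<noteq> {}"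
    using disjoint_cells_apart by metis
  \<comment> \<open>With \<open>2 * \<rho> ^ h / \<rho> < c\<close>, the radius \<open>2 * R\<close>
    is below the separation distance of cells of level \<open>m - h\<close>.\<close>
  obtain h where h: "\<rho> ^ h < c * \<rho> / 2"
    using rho_power_less[of "c * \<rho> / 2"] c(1) rho_pos by auto
  define L where "L = real (card displacements) * real (M ^ h)"
  have "displacements \<noteq> {}"
    unfolding displacements_def using V_nonempty by auto
  then have "L > 0"
    unfolding L_def using finite_displacements M_ge_2 by (simp add: card_gt_0_iff)
  moreover have "measure \<nu> (ball x0 (2 * R) \<inter> BL n) \<le> L * real (M ^ j) * measure \<nu> (cell k w ` K)"
    if x0: "x0 \<in> BL (enat k)" and R: "\<rho> * (R * \<rho> ^ k) < \<rho> ^ m"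
      and sub: "ball x0 (2 * R) \<inter> BL n \<subseteq> BL (enat k)" and w: "w \<in> W (m + j)" for k x0 R m j w n
  proof -
    \<comment> \<open>Truncated subtraction: for \<open>m \<le> h\<close> this is level 0, where K_k
      itself is the only cell.\<close>
    define m0 where "m0 = m - h"
    obtain w0 x' where w0: "w0 \<in> W m0" "x' \<in> K" "x0 = cell k w0 x'"
      using BL_cell[OF x0] by blast
    define S where "S t = (\<lambda>z. cell k w0 (z + t)) ` K" for t
    have S_eq: "S t = (+) (cell k w0 t - cell k w0 0) ` cell k w0 ` K" for t
    proof -
      have "cell k w0 (z + t) = (cell k w0 t - cell k w0 0) + cell k w0 z" for z
      proof -
        have "cell k w0 (z + t) - cell k w0 0 = (cell k w0 t - cell k w0 0) + (cell k w0 z - cell k w0 0)"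
          by (subst (1 3 5) cell_affine) (simp add: scaleR_add_right)
        then show ?thesis
          by (simp add: algebra_simps)
      qed
      then show ?thesis
        unfolding S_def image_comp comp_def by (intro image_cong refl)
    qed
    have S_fm: "S t \<in> fmeasurable \<nu>" and S_measure: "measure \<nu> (S t) = measure \<nu> (cell k w0 ` K)" for t
    proof -
      have "closed (S t)"
        unfolding S_eq by (intro closed_translation closed_cell_image)
      moreover have "emeasure \<nu> (S t) = emeasure \<nu> (cell k w0 ` K)"
        unfolding S_eq by (intro emeasure_hausdorff_measure_translation closed_cell_image)
      ultimately show "S t \<in> fmeasurable \<nu>" "measure \<nu> (S t) = measure \<nu> (cell k w0 ` K)"
        using emeasure_cell_finite[OF w0(1), of k] by (auto simp: fmeasurable_def measure_def)
    qed
    have cover: "ball x0 (2 * R) \<inter> BL n \<subseteq> (\<Union>t\<in>displacements. S t)"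
    proof
      fix y assume y: "y \<in> ball x0 (2 * R) \<inter> BL n"
      then obtain v y' where v: "v \<in> W m0" "y' \<in> K" "y = cell k v y'"
        using sub BL_cell[of y k m0] by blast
      have "FW w0 ` K \<inter> FW v ` K \<noteq> {}"
      proof (cases "m0 = 0")
        case True
        then show ?thesis
          using w0 v K_nonempty by auto
      next
        case False
        then have m: "m = m0 + h"
          unfolding m0_def by simp
        have "dist x0 y < 2 * R"
          using y by simp
        then have "dist (FW w0 x') (FW v y') < 2 * (R * \<rho> ^ k)"
          unfolding w0(3) v(3) dist_cell using rho_pos by (simp add: field_simps)
        also have "\<dots> < 2 * (\<rho> ^ m / \<rho>)"
          using R rho_pos by (simp add: field_simps)
        also have "\<dots> = (2 * \<rho> ^ h / \<rho>) * \<rho> ^ m0"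
          by (simp add: m power_add)
        also have "\<dots> \<le> c * \<rho> ^ m0"
          using h rho_pos by (intro mult_right_mono) (auto simp: field_simps)
        finally show ?thesis
          using c(2)[OF w0(1) v(1) w0(2) v(2)] by blast
      qed
      then obtain t where "t \<in> displacements" "\<And>x. FW v x = FW w0 (x + t)"
        using displacement_cells[OF w0(1) v(1)] by metis
      then show "y \<in> (\<Union>t\<in>displacements. S t)"
        using v unfolding S_def by (auto simp: cell_def)
    qed
    have "m0 + ((m - m0) + j) = m + j"
      unfolding m0_def by simp
    then have w_split: "w \<in> W (m0 + ((m - m0) + j))"
      using w by (simp only:)
    have "measure \<nu> (ball x0 (2 * R) \<inter> BL n) \<le> measure \<nu> (\<Union>t\<in>displacements. S t)"
      using cover BL_borel S_fm finite_displacements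
      by (intro measure_mono_fmeasurable fmeasurable.finite_UN) auto
    also have "\<dots> \<le> (\<Sum>t\<in>displacements. measure \<nu> (S t))"
    proof (intro measure_subadditive_finite finite_displacements)
      show "S ` displacements \<subseteq> sets \<nu>"
        using S_fm[THEN fmeasurableD] by blast
      show "emeasure \<nu> (S t) \<noteq> \<infinity>" for t
        using S_fm[THEN fmeasurableD2] by simp
    qed
    also have "\<dots> = real (card displacements) * measure \<nu> (cell k w0 ` K)"
      by (simp add: S_measure)
    also have "\<dots> \<le> real (card displacements) * (real (M ^ ((m - m0) + j)) * measure \<nu> (cell k w ` K))"
      by (intro mult_left_mono measure_cell_le[OF w0(1) w_split]) simp
    also have "\<dots> \<le> real (card displacements) * (real (M ^ (h + j)) * measure \<nu> (cell k w ` K))"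
    proof (intro mult_left_mono mult_right_mono)
      have "M ^ (m - m0 + j) \<le> M ^ (h + j)"
        using M_ge_2 by (intro power_increasing) (auto simp: m0_def)
      then show "real (M ^ (m - m0 + j)) \<le> real (M ^ (h + j))"
        by (rule of_nat_mono)
    qed auto
    finally show ?thesis
      by (simp add: L_def power_add mult_ac)
  qed
  ultimately show ?thesis
    by blast
qed

lemma set_integrable_abs_continuous:
  fixes u :: "'a \<Rightarrow> real"
  assumes "S \<in> sets borel" "S \<subseteq> BL (enat k)" "continuous_on (BL (enat k)) u"
  shows "set_integrable \<nu> S (\<lambda>x. \<bar>u x\<bar>)"
proof -
  have cont: "continuous_on S (\<lambda>x. \<bar>u x\<bar>)"
    using continuous_on_subset[OF assms(3,2)] by (rule continuous_on_rabs)
  have "bounded (u ` BL (enat k))"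
    using assms(3) compact_BL by (intro compact_imp_bounded compact_continuous_image)
  then obtain B where B: "\<And>x. x \<in> BL (enat k) \<Longrightarrow> \<bar>u x\<bar> \<le> B"
    unfolding bounded_iff by auto
  have "emeasure \<nu> S \<le> emeasure \<nu> (BL (enat k))"
    using assms(2) closed_BL by (intro emeasure_mono) auto
  then have "emeasure \<nu> S < \<infinity>"
    using emeasure_BL_finite[of k] by (rule le_less_trans)
  moreover have "(\<lambda>x. indicator S x *\<^sub>R \<bar>u x\<bar>) \<in> borel_measurable \<nu>"
    using borel_measurable_continuous_on_indicator[OF assms(1) cont]
    by (simp cong: measurable_cong_sets)
  ultimately show ?thesis
    unfolding set_integrable_def using assms(1,2) B
    by (intro integrableI_bounded_set[where A = S and B = B]) (auto simp: subset_iff)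
qed

text \<open>The maximum principle reduces the claim to the largest absolute vertex value
  \<open>S\<close> of the cell. The integral is at least \<open>S / 2\<close> times the measure of
  the subcell from \<open>hext_large_on_subcell\<close>, and \<open>measure_ball_le\<close> compares
  that subcell with the ball.\<close>

lemma mean_value_bound:
  "\<exists>C>0. \<forall>k x0 R n u m w x. x0 \<in> BL (enat k) \<longrightarrow> \<rho> * (R * \<rho> ^ k) < \<rho> ^ m \<longrightarrow>
     ball x0 (2 * R) \<inter> BL n \<subseteq> BL (enat k) \<longrightarrow> continuous_on (BL (enat k)) u \<longrightarrow>
     w \<in> W m \<longrightarrow> cell k w ` K \<subseteq> ball x0 (2 * R) \<inter> BL n \<longrightarrow>
     (\<forall>x\<in>K. u (cell k w x) = hext (u \<circ> cell k w) x) \<longrightarrow> emeasure \<nu> K \<noteq> 0 \<longrightarrow> x \<in> K \<longrightarrow>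
     \<bar>u (cell k w x)\<bar> \<le> C * (1 / measure \<nu> (ball x0 (2 * R) \<inter> BL n) *
       (LINT x:ball x0 (2 * R) \<inter> BL n|\<nu>. \<bar>u x\<bar>))"
proof -
  obtain j where j: "\<And>f. \<exists>s\<in>W j. \<forall>x\<in>K. \<forall>p\<in>V. \<bar>f p\<bar> \<le> 2 * \<bar>hext f (FW s x)\<bar>"
    using hext_large_on_subcell by blast
  obtain L where L: "L > 0" "\<And>k x0 R m j w n. x0 \<in> BL (enat k) \<Longrightarrow> \<rho> * (R * \<rho> ^ k) < \<rho> ^ m \<Longrightarrow>
     ball x0 (2 * R) \<inter> BL n \<subseteq> BL (enat k) \<Longrightarrow> w \<in> W (m + j) \<Longrightarrow>
     measure \<nu> (ball x0 (2 * R) \<inter> BL n) \<le> L * real (M ^ j) * measure \<nu> (cell k w ` K)"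
    using measure_ball_le by metis
  \<comment> \<open>The factor 2 undoes the half of the maximum; \<open>L * M ^ j\<close> bounds the
    ratio of the measures of ball and subcell.\<close>
  define C where "C = 2 * (L * real (M ^ j))"
  have "C > 0"
    unfolding C_def using L(1) M_ge_2 by simp
  have main: "\<bar>u (cell k w x)\<bar> \<le> C * (1 / measure \<nu> (ball x0 (2 * R) \<inter> BL n) *
       (LINT x:ball x0 (2 * R) \<inter> BL n|\<nu>. \<bar>u x\<bar>))"
    if x0: "x0 \<in> BL (enat k)" and R: "\<rho> * (R * \<rho> ^ k) < \<rho> ^ m"
      and sub: "ball x0 (2 * R) \<inter> BL n \<subseteq> BL (enat k)" and cont: "continuous_on (BL (enat k)) u"
      and w: "w \<in> W m" "cell k w ` K \<subseteq> ball x0 (2 * R) \<inter> BL n"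
      and harm: "\<forall>x\<in>K. u (cell k w x) = hext (u \<circ> cell k w) x"
      and pos: "emeasure \<nu> K \<noteq> 0" and x: "x \<in> K" for k x0 R n u m w x
  proof -
    let ?f = "u \<circ> cell k w" and ?B = "ball x0 (2 * R) \<inter> BL n"
    define S where "S = Max ((\<lambda>p. \<bar>?f p\<bar>) ` V)"
    have le_S: "\<bar>?f p\<bar> \<le> S" if "p \<in> V" for p
      unfolding S_def using that finite_V by auto
    have "S \<in> (\<lambda>p. \<bar>?f p\<bar>) ` V"
      unfolding S_def using finite_V V_nonempty by (intro Max_in) auto
    then obtain p where p: "p \<in> V" "S = \<bar>?f p\<bar>"
      by auto
    obtain s where s: "s \<in> W j" "\<And>x p. x \<in> K \<Longrightarrow> p \<in> V \<Longrightarrow> \<bar>?f p\<bar> \<le> 2 * \<bar>hext ?f (FW s x)\<bar>"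
      using j[of ?f] by blast
    let ?D = "cell k (w @ s) ` K"
    have ws: "w @ s \<in> W (m + j)"
      using w(1) s(1) by (rule append_in_words)
    have D_sub: "?D \<subseteq> cell k w ` K"
      using FW_in_K[OF s(1)] by (auto simp: cell_append)
    have large: "S / 2 \<le> \<bar>u z\<bar>" if "z \<in> ?D" for z
    proof -
      obtain y where y: "y \<in> K" "z = cell k w (FW s y)"
        using \<open>z \<in> ?D\<close> unfolding cell_append by blast
      then have "u z = hext ?f (FW s y)"
        using harm FW_in_K[OF s(1)] by blast
      then show ?thesis
        using s(2)[OF y(1) p(1)] p(2) by simp
    qed
    have B_borel: "?B \<in> sets borel"
      using BL_borel by auto
    have "S / 2 * measure \<nu> ?D = (LINT x:?D|\<nu>. S / 2)"
      using emeasure_cell_finite[OF ws, of k] closed_cell_image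
      by (simp add: set_lebesgue_integral_def mult.commute)
    also have "\<dots> \<le> (LINT x:?B|\<nu>. \<bar>u x\<bar>)"
      unfolding set_lebesgue_integral_def
    proof (rule integral_mono)
      show "integrable \<nu> (\<lambda>x. indicator ?D x *\<^sub>R (S / 2))"
        using emeasure_cell_finite[OF ws, of k] closed_cell_image
        by (intro integrable_scaleR_left) (auto intro!: integrable_real_indicator)
      show "integrable \<nu> (\<lambda>x. indicator ?B x *\<^sub>R \<bar>u x\<bar>)"
        using set_integrable_abs_continuous[OF B_borel sub cont] unfolding set_integrable_def .
      show "indicator ?D x *\<^sub>R (S / 2) \<le> indicator ?B x *\<^sub>R \<bar>u x\<bar>" for x
      proof (cases "x \<in> ?D")
        case True
        then have "x \<in> ?B"
          using D_sub w(2) by blast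
        then show ?thesis
          using True large[OF True] by (simp only: indicator_simps scaleR_one)
      qed simp
    qed
    finally have int: "S / 2 * measure \<nu> ?D \<le> (LINT x:?B|\<nu>. \<bar>u x\<bar>)" .
    have D_pos: "measure \<nu> ?D > 0"
      using pos ws by (rule measure_cell_pos)
    have B_le: "measure \<nu> ?B \<le> L * real (M ^ j) * measure \<nu> ?D"
      using L(2)[OF x0 R sub ws] .
    have "measure \<nu> ?D \<le> measure \<nu> ?B"
    proof (rule measure_mono_fmeasurable)
      have "emeasure \<nu> ?B \<le> emeasure \<nu> (BL (enat k))"
        using sub closed_BL by (intro emeasure_mono) auto
      then show "?B \<in> fmeasurable \<nu>"
        using B_borel emeasure_BL_finite[of k] by (auto simp: fmeasurable_def)
      show "?D \<subseteq> ?B"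
        using D_sub w(2) by (rule subset_trans)
      show "?D \<in> sets \<nu>"
        using closed_cell_image by simp
    qed
    then have B_pos: "measure \<nu> ?B > 0"
      using D_pos by linarith
    have "S \<ge> 0"
      using p(2) by simp
    have "S * measure \<nu> ?B \<le> S * (L * real (M ^ j) * measure \<nu> ?D)"
      using B_le \<open>S \<ge> 0\<close> by (rule mult_left_mono)
    also have "\<dots> = C * (S / 2 * measure \<nu> ?D)"
      by (simp add: C_def)
    also have "\<dots> \<le> C * (LINT x:?B|\<nu>. \<bar>u x\<bar>)"
      using int \<open>C > 0\<close> by (intro mult_left_mono) auto
    finally have "S \<le> C * (1 / measure \<nu> ?B * (LINT x:?B|\<nu>. \<bar>u x\<bar>))"
      using B_pos by (simp add: field_simps)
    moreover have "\<bar>u (cell k w x)\<bar> \<le> S"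
    proof -
      have "- S \<le> hext ?f x" "hext ?f x \<le> S"
        using hext_bounds[of "- S" ?f S x] le_S x by (auto simp: abs_le_iff minus_le_iff)
      then show ?thesis
        using harm x by simp
    qed
    ultimately show ?thesis
      by linarith
  qed
  show ?thesis
    by (intro exI[of _ C] conjI allI impI \<open>C > 0\<close>) (rule main; assumption)
qed

lemma beta_greater: "\<beta> - \<alpha> > 0"
proof (rule ccontr)
  assume "\<not> \<beta> - \<alpha> > 0"
  then have "\<rho> powr 0 \<le> \<rho> powr (\<beta> - \<alpha>)"
    using rho_pos rho_less_1 by (intro powr_mono') auto
  then show False
    using q_less_1 rho_pos unfolding q_eq by simp
qed

text \<open>Harmonicity enters only through the values on cells inside the doubled ball, so that one
  estimate serves both K_k and K_\<infinity>. The condition \<open>R * \<rho> ^ k < 1\<close> says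
  that the radius is below the diameter of K_k, which leaves room for a level of cells adapted to
  the ball.\<close>

lemma interior_estimate:
  "\<exists>C>0. \<forall>k x0 R n u x y. x0 \<in> BL (enat k) \<longrightarrow> 0 < R \<longrightarrow> R * \<rho> ^ k < 1 \<longrightarrow>
     ball x0 (2 * R) \<inter> BL n \<subseteq> BL (enat k) \<longrightarrow> enat k \<le> n \<longrightarrow> continuous_on (BL (enat k)) u \<longrightarrow>
     (\<forall>m w x. w \<in> W m \<longrightarrow> cell k w ` K \<subseteq> ball x0 (2 * R) \<inter> BL n \<longrightarrow> x \<in> K \<longrightarrow>
        u (cell k w x) = hext (u \<circ> cell k w) x) \<longrightarrow> emeasure \<nu> K \<noteq> 0 \<longrightarrow>
     x \<in> ball x0 R \<inter> BL n \<longrightarrow> y \<in> ball x0 R \<inter> BL n \<longrightarrow> x \<noteq> y \<longrightarrow>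
     \<bar>u x - u y\<bar> \<le> C * (1 / measure \<nu> (ball x0 (2 * R) \<inter> BL n) *
       (LINT x:ball x0 (2 * R) \<inter> BL n|\<nu>. \<bar>u x\<bar>)) * (dist x y / R) powr (\<beta> - \<alpha>)"
proof -
  obtain c where c: "c > 0" "\<And>m w v x y. w \<in> W m \<Longrightarrow> v \<in> W m \<Longrightarrow> x \<in> K \<Longrightarrow> y \<in> K \<Longrightarrow>
      dist (FW w x) (FW v y) < c * \<rho> ^ m \<Longrightarrow> FW w ` K \<inter> FW v ` K \<noteq> {}"
    using disjoint_cells_apart by metis
  obtain C1 where C1: "C1 > 0" "\<And>k x0 R n u m w x. x0 \<in> BL (enat k) \<Longrightarrow> \<rho> * (R * \<rho> ^ k) < \<rho> ^ m \<Longrightarrow>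
     ball x0 (2 * R) \<inter> BL n \<subseteq> BL (enat k) \<Longrightarrow> continuous_on (BL (enat k)) u \<Longrightarrow>
     w \<in> W m \<Longrightarrow> cell k w ` K \<subseteq> ball x0 (2 * R) \<inter> BL n \<Longrightarrow>
     (\<forall>x\<in>K. u (cell k w x) = hext (u \<circ> cell k w) x) \<Longrightarrow> emeasure \<nu> K \<noteq> 0 \<Longrightarrow> x \<in> K \<Longrightarrow>
     \<bar>u (cell k w x)\<bar> \<le> C1 * (1 / measure \<nu> (ball x0 (2 * R) \<inter> BL n) *
       (LINT x:ball x0 (2 * R) \<inter> BL n|\<nu>. \<bar>u x\<bar>))"
    using mean_value_bound by metis
  define \<gamma> where "\<gamma> = \<beta> - \<alpha>"
  have "\<gamma> > 0"
    unfolding \<gamma>_def by (rule beta_greater)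
  \<comment> \<open>The 4 stands for two cells, each with vertex values oscillating by at most
    \<open>2 * (C1 * A)\<close>. In \<open>c * \<rho>\<^sup>2\<close> one \<rho> pays for rounding
    the radius to a level, the other for rounding the distance, and \<open>c\<close> for the
    separation of cells.\<close>
  define C where "C = 4 * osc_const * C1 * (1 / (c * \<rho>\<^sup>2)) powr \<gamma>"
  have "C > 0"
    unfolding C_def using osc_const_ge_1 C1(1) c(1) rho_pos by (intro mult_pos_pos) auto
  have main: "\<bar>u x - u y\<bar> \<le> C * A * (dist x y / R) powr \<gamma>"
    if x0: "x0 \<in> BL (enat k)" and R: "0 < R" "R * \<rho> ^ k < 1"
      and sub: "ball x0 (2 * R) \<inter> BL n \<subseteq> BL (enat k)" and kn: "enat k \<le> n"
      and cont: "continuous_on (BL (enat k)) u"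
      and harm: "\<And>m w x. w \<in> W m \<Longrightarrow> cell k w ` K \<subseteq> ball x0 (2 * R) \<inter> BL n \<Longrightarrow> x \<in> K \<Longrightarrow>
        u (cell k w x) = hext (u \<circ> cell k w) x"
      and pos: "emeasure \<nu> K \<noteq> 0"
      and xy: "x \<in> ball x0 R \<inter> BL n" "y \<in> ball x0 R \<inter> BL n" "x \<noteq> y"
      and A: "A = 1 / measure \<nu> (ball x0 (2 * R) \<inter> BL n) *
        (LINT x:ball x0 (2 * R) \<inter> BL n|\<nu>. \<bar>u x\<bar>)"
    for k x0 R n u x y A
  proof -
    define \<epsilon> where "\<epsilon> = R * \<rho> ^ k"
    have \<epsilon>: "0 < \<epsilon>" "\<epsilon> < 1"
      unfolding \<epsilon>_def using R rho_pos by auto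
    \<comment> \<open>Cells of this level have diameter between \<open>\<rho> * R\<close> and
      \<open>R\<close> in K_k: small enough that those meeting the ball lie in its double, large
      enough for the mean value bound.\<close>
    define m where "m = (LEAST m. \<rho> ^ m \<le> \<epsilon>)"
    have ex: "\<exists>m. \<rho> ^ m \<le> \<epsilon>"
      using rho_power_less[OF \<epsilon>(1)] less_imp_le by blast
    have m_le: "\<rho> ^ m \<le> \<epsilon>"
      unfolding m_def using ex by (rule LeastI_ex)
    have "m \<noteq> 0"
      using m_le \<epsilon>(2) by (intro notI) simp
    then obtain m' where m': "m = Suc m'"
      using not0_implies_Suc by blast
    have "\<not> \<rho> ^ m' \<le> \<epsilon>"
      using not_less_Least[of m' "\<lambda>m. \<rho> ^ m \<le> \<epsilon>"] m' unfolding m_def by simp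
    then have m_gt: "\<rho> * \<epsilon> < \<rho> ^ m"
      using rho_pos by (simp add: m')
    have cell_sub: "cell k w ` K \<subseteq> ball x0 (2 * R) \<inter> BL n"
      if w: "w \<in> W m" and z: "z \<in> ball x0 R" "z \<in> cell k w ` K" for w z
    proof
      fix z' assume z': "z' \<in> cell k w ` K"
      obtain z1 z1' where z1: "z1 \<in> K" "z = cell k w z1" "z1' \<in> K" "z' = cell k w z1'"
        using z(2) z' by blast
      have "dist z z' \<le> \<rho> ^ m / \<rho> ^ k"
        unfolding z1 dist_cell using dist_cell_le[OF w] z1 rho_pos by (intro divide_right_mono) auto
      also have "\<dots> \<le> R"
        using m_le rho_pos unfolding \<epsilon>_def by (simp add: field_simps)
      finally have "dist x0 z' < 2 * R"
        using z(1) dist_triangle[of x0 z' z] by simp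
      moreover have "z' \<in> BL n"
        using cell_in_BL[OF w z1(3), of k] BL_mono_enat[OF kn] z1(4) by blast
      ultimately show "z' \<in> ball x0 (2 * R) \<inter> BL n"
        by simp
    qed
    have bound: "\<bar>u (cell k w z)\<bar> \<le> C1 * A"
      if "w \<in> W m" "cell k w ` K \<subseteq> ball x0 (2 * R) \<inter> BL n" "z \<in> K" for w z
      unfolding A using x0 m_gt sub cont that(1,2) _ pos that(3) unfolding \<epsilon>_def
      by (rule C1(2)) (use harm that in blast)
    have BL_x: "x \<in> BL (enat k)" and BL_y: "y \<in> BL (enat k)"
      using xy sub R(1) by auto
    obtain w x' where x': "w \<in> W m" "x' \<in> K" "x = cell k w x'"
      using BL_cell[OF BL_x] by blast
    obtain v y' where y': "v \<in> W m" "y' \<in> K" "y = cell k v y'"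
      using BL_cell[OF BL_y] by blast
    have w_sub: "cell k w ` K \<subseteq> ball x0 (2 * R) \<inter> BL n"
      using cell_sub[OF x'(1), of x] x' xy(1) by blast
    have v_sub: "cell k v ` K \<subseteq> ball x0 (2 * R) \<inter> BL n"
      using cell_sub[OF y'(1), of y] y' xy(2) by blast
    have "0 \<le> C1 * A"
      using bound[OF x'(1) w_sub x'(2)] by linarith
    define \<delta> where "\<delta> = dist x y * \<rho> ^ k"
    have "\<delta> > 0"
      unfolding \<delta>_def using xy(3) rho_pos by simp
    have \<delta>_eq: "dist x y / R = \<delta> / \<epsilon>"
      unfolding \<delta>_def \<epsilon>_def using rho_pos by simp
    define X where "X = \<delta> / \<epsilon> / (c * \<rho>\<^sup>2)"
    have "X > 0"
      unfolding X_def using \<open>\<delta> > 0\<close> \<epsilon> c(1) rho_pos by simp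
    have C_eq: "C * A * (dist x y / R) powr \<gamma> = 4 * osc_const * (C1 * A) * X powr \<gamma>"
    proof -
      have "X = (1 / (c * \<rho>\<^sup>2)) * (\<delta> / \<epsilon>)"
        by (simp add: X_def)
      then have "X powr \<gamma> = (1 / (c * \<rho>\<^sup>2)) powr \<gamma> * (\<delta> / \<epsilon>) powr \<gamma>"
        using \<open>\<delta> > 0\<close> \<epsilon> c(1) rho_pos by (simp only: powr_mult)
      then show ?thesis
        unfolding C_def \<delta>_eq by simp
    qed
    show ?thesis
    \<comment> \<open>Points at distance at least a fixed multiple of \<open>R\<close> need only the
      bound on the absolute value of \<open>u\<close>; for closer points the level of cells is
      adapted to their distance.\<close>
    proof (cases "\<delta> < c * \<rho> ^ m")
      case False
      have "c * \<rho>\<^sup>2 \<le> c * \<rho>"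
        using c(1) rho_pos rho_less_1 by (simp add: power2_eq_square mult_left_le)
      also have "c * \<rho> \<le> \<delta> / \<epsilon>"
      proof -
        have "c * \<rho> * \<epsilon> \<le> c * \<rho> ^ m"
          using m_gt c(1) by simp
        then show ?thesis
          using False \<epsilon>(1) by (simp add: field_simps)
      qed
      finally have "1 \<le> X"
        unfolding X_def using c(1) rho_pos by (subst le_divide_eq_1_pos) auto
      then have "1 \<le> X powr \<gamma>"
        using \<open>\<gamma> > 0\<close> by (simp add: ge_one_powr_ge_zero)
      then have one: "1 \<le> osc_const * X powr \<gamma>"
        using osc_const_ge_1 mult_mono[of 1 osc_const 1 "X powr \<gamma>"] by simp
      have "\<bar>u x - u y\<bar> \<le> 2 * (C1 * A)"
        using bound[OF x'(1) w_sub x'(2)] bound[OF y'(1) v_sub y'(2)] unfolding x'(3) y'(3) by linarith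
      also have "\<dots> \<le> 4 * (C1 * A)"
        using \<open>0 \<le> C1 * A\<close> by linarith
      also have "\<dots> \<le> 4 * (C1 * A) * (osc_const * X powr \<gamma>)"
        using mult_left_mono[OF one, of "4 * (C1 * A)"] \<open>0 \<le> C1 * A\<close> by simp
      finally show ?thesis
        unfolding C_eq by (simp add: mult_ac)
    next
      case True
      \<comment> \<open>One level above \<open>j\<close>, at \<open>m + d\<close>, the separation
        distance still exceeds \<open>\<delta>\<close>, so the cells of \<open>x\<close> and
        \<open>y\<close> meet there; \<open>c * \<rho> ^ j \<le> \<delta>\<close> in turn bounds
        \<open>\<rho> ^ d\<close> by \<open>X\<close>.\<close>
      define j where "j = (LEAST j. c * \<rho> ^ j \<le> \<delta>)"
      have exj: "\<exists>j. c * \<rho> ^ j \<le> \<delta>"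
        using rho_power_less[of "\<delta> / c"] \<open>\<delta> > 0\<close> c(1) by (auto simp: field_simps intro: less_imp_le)
      have j_le: "c * \<rho> ^ j \<le> \<delta>"
        unfolding j_def using exj by (rule LeastI_ex)
      have "j > m"
      proof (rule ccontr)
        assume "\<not> j > m"
        then have "c * \<rho> ^ m \<le> c * \<rho> ^ j"
          using c(1) rho_pos rho_less_1 by (intro mult_left_mono power_decreasing) auto
        then show False
          using j_le True by linarith
      qed
      then obtain d where d: "j = Suc (m + d)"
        using less_iff_Suc_add by blast
      have "\<not> c * \<rho> ^ (m + d) \<le> \<delta>"
        using not_less_Least[of "m + d" "\<lambda>j. c * \<rho> ^ j \<le> \<delta>"] d unfolding j_def by simp
      then have close: "\<delta> < c * \<rho> ^ (m + d)"
        by simp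
      obtain s x1 where s: "s \<in> W d" "x1 \<in> K" "x' = FW s x1"
        using K_cell[OF x'(2)] by blast
      obtain t y1 where t: "t \<in> W d" "y1 \<in> K" "y' = FW t y1"
        using K_cell[OF y'(2)] by blast
      have ws: "w @ s \<in> W (m + d)" and vt: "v @ t \<in> W (m + d)"
        using append_in_words x'(1) y'(1) s(1) t(1) by blast+
      have x_eq: "x = cell k (w @ s) x1" and y_eq: "y = cell k (v @ t) y1"
        using x'(3) y'(3) s(3) t(3) by (simp_all add: cell_append)
      have "dist (FW (w @ s) x1) (FW (v @ t) y1) = \<delta>"
        unfolding \<delta>_def x_eq y_eq dist_cell using rho_pos by simp
      then obtain z1 z2 where z: "z1 \<in> K" "z2 \<in> K" "FW (w @ s) z1 = FW (v @ t) z2"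
        using c(2)[OF ws vt s(2) t(2)] close by force
      have osc: "\<bar>u (cell k (w @ s) z) - u (cell k (w @ s) z')\<bar> \<le> osc_const * q ^ d * (2 * (C1 * A))"
        if "w \<in> W m" "cell k w ` K \<subseteq> ball x0 (2 * R) \<inter> BL n" "s \<in> W d" "z \<in> K" "z' \<in> K" for w s z z'
      proof -
        have "osc_le (u \<circ> cell k w) (2 * (C1 * A))"
          unfolding osc_le_def
        proof (intro ballI)
          fix p p' assume "p \<in> V" "p' \<in> V"
          then have "\<bar>u (cell k w p)\<bar> \<le> C1 * A" "\<bar>u (cell k w p')\<bar> \<le> C1 * A"
            using bound[OF that(1,2)] V_subset_K by blast+
          then show "\<bar>(u \<circ> cell k w) p - (u \<circ> cell k w) p'\<bar> \<le> 2 * (C1 * A)"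
            by simp
        qed
        from hext_osc[OF that(3-5) this] show ?thesis
          unfolding cell_append using harm[OF that(1,2)] FW_in_K[OF that(3)] that(4,5) by simp
      qed
      have "cell k (w @ s) z1 = cell k (v @ t) z2"
        using z(3) by (simp add: cell_def)
      then have "\<bar>u x - u y\<bar> \<le> 2 * (osc_const * q ^ d * (2 * (C1 * A)))"
        using osc[OF x'(1) w_sub s(1,2) z(1)] osc[OF y'(1) v_sub t(1,2) z(2)] x_eq y_eq by simp
      also have "\<dots> = 4 * osc_const * (C1 * A) * q ^ d"
        by simp
      also have "\<dots> \<le> 4 * osc_const * (C1 * A) * X powr \<gamma>"
      proof (rule mult_left_mono)
        have "q ^ d = (\<rho> ^ d) powr \<gamma>"
          using rho_pos by (simp add: q_eq \<gamma>_def powr_powr mult.commute flip: powr_realpow)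
        also have "\<dots> \<le> X powr \<gamma>"
        proof (rule powr_mono2)
          have "\<rho> ^ d * (\<epsilon> * (c * \<rho>\<^sup>2)) = (c * \<rho> * \<rho> ^ d) * (\<rho> * \<epsilon>)"
            by (simp add: power2_eq_square)
          also have "\<dots> \<le> (c * \<rho> * \<rho> ^ d) * \<rho> ^ m"
            using m_gt c(1) rho_pos by (intro mult_left_mono) auto
          also have "\<dots> = c * \<rho> ^ j"
            by (simp add: d power_add)
          also have "\<dots> \<le> \<delta>"
            by (rule j_le)
          finally show "\<rho> ^ d \<le> X"
            unfolding X_def using \<epsilon>(1) c(1) rho_pos by (simp add: field_simps)
        qed (use \<open>\<gamma> > 0\<close> rho_pos in auto)
        finally show "q ^ d \<le> X powr \<gamma>" .
        show "0 \<le> 4 * osc_const * (C1 * A)"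
          by (rule mult_nonneg_nonneg[OF _ \<open>0 \<le> C1 * A\<close>]) (use osc_const_ge_1 in simp)
      qed
      finally show ?thesis
        unfolding C_eq .
    qed
  qed
  show ?thesis
    unfolding \<gamma>_def[symmetric]
    by (intro exI[of _ C] conjI allI impI \<open>C > 0\<close>) (rule main[OF _ _ _ _ _ _ _ _ _ _ _ refl]; blast)
qed

text \<open>K_k is compact, so \<open>u\<close> is itself an admissible test function, and its
  energy vanishes.\<close>

lemma harmonic_everywhere_const:
  assumes harm: "harmonic_at (enat k) u (BL (enat k))" and xy: "x \<in> BL (enat k)" "y \<in> BL (enat k)"
  shows "u x = u y"
proof -
  have u: "u \<in> domain_at (enat k)" "continuous_on (BL (enat k)) u" "EN (rescale \<rho> k u) < \<infinity>"
    using harm unfolding harmonic_in_def domain_fin by auto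
  let ?S = "top_of_set (BL (enat k)) closure_of {x \<in> BL (enat k). u x \<noteq> 0}"
  have "closedin (top_of_set (BL (enat k))) ?S"
    by (rule closedin_closure_of)
  then have "compact ?S" "?S \<subseteq> BL (enat k)"
    using closedin_compact[OF compact_BL] closedin_imp_subset by blast+
  then have form0: "form_at (enat k) u u = 0"
    using harm u(1) unfolding harmonic_in_def Let_def by blast
  let ?f = "rescale \<rho> k u"
  have "(\<lambda>m. EL m ?f ?f) \<longlonglongrightarrow>
      (real_of_ereal (EN (\<lambda>x. ?f x + ?f x)) - real_of_ereal (EN (\<lambda>x. ?f x - ?f x))) / 4"
    using u(3) u(3) by (rule EL_LIMSEQ_polarization)
  then have "real_of_ereal (EN ?f) = (real_of_ereal (EN (\<lambda>x. ?f x + ?f x)) - real_of_ereal (EN (\<lambda>x. ?f x - ?f x))) / 4"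
    using EN_finite_LIMSEQ[OF u(3)] LIMSEQ_unique by blast
  moreover have "form_at (enat k) u u = q ^ k * ((real_of_ereal (EN (\<lambda>x. ?f x + ?f x)) - real_of_ereal (EN (\<lambda>x. ?f x - ?f x))) / 4)"
    unfolding blowup_form_def energy_fin rescale_add rescale_diff by (simp add: right_diff_distrib)
  ultimately have "real_of_ereal (EN ?f) = 0"
    using form0 q_pos by simp
  then have EN0: "EN ?f = 0"
    using u(3) EN_nonneg[of ?f] by (cases "EN ?f") auto
  have f_cont: "continuous_on K ?f"
    using continuous_on_comp_cell[OF u(2), of "[]" 0] by (simp add: comp_def cell_def rescale_def)
  obtain x' y' where "x' \<in> K" "y' \<in> K" "x = cell k [] x'" "y = cell k [] y'"
    using xy unfolding BL_enat by blast
  then show ?thesis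
    using EN_zero_imp_const[OF f_cont EN0, of x' y'] by (simp add: rescale_def cell_def)
qed

lemma holder_regularity:
  "\<exists>C>0. \<forall>x0\<in>BL n. \<forall>R>0. \<forall>u\<in>domain_at n. harmonic_at n u (blowup_ball \<rho> K n x0 (2 * R)) \<longrightarrow>
     (\<exists>N\<in>null_sets (blowup_measure \<rho> K \<alpha> n).
        \<forall>x\<in>blowup_ball \<rho> K n x0 R - N. \<forall>y\<in>blowup_ball \<rho> K n x0 R - N. x \<noteq> y \<longrightarrow>
          \<bar>u x - u y\<bar> / dist x y powr (\<beta> - \<alpha>)
            \<le> C / R powr (\<beta> - \<alpha>)
              * (1 / measure (blowup_measure \<rho> K \<alpha> n) (blowup_ball \<rho> K n x0 (2 * R))
                 * set_lebesgue_integral (blowup_measure \<rho> K \<alpha> n)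
                     (blowup_ball \<rho> K n x0 (2 * R)) (\<lambda>x. \<bar>u x\<bar>)))"
proof (cases "emeasure \<nu> K = 0")
  case True
  then show ?thesis
    \<comment> \<open>All of K_n is a null set and may be taken as the exceptional set, so any
      positive constant works.\<close>
    using BL_null by (intro exI[of _ 1]) (auto simp: blowup_ball_def intro!: bexI[of _ "BL n"])
next
  case False
  obtain C where C: "C > 0" and est_all: "\<forall>k x0 R n u x y. x0 \<in> BL (enat k) \<longrightarrow> 0 < R \<longrightarrow> R * \<rho> ^ k < 1 \<longrightarrow>
     ball x0 (2 * R) \<inter> BL n \<subseteq> BL (enat k) \<longrightarrow> enat k \<le> n \<longrightarrow> continuous_on (BL (enat k)) u \<longrightarrow>
     (\<forall>m w x. w \<in> W m \<longrightarrow> cell k w ` K \<subseteq> ball x0 (2 * R) \<inter> BL n \<longrightarrow> x \<in> K \<longrightarrow>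
        u (cell k w x) = hext (u \<circ> cell k w) x) \<longrightarrow> emeasure \<nu> K \<noteq> 0 \<longrightarrow>
     x \<in> ball x0 R \<inter> BL n \<longrightarrow> y \<in> ball x0 R \<inter> BL n \<longrightarrow> x \<noteq> y \<longrightarrow>
     \<bar>u x - u y\<bar> \<le> C * (1 / measure \<nu> (ball x0 (2 * R) \<inter> BL n) *
       (LINT x:ball x0 (2 * R) \<inter> BL n|\<nu>. \<bar>u x\<bar>)) * (dist x y / R) powr (\<beta> - \<alpha>)"
    using interior_estimate by blast
  note est = est_all[rule_format]
  have measure_eq: "measure (blowup_measure \<rho> K \<alpha> n) (ball x0 s \<inter> BL n) = measure \<nu> (ball x0 s \<inter> BL n)" for x0 s
    unfolding blowup_measure_def using BL_borel by (intro measure_restrict_space) auto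
  have integral_eq: "(LINT x:ball x0 s \<inter> BL n|blowup_measure \<rho> K \<alpha> n. \<bar>u x\<bar>) = (LINT x:ball x0 s \<inter> BL n|\<nu>. \<bar>u x\<bar>)"
    for x0 s and u :: "'a \<Rightarrow> real"
  proof -
    have "(LINT x:ball x0 s \<inter> BL n|blowup_measure \<rho> K \<alpha> n. \<bar>u x\<bar>)
        = (LINT x:ball x0 s \<inter> BL n|\<nu>. indicator (BL n) x *\<^sub>R \<bar>u x\<bar>)"
      unfolding blowup_measure_def using BL_borel by (intro set_integral_restrict_space) auto
    also have "\<dots> = (LINT x:ball x0 s \<inter> BL n|\<nu>. \<bar>u x\<bar>)"
      unfolding set_lebesgue_integral_def
      by (intro Bochner_Integration.integral_cong refl) (auto simp: indicator_def)
    finally show ?thesis .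
  qed
  have main: "\<bar>u x - u y\<bar> \<le> C * (1 / measure \<nu> (ball x0 (2 * R) \<inter> BL n) *
       (LINT x:ball x0 (2 * R) \<inter> BL n|\<nu>. \<bar>u x\<bar>)) * (dist x y / R) powr (\<beta> - \<alpha>)"
    if x0: "x0 \<in> BL n" and R: "R > 0" and harm: "harmonic_at n u (ball x0 (2 * R) \<inter> BL n)"
      and xy: "x \<in> ball x0 R \<inter> BL n" "y \<in> ball x0 R \<inter> BL n" "x \<noteq> y" for x0 R u x y
  proof (cases n)
    case (enat k)
    show ?thesis
    proof (cases "R * \<rho> ^ k < 1")
      case True
      have "continuous_on (BL (enat k)) u"
        using harm unfolding harmonic_in_def enat domain_fin by blast
      then show ?thesis
        using x0 R harm xy False True harmonic_on_cell_fin[of k u "ball x0 (2 * R) \<inter> BL n"]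
        unfolding enat by (intro est[of x0 k R "enat k" u]) auto
    next
      \<comment> \<open>The radius is at least the diameter of K_k, so the doubled ball is the whole
        set.\<close>
      case large: False
      have "BL n \<subseteq> ball x0 (2 * R)"
      proof
        fix z assume "z \<in> BL n"
        then obtain z' x0' where "z' \<in> K" "x0' \<in> K" "z = cell k [] z'" "x0 = cell k [] x0'"
          using x0 unfolding enat BL_enat by blast
        then have "dist x0 z \<le> 1 / \<rho> ^ k"
          using dist_K_le_1[of x0' z'] rho_pos by (simp add: dist_cell divide_right_mono)
        also have "\<dots> \<le> R"
          using large rho_pos by (simp add: field_simps)
        finally show "z \<in> ball x0 (2 * R)"
          using R by simp
      qed
      then have "ball x0 (2 * R) \<inter> BL n = BL (enat k)"
        unfolding enat by blast
      then have "u x = u y"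
        using harmonic_everywhere_const[of k u x y] harm xy unfolding enat by simp
      moreover have "0 \<le> (LINT x:ball x0 (2 * R) \<inter> BL n|\<nu>. \<bar>u x\<bar>)"
        unfolding set_lebesgue_integral_def by (intro Bochner_Integration.integral_nonneg) auto
      ultimately show ?thesis
        using C by simp
    qed
  next
    case infinity
    obtain l1 where l1: "x0 \<in> BL (enat l1)"
      using x0 unfolding infinity BL_inf by blast
    obtain l2 where l2: "ball x0 (2 * R) \<inter> BL \<infinity> \<subseteq> BL (enat l2)"
      using ball_in_BL[of x0 "2 * R"] x0 R unfolding infinity by auto
    obtain l3 where l3: "\<rho> ^ l3 < 1 / R"
      using rho_power_less R by (metis zero_less_divide_1_iff)
    \<comment> \<open>A stage that contains the centre and the doubled ball and whose diameter
      exceeds the radius.\<close>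
    define k where "k = max l1 (max l2 l3)"
    have "\<rho> ^ k \<le> \<rho> ^ l3"
      using rho_pos rho_less_1 by (intro power_decreasing) (auto simp: k_def)
    then have "\<rho> ^ k < 1 / R"
      using l3 by (rule le_less_trans)
    then have "R * \<rho> ^ k < 1"
      using R by (simp add: field_simps)
    moreover have "x0 \<in> BL (enat k)"
      using l1 BL_mono[of l1 k] by (auto simp: k_def)
    moreover have sub: "ball x0 (2 * R) \<inter> BL n \<subseteq> BL (enat k)"
      using l2 unfolding infinity by (rule subset_trans[OF _ BL_mono]) (simp add: k_def)
    moreover have "continuous_on (BL (enat k)) u"
      using harm BL_subset[of k] unfolding harmonic_in_def infinity blowup_domain_def
      by (auto intro: continuous_on_subset)
    moreover have "u (cell k w z) = hext (u \<circ> cell k w) z"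
      if "w \<in> W m" "cell k w ` K \<subseteq> ball x0 (2 * R) \<inter> BL n" "z \<in> K" for m w z
      using harm sub that unfolding infinity by (rule harmonic_on_cell_inf)
    ultimately show ?thesis
      using R xy False by (intro est[of x0 k R n u x y]) (auto simp: infinity)
  qed
  show ?thesis
    unfolding blowup_ball_def measure_eq integral_eq
  \<comment> \<open>The estimate holds for every pair of points, so the exceptional set is
    empty.\<close>
  proof (intro exI[of _ C] conjI ballI allI impI C bexI[of _ "{}"])
    fix x0 R u x y
    assume "x0 \<in> BL n" "0 < R" "harmonic_at n u (ball x0 (2 * R) \<inter> BL n)"
      "x \<in> ball x0 R \<inter> BL n - {}" "y \<in> ball x0 R \<inter> BL n - {}" "x \<noteq> y"
    then show "\<bar>u x - u y\<bar> / dist x y powr (\<beta> - \<alpha>) \<le> C / R powr (\<beta> - \<alpha>) *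
        (1 / measure \<nu> (ball x0 (2 * R) \<inter> BL n) * (LINT x:ball x0 (2 * R) \<inter> BL n|\<nu>. \<bar>u x\<bar>))"
      using main[of x0 R u x y] by (simp add: powr_divide field_simps)
  qed auto
qed

end

theorem theorem2p2:
  fixes M :: nat and \<rho> \<alpha> \<beta> :: real
    and a :: "nat \<Rightarrow> 'a::euclidean_space" and K :: "'a set"
    and H :: "'a \<Rightarrow> 'a \<Rightarrow> real" and r :: "nat \<Rightarrow> real"
    and n :: enat
  assumes "M \<ge> 2" and "0 < \<rho>" and "\<rho> < 1"
    and "\<exists>i\<in>{1..M}. a i = 0"
    and "is_attractor M \<rho> a K"
    and "post_critically_finite M \<rho> a K"
    and "connected K" and "diameter K = 1"
    and "\<alpha> = hausdorff_dim K" and "\<alpha> = - ln (real M) / ln \<rho>"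
    and "regular_harmonic_structure M \<rho> a K H r"
    and "\<forall>i\<in>{1..M}. r i = \<rho> powr (\<beta> - \<alpha>)"
  shows "\<exists>C>0. \<forall>x0\<in>blowup \<rho> K n. \<forall>R>0. \<forall>u\<in>blowup_domain M \<rho> a K H r \<alpha> \<beta> n.
           harmonic_in M \<rho> a K H r \<alpha> \<beta> n u (blowup_ball \<rho> K n x0 (2 * R)) \<longrightarrow>
           (\<exists>N\<in>null_sets (blowup_measure \<rho> K \<alpha> n).
              \<forall>x\<in>blowup_ball \<rho> K n x0 R - N. \<forall>y\<in>blowup_ball \<rho> K n x0 R - N. x \<noteq> y \<longrightarrow>
                \<bar>u x - u y\<bar> / dist x y powr (\<beta> - \<alpha>)
                  \<le> C / R powr (\<beta> - \<alpha>)
                    * (1 / measure (blowup_measure \<rho> K \<alpha> n) (blowup_ball \<rho> K n x0 (2 * R))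
                       * set_lebesgue_integral (blowup_measure \<rho> K \<alpha> n)
                           (blowup_ball \<rho> K n x0 (2 * R)) (\<lambda>x. \<bar>u x\<bar>)))"
proof -
  obtain i0 where i0: "i0 \<in> {1..M}" "a i0 = 0"
    using assms(4) by blast
  have "\<rho> powr (\<beta> - \<alpha>) < 1"
    using assms(11,12) i0 unfolding regular_harmonic_structure_def by force
  then interpret pcf_blowup M \<rho> a K H r "\<rho> powr (\<beta> - \<alpha>)" \<alpha> \<beta> i0
    using assms i0 by unfold_locales (auto simp: regular_harmonic_structure_def)
  show ?thesis
    by (rule holder_regularity)
qed

end
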